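(* For all integers $1\le n\le k$: if $\rho_{n,k}$ contains an irreducible $S^\lambda$ whose Young diagram has exactly $j$ columns (i.e. $\lambda_1=j$), then $n\le j\le k$.
   Context: All vector spaces are over $\mathbb C$. For $n\ge 2$, a Filippov $n$-algebra is a vector space $L$ with an $n$-linear map $[\cdot,\dots,\cdot]:L^n\to L$ satisfying $[x_1,\dots,x_n]=\mathrm{sgn}(\sigma)[x_{\sigma(1)},\dots,x_{\sigma(n)}]$ for all $\sigma\in\mathfrak S_n$, and $[[x_1,\dots,x_n],x_{n+1},\dots,x_{2n-1}]=\sum_{i=1}^n[x_1,\dots,x_{i-1},[x_i,x_{n+1},\dots,x_{2n-1}],x_{i+1},\dots,x_n]$. The free Filippov $n$-algebra on a set $X$ is generated by all $n$-ary bracketings of elements of $X$, subject only to relations following from $n$-linearity, antisymmetry and the generalized Jacobi identity. For $n\ge2$, $\rho_{n,k}$ is the multilinear component of the free Filippov $n$-algebra on $[k(n-1)+1]$ (span of $n$-bracketed words using each letter exactly once), an $\mathfrak S_{k(n-1)+1}$-module by permuting letters; by convention $\rho_{1,k}=S^1$. $S^\lambda$ denotes the Specht module indexed by $\lambda$. *)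

theory Defs
  imports
    Complex_Main
    "HOL-Library.Poly_Mapping"
    "HOL-Library.Multiset"
    "HOL-Combinatorics.Permutations"
    "HOL-Algebra.Module"
    "HOL-Algebra.AbelCoset"
begin

section \<open>Complex modules with an action of permutations\<close>

text \<open>
  A complex vector space together with an action of permutations of the natural numbers; the
  symmetric group on \<open>m\<close> letters is the set of all \<open>\<sigma>\<close> with \<open>\<sigma> permutes {1..m}\<close>. The ring
  multiplication and unit inherited from the record of modules play no role and are left
  undefined.
\<close>

record 'v perm_module = "(complex, 'v) module" +
  act :: "(nat \<Rightarrow> nat) \<Rightarrow> 'v \<Rightarrow> 'v"

definition perm_module_embedding ::
  "nat \<Rightarrow> 'v perm_module \<Rightarrow> 'w perm_module \<Rightarrow> ('v \<Rightarrow> 'w) \<Rightarrow> bool" where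
  "perm_module_embedding m M N f \<longleftrightarrow>
     f \<in> carrier M \<rightarrow> carrier N \<and>
     inj_on f (carrier M) \<and>
     (\<forall>x\<in>carrier M. \<forall>y\<in>carrier M. f (x \<oplus>\<^bsub>M\<^esub> y) = f x \<oplus>\<^bsub>N\<^esub> f y) \<and>
     (\<forall>c. \<forall>x\<in>carrier M. f (c \<odot>\<^bsub>M\<^esub> x) = c \<odot>\<^bsub>N\<^esub> f x) \<and>
     (\<forall>\<sigma>. \<sigma> permutes {1..m} \<longrightarrow> (\<forall>x\<in>carrier M. f (act M \<sigma> x) = act N \<sigma> (f x)))"

text \<open>\<open>N\<close> contains a submodule isomorphic to \<open>M\<close>.\<close>

definition has_submodule_iso :: "nat \<Rightarrow> 'w perm_module \<Rightarrow> 'v perm_module \<Rightarrow> bool" where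
  "has_submodule_iso m N M \<longleftrightarrow> (\<exists>f. perm_module_embedding m M N f)"

text \<open>
  The summand \<open>U\<close> in the scalar multiplication only matters for the scalar \<open>0\<close>, where
  \<open>(0 \<odot> _) ` A\<close> would be \<open>{0}\<close> instead of the zero coset \<open>U\<close>.
\<close>

definition quotient_perm_module :: "'v perm_module \<Rightarrow> 'v set \<Rightarrow> 'v set perm_module" where
  "quotient_perm_module M U =
     \<lparr>carrier = a_rcosets\<^bsub>M\<^esub> U, monoid.mult = undefined, one = undefined,
      zero = U, add = set_add M,
      smult = (\<lambda>c A. U <+>\<^bsub>M\<^esub> (smult M c ` A)),
      act = (\<lambda>\<sigma> A. act M \<sigma> ` A)\<rparr>"


section \<open>Formal linear combinations\<close>

definition lc_scale :: "complex \<Rightarrow> ('b \<Rightarrow>\<^sub>0 complex) \<Rightarrow> ('b \<Rightarrow>\<^sub>0 complex)" where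
  "lc_scale c p = Poly_Mapping.map ((*) c) p"

lemma lookup_lc_scale [simp]:
  "Poly_Mapping.lookup (lc_scale c p) b = c * Poly_Mapping.lookup p b"
  by (simp add: lc_scale_def Poly_Mapping.map.rep_eq when_def)

global_interpretation lc: vector_space lc_scale
  by unfold_locales
    (auto intro!: poly_mapping_eqI simp: lookup_add algebra_simps)

definition lc_over :: "'b set \<Rightarrow> ('b \<Rightarrow>\<^sub>0 complex) set" where
  "lc_over B = {p. Poly_Mapping.keys p \<subseteq> B}"

text \<open>The module of formal linear combinations of the elements of \<open>B\<close>, where \<open>\<sigma>\<close> acts on \<open>B\<close>
  by \<open>a \<sigma>\<close>.\<close>

definition lc_module ::
  "'b set \<Rightarrow> ((nat \<Rightarrow> nat) \<Rightarrow> 'b \<Rightarrow> 'b) \<Rightarrow> ('b \<Rightarrow>\<^sub>0 complex) perm_module" where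
  "lc_module B a =
     \<lparr>carrier = lc_over B, monoid.mult = undefined, one = undefined,
      zero = 0, add = (+), smult = lc_scale,
      act = (\<lambda>\<sigma> p. \<Sum>b\<in>Poly_Mapping.keys p.
                     Poly_Mapping.single (a \<sigma> b) (Poly_Mapping.lookup p b))\<rparr>"


section \<open>The free Filippov algebra\<close>

datatype 'a nword = Letter 'a | Bracket "'a nword list"

fun letters :: "'a nword \<Rightarrow> 'a list" where
  "letters (Letter x) = [x]"
| "letters (Bracket ws) = concat (map letters ws)"

inductive_set nwords :: "nat \<Rightarrow> 'a set \<Rightarrow> 'a nword set" for n :: nat and X :: "'a set" where
  Letter: "x \<in> X \<Longrightarrow> Letter x \<in> nwords n X"
| Bracket: "length ws = n \<Longrightarrow> (\<And>w. w \<in> set ws \<Longrightarrow> w \<in> nwords n X) \<Longrightarrow> Bracket ws \<in> nwords n X"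

text \<open>The multilinear extension of \<open>Bracket\<close> to linear combinations of words.\<close>

definition brk :: "('a nword \<Rightarrow>\<^sub>0 complex) list \<Rightarrow> ('a nword \<Rightarrow>\<^sub>0 complex)" where
  "brk ps =
     (\<Sum>ws\<in>{ws. list_all2 (\<lambda>w p. w \<in> Poly_Mapping.keys p) ws ps}.
        Poly_Mapping.single (Bracket ws) (\<Prod>i<length ps. Poly_Mapping.lookup (ps ! i) (ws ! i)))"

text \<open>
  All consequences of antisymmetry and of the generalized Jacobi identity: the least subspace of
  the space of linear combinations of \<open>n\<close>-bracketed words which contains all instances of these
  identities and is closed under bracketing with arbitrary elements.
\<close>

inductive_set filippov_ideal :: "nat \<Rightarrow> 'a set \<Rightarrow> ('a nword \<Rightarrow>\<^sub>0 complex) set"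
  for n :: nat and X :: "'a set" where
  zero: "0 \<in> filippov_ideal n X"
| add: "p \<in> filippov_ideal n X \<Longrightarrow> q \<in> filippov_ideal n X \<Longrightarrow> p + q \<in> filippov_ideal n X"
| scale: "p \<in> filippov_ideal n X \<Longrightarrow> lc_scale c p \<in> filippov_ideal n X"
| bracket:
    "length ps = n \<Longrightarrow> set ps \<subseteq> lc_over (nwords n X) \<Longrightarrow> i < n \<Longrightarrow>
     ps ! i \<in> filippov_ideal n X \<Longrightarrow> brk ps \<in> filippov_ideal n X"
| antisymmetry:
    "length ps = n \<Longrightarrow> set ps \<subseteq> lc_over (nwords n X) \<Longrightarrow> \<sigma> permutes {..<n} \<Longrightarrow>
     brk ps - lc_scale (of_int (sign \<sigma>)) (brk (map (\<lambda>i. ps ! \<sigma> i) [0..<n]))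
       \<in> filippov_ideal n X"
| jacobi:
    "length ps = n \<Longrightarrow> set ps \<subseteq> lc_over (nwords n X) \<Longrightarrow>
     length qs = n - 1 \<Longrightarrow> set qs \<subseteq> lc_over (nwords n X) \<Longrightarrow>
     brk (brk ps # qs) - (\<Sum>i<n. brk (ps[i := brk (ps ! i # qs)])) \<in> filippov_ideal n X"

definition free_filippov :: "nat \<Rightarrow> nat set \<Rightarrow> (nat nword \<Rightarrow>\<^sub>0 complex) set perm_module" where
  "free_filippov n X =
     quotient_perm_module (lc_module (nwords n X) map_nword) (filippov_ideal n X)"

definition multilinear_words :: "nat \<Rightarrow> nat set \<Rightarrow> nat nword set" where
  "multilinear_words n X = {w \<in> nwords n X. mset (letters w) = mset_set X}"

text \<open>The span of the classes of the multilinear words in the free Filippov algebra.\<close>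

definition multilinear_component ::
  "nat \<Rightarrow> nat set \<Rightarrow> (nat nword \<Rightarrow>\<^sub>0 complex) set perm_module" where
  "multilinear_component n X =
     (free_filippov n X)
       \<lparr>carrier := {filippov_ideal n X +>\<^bsub>lc_module (nwords n X) map_nword\<^esub> p | p.
                     p \<in> lc_over (multilinear_words n X)}\<rparr>"


section \<open>Specht modules\<close>

definition is_partition :: "nat \<Rightarrow> nat list \<Rightarrow> bool" where
  "is_partition m la \<longleftrightarrow> sorted_wrt (\<ge>) la \<and> 0 \<notin> set la \<and> sum_list la = m"

definition cells :: "nat list \<Rightarrow> (nat \<times> nat) set" where
  "cells la = {(i, j). i < length la \<and> j < la ! i}"

definition num_columns :: "nat list \<Rightarrow> nat" where
  "num_columns la = card (snd ` cells la)"

lemma num_columns_eq: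
  assumes "is_partition m la" and "la \<noteq> []"
  shows "num_columns la = la ! 0"
proof -
  have le: "la ! i \<le> la ! 0" if "i < length la" for i
    using assms(1) that by (cases "i = 0") (auto simp: is_partition_def sorted_wrt_iff_nth_less)
  have "snd ` cells la = {..<la ! 0}"
    using assms(2) le by (force simp: cells_def image_def)
  then show ?thesis
    by (simp add: num_columns_def)
qed

definition tableaux :: "nat list \<Rightarrow> (nat \<times> nat \<Rightarrow> nat) set" where
  "tableaux la = {t. bij_betw t (cells la) {1..sum_list la}}"

text \<open>The row equivalence class of a tableau, given by the list of its row sets.\<close>

definition tabloid :: "nat list \<Rightarrow> (nat \<times> nat \<Rightarrow> nat) \<Rightarrow> nat set list" where
  "tabloid la t = map (\<lambda>i. {t (i, j) | j. (i, j) \<in> cells la}) [0..<length la]"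

definition column_stabilizer :: "nat list \<Rightarrow> (nat \<times> nat \<Rightarrow> nat) \<Rightarrow> (nat \<Rightarrow> nat) set" where
  "column_stabilizer la t =
     {\<sigma>. \<sigma> permutes {1..sum_list la} \<and>
         (\<forall>j. \<sigma> ` {t (i, j) | i. (i, j) \<in> cells la} = {t (i, j) | i. (i, j) \<in> cells la})}"

definition polytabloid :: "nat list \<Rightarrow> (nat \<times> nat \<Rightarrow> nat) \<Rightarrow> (nat set list \<Rightarrow>\<^sub>0 complex)" where
  "polytabloid la t =
     (\<Sum>\<sigma>\<in>column_stabilizer la t.
        Poly_Mapping.single (tabloid la (\<sigma> \<circ> t)) (of_int (sign \<sigma>)))"

definition specht :: "nat list \<Rightarrow> (nat set list \<Rightarrow>\<^sub>0 complex) perm_module" where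
  "specht la =
     (lc_module (tabloid la ` tableaux la) (\<lambda>\<sigma>. map ((`) \<sigma>)))
       \<lparr>carrier := lc.span (polytabloid la ` tableaux la)\<rparr>"


section \<open>The modules \<open>\<rho>\<^sub>n\<^sub>,\<^sub>k\<close>\<close>

definition rho :: "nat \<Rightarrow> nat \<Rightarrow> (nat nword \<Rightarrow>\<^sub>0 complex) set perm_module" where
  "rho n k = multilinear_component n {1..k * (n - 1) + 1}"

text \<open>
  For \<open>n = 1\<close> the module is, by convention, the trivial module \<open>S\<^sup>1\<close> of the symmetric group on one
  letter, that is, the Specht module of the one-cell diagram, and not the value of the definition
  above. It has another element type, hence the case distinction is made here.
\<close>

definition rho_contains_specht :: "nat \<Rightarrow> nat \<Rightarrow> nat list \<Rightarrow> bool" where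
  "rho_contains_specht n k la \<longleftrightarrow>
     (if n = 1 then has_submodule_iso 1 (specht [1]) (specht la)
      else has_submodule_iso (k * (n - 1) + 1) (rho n k) (specht la))"

end

theory Submission
  imports Defs "HOL-Computational_Algebra.Polynomial"
begin

text \<open>
  Linear functionals on words which vanish on the ideal replace computations in the quotient.

  Upper bound: if \<open>\<lambda>\<^sub>1 > k\<close>, symmetrize a polytabloid over the letters of its first row. A word with
  \<open>k\<close> brackets then has two of these letters directly inside the same bracket, so by antisymmetry its
  symmetrization vanishes.

  Lower bound: put \<open>r = n - 1\<close> and suppose that \<open>\<lambda>\<close> has at most \<open>r\<close> columns, that is, that the letters
  are alternated in at most \<open>r\<close> classes. Left-normed words
  \<open>[\<dots>[[x\<^sub>0, P\<^sub>1], P\<^sub>2], \<dots>, P\<^sub>k]\<close> span, and after alternation they become a multilinear form \<open>\<Psi>\<close> in \<open>k r + 1\<close>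
  vectors of \<open>\<complex>\<^sup>r\<close> which is symmetric within each block \<open>P\<^sub>i\<close>. Two applications of the Jacobi identity
  turn into a quadratic equation for the \<open>sl\<^sub>2\<close>-Casimir operator which moves vectors between two
  consecutive blocks; it says that only spins 0 and 1 occur, so moving two vectors
  from one block to the next kills \<open>\<Psi>\<close>. By induction on \<open>j\<close>, the form then vanishes if the innermost blocks are powers of
  \<open>x\<^sub>1, \<dots>, x\<^sub>j\<close> and the next one contains \<open>w\<^sup>j\<close> with \<open>w\<close> in their span. For
  \<open>j = r\<close> the span is everything, and polarization gives \<open>\<Psi> = 0\<close> as soon as \<open>k > r\<close>.
\<close>

section \<open>Moving elements between two multisets\<close>

text \<open>Let F be the form as a function of two consecutive blocks P and Q, and F' the same with
  the blocks interchanged. Jacobi expresses the sum over all exchanges of one entry of P with one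
  entry of Q through F and F'. With R and L moving one vector to the next block and back, this
  becomes L R F = F - \<epsilon> F' with \<epsilon> = 1 or -1. Interchanging twice is the identity,
  so L R L R = 2 L R on F: this is the quadratic equation. No decomposition into irreducible
  sl2-modules is needed: injectivity of L in positive weight turns the equation into R R F = 0.
  Everything after that is bookkeeping with R R F = 0, which relates the values of F for different
  distributions of repeated vectors over the two blocks. The condition n \<le> k, that is r < k, is
  what the construction consumes: r independent vectors fill r blocks, and one more block is
  required in which every vector already lies in their span. For r = 1, the case of Lie algebras, a
  block has one entry and the equation is void; there the Jacobi identity on the first three letters
  starts the induction.\<close>

definition shiftR :: "('v multiset \<Rightarrow> 'v multiset \<Rightarrow> complex) \<Rightarrow> 'v multiset \<Rightarrow> 'v multiset \<Rightarrow> complex" where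
  "shiftR F P Q = (\<Sum>p\<in>#P. F (P - {#p#}) (add_mset p Q))"

definition shiftL :: "('v multiset \<Rightarrow> 'v multiset \<Rightarrow> complex) \<Rightarrow> 'v multiset \<Rightarrow> 'v multiset \<Rightarrow> complex" where
  "shiftL F P Q = (\<Sum>q\<in>#Q. F (add_mset q P) (Q - {#q#}))"

text \<open>The common off-diagonal part of \<open>shiftR (shiftL F)\<close> and
  \<open>shiftL (shiftR F)\<close>; it is the operator that the Jacobi identity controls.\<close>

definition exchange :: "('v multiset \<Rightarrow> 'v multiset \<Rightarrow> complex) \<Rightarrow> 'v multiset \<Rightarrow> 'v multiset \<Rightarrow> complex" where
  "exchange F P Q = (\<Sum>p\<in>#P. \<Sum>q\<in>#Q. F (add_mset q (P - {#p#})) (add_mset p (Q - {#q#})))"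

lemma shiftR_shiftL: "shiftR (shiftL F) P Q = of_nat (size P) * F P Q + exchange F P Q"
proof -
  have "shiftR (shiftL F) P Q =
    (\<Sum>p\<in>#P. F P Q + (\<Sum>q\<in>#Q. F (add_mset q (P - {#p#})) (add_mset p (Q - {#q#}))))"
    unfolding shiftR_def shiftL_def
    by (intro arg_cong[where f = sum_mset] image_mset_cong) (auto intro!: arg_cong[where f = sum_mset] image_mset_cong)
  then show ?thesis
    by (simp add: exchange_def sum_mset.distrib)
qed

lemma shiftL_shiftR: "shiftL (shiftR F) P Q = of_nat (size Q) * F P Q + exchange F P Q"
proof -
  have "shiftL (shiftR F) P Q =
    (\<Sum>q\<in>#Q. F P Q + (\<Sum>p\<in>#P. F (add_mset q (P - {#p#})) (add_mset p (Q - {#q#}))))"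
    unfolding shiftR_def shiftL_def
    by (intro arg_cong[where f = sum_mset] image_mset_cong) (auto intro!: arg_cong[where f = sum_mset] image_mset_cong)
  also have "\<dots> = of_nat (size Q) * F P Q + exchange F P Q"
    unfolding exchange_def by (subst sum_mset.swap) (simp add: sum_mset.distrib)
  finally show ?thesis .
qed

text \<open>The exchange parts cancel, which leaves the commutation relation of sl2.\<close>

lemma shift_commute:
  "shiftR (shiftL F) P Q = shiftL (shiftR F) P Q + (of_nat (size P) - of_nat (size Q)) * F P Q"
  by (simp add: shiftR_shiftL shiftL_shiftR algebra_simps)

text \<open>A support condition in place of a type of sized multisets. On the support, the factor in
  \<open>shift_commute\<close> is the scalar p - q.\<close>

definition bisized :: "nat \<Rightarrow> nat \<Rightarrow> ('v multiset \<Rightarrow> 'v multiset \<Rightarrow> complex) \<Rightarrow> bool" where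
  "bisized p q F \<longleftrightarrow> (\<forall>P Q. F P Q \<noteq> 0 \<longrightarrow> size P = p \<and> size Q = q)"

lemma sum_mset_eq_0: "(\<And>x. x \<in># M \<Longrightarrow> f x = 0) \<Longrightarrow> (\<Sum>x\<in>#M. f x) = (0::'b::comm_monoid_add)"
  by (induction M) auto

lemma bisized_shiftR:
  assumes "bisized p q F"
  shows "bisized (Suc p) (q - 1) (shiftR F)"
  unfolding bisized_def
proof (intro allI impI)
  fix P Q assume "shiftR F P Q \<noteq> 0"
  then obtain x where x: "x \<in># P" and nz: "F (P - {#x#}) (add_mset x Q) \<noteq> 0"
    unfolding shiftR_def by (meson sum_mset_eq_0)
  from assms[unfolded bisized_def, rule_format, OF nz] x size_Suc_Diff1[OF x]
  show "size P = Suc p \<and> size Q = q - 1" by (auto simp: size_Diff_singleton)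
qed

lemma bisized_shiftL:
  assumes "bisized p q F"
  shows "bisized (p - 1) (Suc q) (shiftL F)"
  unfolding bisized_def
proof (intro allI impI)
  fix P Q assume "shiftL F P Q \<noteq> 0"
  then obtain x where x: "x \<in># Q" and nz: "F (add_mset x P) (Q - {#x#}) \<noteq> 0"
    unfolding shiftL_def by (meson sum_mset_eq_0)
  from assms[unfolded bisized_def, rule_format, OF nz] x size_Suc_Diff1[OF x]
  show "size P = p - 1 \<and> size Q = Suc q" by (auto simp: size_Diff_singleton)
qed

lemma shift_scale:
  "shiftR (\<lambda>P Q. c * F P Q) = (\<lambda>P Q. c * shiftR F P Q)"
  "shiftL (\<lambda>P Q. c * F P Q) = (\<lambda>P Q. c * shiftL F P Q)"
  by (auto simp: shiftR_def shiftL_def sum_mset_distrib_left fun_eq_iff)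

lemma shift_diff:
  "shiftR (\<lambda>P Q. F P Q - G P Q) = (\<lambda>P Q. shiftR F P Q - shiftR G P Q)"
  "shiftL (\<lambda>P Q. F P Q - G P Q) = (\<lambda>P Q. shiftL F P Q - shiftL G P Q)"
proof -
  have "(\<Sum>x\<in>#M. f x - g x) = (\<Sum>x\<in>#M. f x) - (\<Sum>x\<in>#M. g x)" for f g :: "'a \<Rightarrow> complex" and M
    by (induction M) auto
  then show "shiftR (\<lambda>P Q. F P Q - G P Q) = (\<lambda>P Q. shiftR F P Q - shiftR G P Q)"
  "shiftL (\<lambda>P Q. F P Q - G P Q) = (\<lambda>P Q. shiftL F P Q - shiftL G P Q)"
    by (auto simp: shiftR_def shiftL_def fun_eq_iff)
qed

lemma shift_flip:
  "shiftR (\<lambda>P Q. F Q P) = (\<lambda>P Q. shiftL F Q P)"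
  "shiftL (\<lambda>P Q. F Q P) = (\<lambda>P Q. shiftR F Q P)"
  by (auto simp: shiftR_def shiftL_def fun_eq_iff)

lemma shift_0: "shiftR (\<lambda>P Q. 0) = (\<lambda>P Q. 0)" "shiftL (\<lambda>P Q. 0) = (\<lambda>P Q. 0)"
  by (auto simp: shiftR_def shiftL_def fun_eq_iff)

lemma bisized_funpow_shiftR: "bisized p q F \<Longrightarrow> bisized (p + t) (q - t) ((shiftR ^^ t) F)"
proof (induction t)
  case (Suc t)
  from bisized_shiftR[OF Suc.IH[OF Suc.prems]] show ?case by simp
qed simp

text \<open>The operators \<^const>\<open>shiftR\<close> and \<^const>\<open>shiftL\<close> generate an \<open>sl\<^sub>2\<close>, and \<open>p - q\<close> is the weight: there is no
  lowest weight vector of positive weight.\<close>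

lemma shiftL_inj:
  assumes F: "bisized p q F" and less: "q < p" and L: "shiftL F = (\<lambda>P Q. 0)"
  shows "F = (\<lambda>P Q. 0)"
proof -
  define G where "G t = (shiftR ^^ t) F" for t
  \<comment> \<open>\<open>c t\<close> is the sum of the weights p - q + 2 s over s \<le> t,
    collected when \<open>shiftL\<close> is commuted past t + 1 copies of
    \<open>shiftR\<close>.\<close>
  define c :: "nat \<Rightarrow> complex" where "c t = of_nat (Suc t) * of_nat (p - q + t)" for t
  have size: "bisized (p + t) (q - t) (G t)" for t
    using bisized_funpow_shiftR[OF F] by (simp add: G_def)
  have step: "shiftL (G (Suc t)) = (\<lambda>P Q. - c t * G t P Q)" if "t \<le> q" for t
    using that
  proof (induction t)
    case 0
    show ?case
    proof (intro ext)
      fix P Q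
      show "shiftL (G (Suc 0)) P Q = - c 0 * G 0 P Q"
      proof (cases "G 0 P Q = 0")
        case True
        then show ?thesis using shift_commute[of F P Q] L by (simp add: G_def shift_0)
      next
        case False
        with size[of 0] have "size P = p" "size Q = q" by (auto simp: bisized_def)
        then show ?thesis using shift_commute[of F P Q] L less
          by (simp add: G_def shift_0 c_def of_nat_diff algebra_simps)
      qed
    qed
  next
    case (Suc t)
    then have IH: "shiftL (G (Suc t)) = (\<lambda>P Q. - c t * G t P Q)" by simp
    show ?case
    proof (intro ext)
      fix P Q
      have eq: "- c t * G (Suc t) P Q =
          shiftL (G (Suc (Suc t))) P Q + (of_nat (size P) - of_nat (size Q)) * G (Suc t) P Q"
        using shift_commute[of "G (Suc t)" P Q] unfolding IH shift_scale by (simp add: G_def)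
      show "shiftL (G (Suc (Suc t))) P Q = - c (Suc t) * G (Suc t) P Q"
      proof (cases "G (Suc t) P Q = 0")
        case True
        then show ?thesis using eq by simp
      next
        case False
        with size[of "Suc t"] have "size P = p + Suc t" "size Q = q - Suc t" by (auto simp: bisized_def)
        then show ?thesis using eq less \<open>Suc t \<le> q\<close>
          by (simp add: c_def of_nat_diff algebra_simps)
      qed
    qed
  qed
  have c0: "c t \<noteq> 0" for t
    using less unfolding c_def by (simp del: of_nat_Suc of_nat_add)
  \<comment> \<open>\<open>G q\<close> lives on empty second multisets, where \<open>shiftL\<close>
    is an empty sum. From there the nonzero factors \<open>c\<close> carry the vanishing down to
    \<open>G 0\<close>.\<close>
  have zero: "G (q - t) = (\<lambda>P Q. 0)" if "t \<le> q" for t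
    using that
  proof (induction t)
    case 0
    show ?case
    proof (intro ext)
      fix P Q
      show "G (q - 0) P Q = 0"
      proof (rule ccontr)
        assume "G (q - 0) P Q \<noteq> 0"
        with size[of q] have "Q = {#}" by (auto simp: bisized_def)
        then have "shiftL (G (Suc q)) P Q = 0" by (simp add: shiftL_def)
        with step[of q] c0 \<open>G (q - 0) P Q \<noteq> 0\<close> show False by simp
      qed
    qed
  next
    case (Suc t)
    have "Suc (q - Suc t) = q - t" using Suc.prems by simp
    with step[of "q - Suc t"] Suc have "(\<lambda>P Q. - c (q - Suc t) * G (q - Suc t) P Q) = (\<lambda>P Q. 0)"
      by (simp add: shift_0)
    then show ?case using c0 by (simp add: fun_eq_iff)
  qed
  from zero[of q] show ?thesis by (simp add: G_def)
qed

text \<open>By the hypothesis, the Casimir operator \<open>L R\<close> satisfies \<open>L R (L R - 2) = 0\<close> on \<open>F\<close>. Its eigenvalue on spin \<open>d\<close> is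
  \<open>d (d + 1)\<close>, so only spins 0 and 1 occur.\<close>

lemma shiftR_shiftR_eq_0:
  assumes F: "bisized r r F" and \<epsilon>: "\<epsilon> * \<epsilon> = 1"
    and LR: "shiftL (shiftR F) = (\<lambda>P Q. F P Q - \<epsilon> * F Q P)"
  shows "shiftR (shiftR F) = (\<lambda>P Q. 0)"
proof (cases "r < 2")
  \<comment> \<open>For r < 2 the truncated sizes used below would be wrong, but two moved elements
    already exceed the size r of the second multiset.\<close>
  case True
  have "bisized (Suc (Suc r)) (r - 1 - 1) (shiftR (shiftR F))"
    by (intro bisized_shiftR F)
  show ?thesis
  proof (intro ext, rule ccontr)
    fix P Q assume "shiftR (shiftR F) P Q \<noteq> 0"
    then obtain p where "p \<in># P" "shiftR F (P - {#p#}) (add_mset p Q) \<noteq> 0"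
      unfolding shiftR_def[of "shiftR F"] by (meson sum_mset_eq_0)
    then obtain p' where nz: "F (P - {#p#} - {#p'#}) (add_mset p' (add_mset p Q)) \<noteq> 0"
      unfolding shiftR_def by (meson sum_mset_eq_0)
    from F[unfolded bisized_def, rule_format, OF nz] True show False by simp
  qed
next
  case False
  have RL: "shiftR (shiftL F) = shiftL (shiftR F)"
  proof (intro ext)
    fix P Q
    show "shiftR (shiftL F) P Q = shiftL (shiftR F) P Q"
      using shift_commute[of F P Q] F by (cases "F P Q = 0") (auto simp: bisized_def)
  qed
  \<comment> \<open>Interchanging the arguments turns L R into R L, which agrees with L R in weight
    0.\<close>
  have flip: "shiftL (shiftR (\<lambda>P Q. F Q P)) = (\<lambda>P Q. F Q P - \<epsilon> * F P Q)"
    unfolding shift_flip(1)[of F] shift_flip(2)[of "shiftL F"] RL LR ..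
  have LRLR: "shiftL (shiftR (shiftL (shiftR F))) = (\<lambda>P Q. 2 * shiftL (shiftR F) P Q)"
  proof -
    have "shiftL (shiftR (shiftL (shiftR F))) P Q = 2 * shiftL (shiftR F) P Q" for P Q
    proof -
      have "shiftL (shiftR (shiftL (shiftR F))) P Q = (F P Q - \<epsilon> * F Q P) - \<epsilon> * (F Q P - \<epsilon> * F P Q)"
        unfolding LR shift_diff shift_scale flip ..
      also have "\<dots> = (1 + \<epsilon> * \<epsilon>) * F P Q - 2 * \<epsilon> * F Q P" by (simp add: algebra_simps)
      finally show ?thesis unfolding \<epsilon> LR by (simp add: algebra_simps)
    qed
    then show ?thesis by blast
  qed
  define H where "H = shiftR (shiftR F)"
  have H: "bisized (Suc (Suc r)) (r - 2) H"
    using bisized_shiftR[OF bisized_shiftR[OF F]] by (simp add: H_def numeral_2_eq_2)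
  have LH: "shiftL H = (\<lambda>P Q. shiftR (shiftL (shiftR F)) P Q - 2 * shiftR F P Q)"
  proof (intro ext)
    fix P Q
    show "shiftL H P Q = shiftR (shiftL (shiftR F)) P Q - 2 * shiftR F P Q"
      using shift_commute[of "shiftR F" P Q] bisized_shiftR[OF F] False
      by (cases "shiftR F P Q = 0") (auto simp: bisized_def H_def of_nat_diff)
  qed
  \<comment> \<open>As \<open>shiftR F\<close> has weight 2, L L R R = L R L R - 2 L R on F. Both
    \<open>shiftL H\<close> and \<open>H\<close> have positive weight, so \<open>shiftL_inj\<close>
    strips the two L.\<close>
  have "shiftL (shiftL H) = (\<lambda>P Q. 0)"
    unfolding LH shift_diff shift_scale LRLR by simp
  moreover have "bisized (Suc r) (r - 1) (shiftL H)"
    using bisized_shiftL[OF H] False by (simp add: numeral_2_eq_2 Suc_diff_Suc)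
  ultimately have "shiftL H = (\<lambda>P Q. 0)"
    using shiftL_inj by fastforce
  from shiftL_inj[OF H _ this] show ?thesis
    by (simp add: H_def)
qed

section \<open>Vanishing rules for functions killed by two right shifts\<close>

lemma sum_mset_cong: "(\<And>x. x \<in># M \<Longrightarrow> f x = g x) \<Longrightarrow> (\<Sum>x\<in>#M. f x) = (\<Sum>x\<in>#M. g x)"
  by (metis image_mset_cong)

lemma shiftR_replicate:
  "shiftR F (replicate_mset b y + T) Q =
     of_nat b * F (replicate_mset (b - 1) y + T) (add_mset y Q)
     + (\<Sum>x\<in>#T. F (replicate_mset b y + (T - {#x#})) (add_mset x Q))"
proof -
  have eq: "F (replicate_mset b y + T - {#p#}) (add_mset p Q) = F (replicate_mset (b - 1) y + T) (add_mset y Q)"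
    if "p \<in># replicate_mset b y" for p
  proof -
    from that have "p = y" "b = Suc (b - 1)" by (auto split: if_splits)
    then have "replicate_mset b y + T = add_mset p (replicate_mset (b - 1) y + T)"
      by (metis replicate_mset_Suc union_mset_add_mset_left)
    with \<open>p = y\<close> show ?thesis by simp
  qed
  have "(\<Sum>p\<in>#replicate_mset b y. F (replicate_mset b y + T - {#p#}) (add_mset p Q))
      = (\<Sum>p\<in>#replicate_mset b y. F (replicate_mset (b - 1) y + T) (add_mset y Q))"
    by (rule sum_mset_cong) (rule eq)
  moreover have "(\<Sum>x\<in>#T. F (replicate_mset b y + T - {#x#}) (add_mset x Q))
      = (\<Sum>x\<in>#T. F (replicate_mset b y + (T - {#x#})) (add_mset x Q))"
    by (rule sum_mset_cong) (metis multiset_diff_union_assoc single_subset_iff)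
  ultimately show ?thesis by (simp add: shiftR_def)
qed

text \<open>The three terms correspond to two, one or no copies of y among the moved elements; the
  factor 2 counts the two orders in the mixed case.\<close>

lemma shiftR_shiftR_replicate:
  "shiftR (shiftR F) (replicate_mset (Suc (Suc b)) y + T) Q =
     of_nat (Suc (Suc b)) * of_nat (Suc b) * F (replicate_mset b y + T) (add_mset y (add_mset y Q))
     + 2 * of_nat (Suc (Suc b)) * (\<Sum>x\<in>#T. F (replicate_mset (Suc b) y + (T - {#x#})) (add_mset x (add_mset y Q)))
     + (\<Sum>x\<in>#T. \<Sum>x'\<in>#T - {#x#}. F (replicate_mset (Suc (Suc b)) y + (T - {#x#} - {#x'#})) (add_mset x' (add_mset x Q)))"
proof -
  have "shiftR (shiftR F) (replicate_mset (Suc (Suc b)) y + T) Q =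
     of_nat (Suc (Suc b)) * (of_nat (Suc b) * F (replicate_mset b y + T) (add_mset y (add_mset y Q))
       + (\<Sum>x\<in>#T. F (replicate_mset (Suc b) y + (T - {#x#})) (add_mset x (add_mset y Q))))
     + (\<Sum>x\<in>#T. of_nat (Suc (Suc b)) * F (replicate_mset (Suc b) y + (T - {#x#})) (add_mset y (add_mset x Q))
       + (\<Sum>x'\<in>#T - {#x#}. F (replicate_mset (Suc (Suc b)) y + (T - {#x#} - {#x'#})) (add_mset x' (add_mset x Q))))"
    unfolding shiftR_replicate[of "shiftR F"] shiftR_replicate[of F] by (simp only: diff_Suc_1)
  also have "(\<lambda>x. of_nat (Suc (Suc b)) * F (replicate_mset (Suc b) y + (T - {#x#})) (add_mset y (add_mset x Q))
       + (\<Sum>x'\<in>#T - {#x#}. F (replicate_mset (Suc (Suc b)) y + (T - {#x#} - {#x'#})) (add_mset x' (add_mset x Q))))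
    = (\<lambda>x. of_nat (Suc (Suc b)) * F (replicate_mset (Suc b) y + (T - {#x#})) (add_mset x (add_mset y Q))
       + (\<Sum>x'\<in>#T - {#x#}. F (replicate_mset (Suc (Suc b)) y + (T - {#x#} - {#x'#})) (add_mset x' (add_mset x Q))))"
    by (simp only: add_mset_commute)
  finally show ?thesis
    unfolding sum_mset.distrib sum_mset_distrib_left[symmetric] by (simp only: algebra_simps mult_2)
qed

text \<open>If P consists of copies of y only, both moved elements are y and a single term of the
  double shift is left.\<close>

lemma RR_power:
  assumes "shiftR (shiftR F) = (\<lambda>P Q. 0)"
  shows "F (replicate_mset b y) (add_mset y (add_mset y Q)) = 0"
  using shiftR_shiftR_replicate[of F b y "{#}" Q] of_nat_0_eq_iff[where 'a = complex]
  unfolding assms by (simp del: of_nat_Suc)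

text \<open>The double shift, taken with two more copies of w in P, expresses the value for i
  through values for i + 1 and i + 2; from i = a on the hypothesis applies. Since a < e, at least
  two copies of w are in Q as long as i < a.\<close>

lemma RR_few_moved:
  assumes RR: "shiftR (shiftR F) = (\<lambda>P Q. 0)"
    and a: "\<And>T Q. F (replicate_mset a w + T) Q = 0" and "a < e" "i \<le> e"
  shows "F (replicate_mset i w + T) (replicate_mset (e - i) w + Q) = 0"
  using \<open>i \<le> e\<close>
proof (induction "e - i" arbitrary: i T Q rule: less_induct)
  case less
  show ?case
  proof (cases "a \<le> i")
    case True
    then obtain d where "i = a + d" using le_Suc_ex by blast
    then have "replicate_mset i w = replicate_mset a w + replicate_mset d w"
      by (simp add: multiset_eq_iff)
    then show ?thesis using a[of "replicate_mset d w + T"] by (simp add: add.assoc)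
  next
    case False
    with \<open>a < e\<close> have i: "Suc (Suc i) \<le> e" by simp
    define Q' where "Q' = replicate_mset (e - i - 2) w + Q"
    have e1: "add_mset x (add_mset w Q') = replicate_mset (e - Suc i) w + add_mset x Q" for x
      using i unfolding Q'_def by (simp add: Suc_diff_Suc numeral_2_eq_2 add_mset_commute flip: replicate_mset_Suc union_mset_add_mset_left)
    have e2: "add_mset x (add_mset x' Q') = replicate_mset (e - Suc (Suc i)) w + add_mset x (add_mset x' Q)" for x x'
      unfolding Q'_def by (simp add: numeral_2_eq_2)
    have e0: "add_mset w (add_mset w Q') = replicate_mset (e - i) w + Q"
      using i unfolding Q'_def by (simp add: Suc_diff_Suc numeral_2_eq_2 flip: replicate_mset_Suc union_mset_add_mset_left)
    have one: "F (replicate_mset (Suc i) w + T') (add_mset x (add_mset w Q')) = 0" for T' x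
      unfolding e1 using i by (intro less.hyps) auto
    have two: "F (replicate_mset (Suc (Suc i)) w + T') (add_mset x (add_mset x' Q')) = 0" for T' x x'
      unfolding e2 using i by (intro less.hyps) auto
    have "of_nat (Suc (Suc i)) * of_nat (Suc i) * F (replicate_mset i w + T) (add_mset w (add_mset w Q')) = 0"
      using shiftR_shiftR_replicate[of F i w T Q'] unfolding RR one two by simp
    then show ?thesis
      unfolding e0 using of_nat_0_eq_iff[where 'a = complex] by (simp del: of_nat_Suc)
  qed
qed

text \<open>The constants solve the recursion in \<open>t\<close> which the hypothesis gives on the arguments
  containing \<open>y\<close> exactly \<open>r + 1\<close> times; what matters is that they do not vanish.\<close>

lemma RR_redistribute:
  assumes RR: "shiftR (shiftR F) = (\<lambda>P Q. 0)" and "t \<le> r" "size T = t"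
  shows "fact r * F (replicate_mset (r - t) y + T) (replicate_mset (Suc t) y + Q) =
     (- 1) ^ t * fact (Suc t) * fact (r - t) * F (replicate_mset r y) (add_mset y (T + Q))"
  using \<open>t \<le> r\<close> \<open>size T = t\<close>
proof (induction t arbitrary: T Q rule: less_induct)
  case (less t)
  let ?\<phi> = "F (replicate_mset r y) (add_mset y (T + Q))"
  show ?case
  proof (cases t)
    case 0
    then show ?thesis using less.prems by (simp add: mult_ac)
  next
    case (Suc s)
    define b where "b = r - t"
    define Q' where "Q' = replicate_mset s y + Q"
    have b1: "Suc b = r - s" "Suc (Suc b) = r - s + 1" using Suc less.prems by (auto simp: b_def)
    have one: "fact r * F (replicate_mset (Suc b) y + (T - {#x#})) (add_mset x (add_mset y Q'))
        = (- 1) ^ s * fact (Suc s) * fact (Suc b) * ?\<phi>" if "x \<in># T" for x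
    proof -
      have e1: "add_mset x (add_mset y Q') = replicate_mset (Suc s) y + add_mset x Q"
        by (simp add: Q'_def)
      have e2: "T - {#x#} + add_mset x Q = T + Q" using that by simp
      have "size (T - {#x#}) = s" using that less.prems Suc by (simp add: size_Diff_singleton)
      then show ?thesis
        unfolding e1 b1(1) using less.IH[of s "T - {#x#}" "add_mset x Q", unfolded e2] Suc less.prems
        by simp
    qed
    have two: "fact r * F (replicate_mset (Suc (Suc b)) y + (T - {#x#} - {#x'#})) (add_mset x' (add_mset x Q'))
        = (- 1) ^ (s - 1) * fact s * fact (Suc (Suc b)) * ?\<phi>"
      if "x \<in># T" "x' \<in># T - {#x#}" for x x'
    proof -
      have sz1: "size (T - {#x#}) = s"
        using size_Diff_singleton[OF that(1)] less.prems Suc by simp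
      have sz: "size (T - {#x#} - {#x'#}) = s - 1"
        using size_Diff_singleton[OF that(2)] unfolding sz1 .
      have s: "s = Suc (s - 1)" using that(2) sz1 by (cases s) auto
      have e1: "add_mset x' (add_mset x Q') = replicate_mset (Suc (s - 1)) y + add_mset x' (add_mset x Q)"
        using s by (simp add: Q'_def)
      have e2: "T - {#x#} - {#x'#} + add_mset x' (add_mset x Q) = T + Q"
      proof -
        from that(2) obtain T' where "T - {#x#} = add_mset x' T'" by (metis mset_add)
        with that(1) have "T = add_mset x (add_mset x' T')" by (metis insert_DiffM)
        then show ?thesis by simp
      qed
      have e3: "Suc (Suc b) = r - (s - 1)" using s Suc less.prems by (simp add: b_def)
      show ?thesis
        unfolding e1 e3 using less.IH[of "s - 1" "T - {#x#} - {#x'#}" "add_mset x' (add_mset x Q)", unfolded e2]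
          Suc less.prems sz s by simp
    qed
    have zero: "add_mset y (add_mset y Q') = replicate_mset (Suc t) y + Q"
      using Suc by (simp add: Q'_def)
    have s1: "(\<Sum>x\<in>#T. fact r * F (replicate_mset (Suc b) y + (T - {#x#})) (add_mset x (add_mset y Q')))
        = of_nat t * ((- 1) ^ s * fact (Suc s) * fact (Suc b) * ?\<phi>)"
      using less.prems one by (simp cong: image_mset_cong)
    have s2: "(\<Sum>x\<in>#T. \<Sum>x'\<in>#T - {#x#}. fact r * F (replicate_mset (Suc (Suc b)) y + (T - {#x#} - {#x'#})) (add_mset x' (add_mset x Q')))
        = of_nat t * (of_nat s * ((- 1) ^ (s - 1) * fact s * fact (Suc (Suc b)) * ?\<phi>))"
    proof -
      have "(\<Sum>x'\<in>#T - {#x#}. fact r * F (replicate_mset (Suc (Suc b)) y + (T - {#x#} - {#x'#})) (add_mset x' (add_mset x Q')))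
         = of_nat s * ((- 1) ^ (s - 1) * fact s * fact (Suc (Suc b)) * ?\<phi>)" if "x \<in># T" for x
        using two[OF that] that less.prems Suc by (simp add: size_Diff_singleton cong: image_mset_cong)
      then show ?thesis using less.prems by (simp cong: image_mset_cong)
    qed
    have "0 = fact r * shiftR (shiftR F) (replicate_mset (Suc (Suc b)) y + T) Q'"
      by (simp add: RR)
    also have "\<dots> = of_nat (Suc (Suc b)) * of_nat (Suc b) * (fact r * F (replicate_mset b y + T) (replicate_mset (Suc t) y + Q))
       + 2 * of_nat (Suc (Suc b)) * (of_nat t * ((- 1) ^ s * fact (Suc s) * fact (Suc b) * ?\<phi>))
       + of_nat t * (of_nat s * ((- 1) ^ (s - 1) * fact s * fact (Suc (Suc b)) * ?\<phi>))"
      unfolding shiftR_shiftR_replicate zero distrib_left s1[symmetric] s2[symmetric]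
      by (simp only: sum_mset_distrib_left mult_ac)
    \<comment> \<open>For \<open>s = 0\<close> the exponent \<open>s - 1\<close> is truncated, but
      the factor \<open>s\<close> vanishes.\<close>
    also have "of_nat t * (of_nat s * ((- 1) ^ (s - 1) * fact s * fact (Suc (Suc b)) * ?\<phi>))
       = - ((- 1) ^ s * of_nat t * of_nat s * fact s * fact (Suc (Suc b)) * ?\<phi>)"
      by (cases s) auto
    also have "of_nat (Suc (Suc b)) * of_nat (Suc b) * (fact r * F (replicate_mset b y + T) (replicate_mset (Suc t) y + Q))
       + 2 * of_nat (Suc (Suc b)) * (of_nat t * ((- 1) ^ s * fact (Suc s) * fact (Suc b) * ?\<phi>))
       + - ((- 1) ^ s * of_nat t * of_nat s * fact s * fact (Suc (Suc b)) * ?\<phi>)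
      = of_nat (Suc (Suc b)) * of_nat (Suc b) * (fact r * F (replicate_mset b y + T) (replicate_mset (Suc t) y + Q)
          - (- 1) ^ t * fact (Suc t) * fact b * ?\<phi>)"
    proof -
      \<comment> \<open>\<open>A\<close> and \<open>B\<close> stand for \<open>s\<close> and
        \<open>b\<close>, \<open>f\<close> and \<open>g\<close> for their factorials, and
        \<open>\<sigma>\<close> for the sign \<open>(- 1) ^ s\<close>.\<close>
      have alg: "(B + 2) * (B + 1) * X + 2 * (B + 2) * ((A + 1) * (\<sigma> * ((A + 1) * f) * ((B + 1) * g) * \<phi>))
          + - (\<sigma> * (A + 1) * A * f * ((B + 2) * ((B + 1) * g)) * \<phi>)
        = (B + 2) * (B + 1) * (X - (- 1 * \<sigma>) * ((A + 2) * ((A + 1) * f)) * g * \<phi>)"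
        for A B X \<sigma> f g \<phi> :: complex
        by (simp add: algebra_simps)
      have "complex_of_nat (Suc n) = of_nat n + 1" "complex_of_nat (Suc (Suc n)) = of_nat n + 2"
        "fact (Suc n) = (complex_of_nat n + 1) * fact n"
        "fact (Suc (Suc n)) = (complex_of_nat n + 2) * ((of_nat n + 1) * fact n)" for n
        by (simp_all add: algebra_simps)
      then show ?thesis
        unfolding \<open>t = Suc s\<close> power_Suc by (simp only: alg)
    qed
    finally show ?thesis
      unfolding b_def[symmetric] using of_nat_0_eq_iff[where 'a = complex] by (simp del: of_nat_Suc)
  qed
qed

text \<open>Trades T against copies of y in the other block. The constants in
  \<open>RR_redistribute\<close> are nonzero, so vanishing carries over to the value at which P is a
  pure power.\<close>

lemma RR_redistribute_eq_0:
  assumes RR: "shiftR (shiftR F) = (\<lambda>P Q. 0)" and "size T \<le> r"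
    and "F (replicate_mset (r - size T) y + T) (replicate_mset (Suc (size T)) y + Q) = 0"
  shows "F (replicate_mset r y) (add_mset y (T + Q)) = 0"
  using RR_redistribute[OF RR \<open>size T \<le> r\<close> refl, of y Q] assms(3)
  by (simp del: fact_Suc of_nat_Suc)

section \<open>Multilinear forms of left-normed words\<close>

text \<open>A line x + t y with x outside \<open>H\<close> meets \<open>H\<close> for at most one t.
  Hence f at the power (x + t y)^(s+2) is a polynomial in t with infinitely many zeros, and its
  linear coefficient, a nonzero multiple of f at y x^(s+1), vanishes; y then stays fixed for the
  induction. The exceptional subspace \<open>H\<close> allows test vectors to be taken outside the
  span of vectors chosen before.\<close>

lemma polarization:
  fixes f :: "('b \<Rightarrow>\<^sub>0 complex) multiset \<Rightarrow> complex"
  assumes W: "lc.subspace W" and H: "lc.subspace H" and h: "h \<in> W" "h \<notin> H"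
    and add: "\<And>M x y. size M = s \<Longrightarrow> f (add_mset (x + y) M) = f (add_mset x M) + f (add_mset y M)"
    and scale: "\<And>M c x. size M = s \<Longrightarrow> f (add_mset (lc_scale c x) M) = c * f (add_mset x M)"
    and diag: "\<And>x. x \<in> W \<Longrightarrow> x \<notin> H \<Longrightarrow> f (replicate_mset (Suc s) x) = 0"
    and P: "set_mset P \<subseteq> W" "size P = Suc s"
  shows "f P = 0"
  using add scale diag P
proof (induction s arbitrary: f P)
  case (0 f)
  note add = 0(1) and scale = 0(2) and diag = 0(3)
  from 0 obtain y where P: "P = {#y#}" by (metis size_1_singleton_mset One_nat_def)
  show ?case
  proof (cases "y \<in> H")
    case True
    then have "y + h \<notin> H" using lc.subspace_diff[OF H, of "y + h" y] h by auto
    moreover have "y + h \<in> W" using lc.subspace_add[OF W] 0 P h by auto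
    ultimately show ?thesis using add[of "{#}" y h] diag[of "y + h"] diag[of h] h P by simp
  next
    case False
    then show ?thesis using diag[of y] 0 P by simp
  qed
next
  case (Suc s f)
  note add = Suc.prems(1) and scale = Suc.prems(2) and diag = Suc.prems(3)
  have key: "f (add_mset y (replicate_mset (Suc s) x)) = 0" if "x \<in> W" "x \<notin> H" "y \<in> W" for x y
  proof -
    \<comment> \<open>Only the two lowest coefficients are tracked: the constant one feeds the
      linear one when a factor x + t y is split. For \<open>b = 0\<close> the truncated
      \<open>b - 1\<close> comes with the factor 0.\<close>
    have poly: "\<exists>q. (\<forall>t. f (replicate_mset b (x + lc_scale t y) + M) = poly q t) \<and>
       coeff q 0 = f (replicate_mset b x + M) \<and>
       coeff q 1 = of_nat b * f (add_mset y (replicate_mset (b - 1) x) + M)"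
      if "b + size M = Suc (Suc s)" for b M
      using that
    proof (induction b arbitrary: M)
      case 0
      show ?case by (intro exI[of _ "[:f M:]"]) auto
    next
      case (Suc b)
      obtain q1 where q1: "\<And>t. f (replicate_mset b (x + lc_scale t y) + add_mset x M) = poly q1 t"
        "coeff q1 0 = f (replicate_mset b x + add_mset x M)"
        "coeff q1 1 = of_nat b * f (add_mset y (replicate_mset (b - 1) x) + add_mset x M)"
        using Suc.IH[of "add_mset x M"] Suc.prems by auto
      obtain q2 where q2: "\<And>t. f (replicate_mset b (x + lc_scale t y) + add_mset y M) = poly q2 t"
        "coeff q2 0 = f (replicate_mset b x + add_mset y M)"
        using Suc.IH[of "add_mset y M"] Suc.prems by auto
      have "f (replicate_mset (Suc b) (x + lc_scale t y) + M) = poly (q1 + pCons 0 q2) t" for t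
        using add[of "replicate_mset b (x + lc_scale t y) + M" x "lc_scale t y"]
          scale[of "replicate_mset b (x + lc_scale t y) + M" t y] q1(1)[of t] q2(1)[of t] Suc.prems
        by simp
      moreover have "of_nat b * f (add_mset y (replicate_mset (b - 1) x) + add_mset x M)
          = of_nat b * f (add_mset y (replicate_mset b x) + M)"
        by (cases b) (auto simp: add_mset_commute)
      ultimately show ?case
        using q1(2,3) q2(2)
        by (intro exI[of _ "q1 + pCons 0 q2"]) (auto simp: algebra_simps)
    qed
    obtain q where q: "\<And>t. f (replicate_mset (Suc (Suc s)) (x + lc_scale t y)) = poly q t"
       "coeff q 1 = of_nat (Suc (Suc s)) * f (add_mset y (replicate_mset (Suc s) x))"
      using poly[of "Suc (Suc s)" "{#}"] by auto
    have bad: "t = t'" if "x + lc_scale t y \<in> H" "x + lc_scale t' y \<in> H" for t t'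
    proof (rule ccontr)
      assume "t \<noteq> t'"
      have "(x + lc_scale t y) - (x + lc_scale t' y) = lc_scale (t - t') y"
        by (simp add: lc.scale_left_diff_distrib)
      then have "lc_scale (1 / (t - t')) (lc_scale (t - t') y) \<in> H"
        using that lc.subspace_diff[OF H] lc.subspace_scale[OF H] by metis
      then have "y \<in> H" using \<open>t \<noteq> t'\<close> by (simp add: lc.scale_one)
      with that(1) have "x \<in> H"
        using lc.subspace_diff[OF H, of "x + lc_scale t y" "lc_scale t y"] lc.subspace_scale[OF H] by auto
      with \<open>x \<notin> H\<close> show False by simp
    qed
    have fin: "finite {t. x + lc_scale t y \<in> H}"
    proof (cases "{t. x + lc_scale t y \<in> H} = {}")
      case False
      then obtain t where "x + lc_scale t y \<in> H" by auto
      with bad have "{t. x + lc_scale t y \<in> H} \<subseteq> {t}" by auto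
      then show ?thesis using finite_subset by blast
    qed simp
    have "q = 0"
    proof (rule ccontr)
      assume "q \<noteq> 0"
      have "UNIV \<subseteq> {t. x + lc_scale t y \<in> H} \<union> {t. poly q t = 0}"
      proof
        fix t :: complex
        have "x + lc_scale t y \<in> W"
          using \<open>x \<in> W\<close> \<open>y \<in> W\<close> by (intro lc.subspace_add[OF W] lc.subspace_scale[OF W])
        then show "t \<in> {t. x + lc_scale t y \<in> H} \<union> {t. poly q t = 0}"
          using q(1)[of t] diag[of "x + lc_scale t y"] by auto
      qed
      then have "finite (UNIV :: complex set)"
        using fin poly_roots_finite[OF \<open>q \<noteq> 0\<close>] by (meson finite_Un finite_subset)
      then show False by (simp add: infinite_UNIV_char_0)
    qed
    then show ?thesis using q(2) of_nat_0_eq_iff[where 'a = complex] by (simp del: of_nat_Suc)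
  qed
  from Suc.prems(5) obtain y P' where P: "P = add_mset y P'" "size P' = Suc s"
    by (metis size_eq_Suc_imp_eq_union size_add_mset nat.inject)
  have "f (add_mset y P') = 0"
  proof (rule Suc.IH[of "\<lambda>M. f (add_mset y M)"])
    fix M :: "('b \<Rightarrow>\<^sub>0 complex) multiset" and x z c assume "size M = s"
    then show "f (add_mset y (add_mset (x + z) M)) = f (add_mset y (add_mset x M)) + f (add_mset y (add_mset z M))"
      and "f (add_mset y (add_mset (lc_scale c x) M)) = c * f (add_mset y (add_mset x M))"
      using add[of "add_mset y M" x z] scale[of "add_mset y M" c x] by (simp_all add: add_mset_commute)
  qed (use key Suc.prems P in auto)
  then show ?case by (simp add: P)
qed

section \<open>Symmetric blocks and their reduction to powers of vectors\<close>

definition list_of_mset :: "'a multiset \<Rightarrow> 'a list" where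
  "list_of_mset M = (SOME xs. mset xs = M)"

lemma mset_list_of_mset [simp]: "mset (list_of_mset M) = M"
  unfolding list_of_mset_def by (rule someI_ex) (rule ex_mset)

lemma length_list_of_mset [simp]: "length (list_of_mset M) = size M"
  by (metis mset_list_of_mset size_mset)

text \<open>The first block has length \<open>r + 1\<close>, all others have length \<open>r\<close>; hence the prefixes
  of length \<open>Suc (b * r)\<close>. For \<open>r = 1\<close> the assumption \<open>exchange\<close> may be trivial (\<open>\<epsilon> = - 1\<close>), which is why \<open>cube\<close>
  is needed.\<close>

locale comb_form =
  fixes r m :: nat and \<Psi> :: "('b \<Rightarrow>\<^sub>0 complex) list \<Rightarrow> complex"
  assumes r: "1 \<le> r"
    and add: "length A + length B + 1 = m \<Longrightarrow> \<Psi> (A @ (x + y) # B) = \<Psi> (A @ x # B) + \<Psi> (A @ y # B)"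
    and scale: "length A + length B + 1 = m \<Longrightarrow> \<Psi> (A @ lc_scale c x # B) = c * \<Psi> (A @ x # B)"
    and sym_first: "length P = Suc r \<Longrightarrow> length P + length B = m \<Longrightarrow> mset P = mset P' \<Longrightarrow> \<Psi> (P @ B) = \<Psi> (P' @ B)"
    and sym: "length A = Suc (b * r) \<Longrightarrow> length P = r \<Longrightarrow> length A + r + length B = m \<Longrightarrow> mset P = mset P' \<Longrightarrow>
       \<Psi> (A @ P @ B) = \<Psi> (A @ P' @ B)"
    and exchange: "length A = Suc (b * r) \<Longrightarrow> length A + r + r + length B = m \<Longrightarrow>
       \<exists>\<epsilon>. \<epsilon> * \<epsilon> = 1 \<and> (\<forall>P Q. length P = r \<longrightarrow> length Q = r \<longrightarrow>
         (\<Sum>i<r. \<Sum>l<r. \<Psi> (A @ P[i := Q ! l] @ Q[l := P ! i] @ B))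
           + of_nat (r - 1) * \<Psi> (A @ P @ Q @ B) + \<epsilon> * \<Psi> (A @ Q @ P @ B) = 0)"
    and cube: "r = 1 \<Longrightarrow> length B + 3 = m \<Longrightarrow> \<Psi> (x # x # x # B) = 0"
begin

text \<open>The cut-off at sizes (r, r) makes the function \<open>bisized\<close>. After a prefix of
  length \<open>Suc (b * r)\<close> the value is independent of the chosen orderings by
  \<open>sym\<close>.\<close>

definition blocks where
  "blocks A B P Q =
     (if size P = r \<and> size Q = r then \<Psi> (A @ list_of_mset P @ list_of_mset Q @ B) else 0)"

lemma bisized_blocks: "bisized r r (blocks A B)"
  by (auto simp: bisized_def blocks_def split: if_splits)

lemma blocks_mset:
  assumes A: "length A = Suc (b * r)" and m: "length A + r + r + length B = m"
    and "length P = r" "length Q = r"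
  shows "blocks A B (mset P) (mset Q) = \<Psi> (A @ P @ Q @ B)"
proof -
  have "blocks A B (mset P) (mset Q) = \<Psi> (A @ list_of_mset (mset P) @ list_of_mset (mset Q) @ B)"
    using assms by (simp add: blocks_def)
  also have "\<dots> = \<Psi> (A @ P @ list_of_mset (mset Q) @ B)"
    using sym[of A b "list_of_mset (mset P)" "list_of_mset (mset Q) @ B" P] assms by simp
  also have "\<dots> = \<Psi> (A @ P @ Q @ B)"
    using sym[of "A @ P" "Suc b" "list_of_mset (mset Q)" B Q] assms by simp
  finally show ?thesis .
qed

lemma sum_mset_mset_nth: "(\<Sum>x\<in>#mset xs. f x) = (\<Sum>i<length xs. f (xs ! i))"
proof -
  have "(\<Sum>x\<in>#mset xs. f x) = sum_list (map f xs)"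
    by (simp flip: sum_mset_sum_list)
  also have "\<dots> = (\<Sum>i<length xs. f (xs ! i))"
    by (simp add: sum_list_sum_nth atLeast0LessThan)
  finally show ?thesis .
qed

text \<open>The diagonal part of L R contributes r F and the assumption \<open>exchange\<close>
  contributes - (r - 1) F - \<epsilon> F', where F' has the blocks interchanged; this is the
  hypothesis of \<open>shiftR_shiftR_eq_0\<close>.\<close>

lemma RR_blocks:
  assumes A: "length A = Suc (b * r)" and m: "length A + r + r + length B = m"
  shows "shiftR (shiftR (blocks A B)) = (\<lambda>P Q. 0)"
proof -
  obtain \<epsilon> where \<epsilon>: "\<epsilon> * \<epsilon> = 1" and J: "\<And>P Q. length P = r \<Longrightarrow> length Q = r \<Longrightarrow>
         (\<Sum>i<r. \<Sum>l<r. \<Psi> (A @ P[i := Q ! l] @ Q[l := P ! i] @ B))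
           + of_nat (r - 1) * \<Psi> (A @ P @ Q @ B) + \<epsilon> * \<Psi> (A @ Q @ P @ B) = 0"
    using exchange[OF A m] by blast
  have "shiftL (shiftR (blocks A B)) P Q = blocks A B P Q - \<epsilon> * blocks A B Q P" for P Q
  proof (cases "size P = r \<and> size Q = r")
    case True
    define p q where "p = list_of_mset P" and "q = list_of_mset Q"
    have [simp]: "mset p = P" "mset q = Q" and pq: "length p = r" "length q = r"
      using True by (simp_all add: p_def q_def)
    have "exchange (blocks A B) P Q = (\<Sum>x\<in>#mset p. \<Sum>y\<in>#mset q.
        blocks A B (add_mset y (P - {#x#})) (add_mset x (Q - {#y#})))"
      by (simp add: exchange_def)
    also have "\<dots> = (\<Sum>i<r. \<Sum>l<r. blocks A B (mset (p[i := q ! l])) (mset (q[l := p ! i])))"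
      unfolding sum_mset_mset_nth pq by (intro sum.cong refl) (simp add: mset_update pq)
    also have "\<dots> = (\<Sum>i<r. \<Sum>l<r. \<Psi> (A @ p[i := q ! l] @ q[l := p ! i] @ B))"
      using pq by (intro sum.cong refl blocks_mset[OF A m]) auto
    also have "\<dots> = - of_nat (r - 1) * blocks A B P Q - \<epsilon> * blocks A B Q P"
    proof -
      have "a = - b - c" if "a + b + c = 0" for a b c :: complex
      proof -
        have "a = (a + b + c) - b - c" by simp
        with that show ?thesis by simp
      qed
      from this[OF J[OF pq]] show ?thesis
        using blocks_mset[OF A m pq] blocks_mset[OF A m pq(2) pq(1)] by simp
    qed
    finally show ?thesis
      using shiftL_shiftR[of "blocks A B" P Q] True r by (simp add: of_nat_diff algebra_simps)
  next
    case False
    have "bisized r r (shiftL (shiftR (blocks A B)))"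
      using bisized_shiftL[OF bisized_shiftR[OF bisized_blocks]] r by simp
    with False have "shiftL (shiftR (blocks A B)) P Q = 0" unfolding bisized_def by blast
    with False show ?thesis by (auto simp: blocks_def)
  qed
  then show ?thesis by (intro shiftR_shiftR_eq_0[OF bisized_blocks \<epsilon>]) blast
qed

lemma blocks_linear:
  assumes A: "length A = Suc (b * r)" and m: "length A + r + r + length B = m"
    and P: "size P = r" and Q: "Suc (size Q) = r"
  shows "blocks A B P (add_mset (x + y) Q) = blocks A B P (add_mset x Q) + blocks A B P (add_mset y Q)"
    and "blocks A B P (add_mset (lc_scale c x) Q) = c * blocks A B P (add_mset x Q)"
proof -
  have eq: "blocks A B P (add_mset z Q) = \<Psi> ((A @ list_of_mset P) @ z # (list_of_mset Q @ B))" for z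
    using blocks_mset[OF A m, of "list_of_mset P" "z # list_of_mset Q"] P Q by simp
  show "blocks A B P (add_mset (x + y) Q) = blocks A B P (add_mset x Q) + blocks A B P (add_mset y Q)"
    and "blocks A B P (add_mset (lc_scale c x) Q) = c * blocks A B P (add_mset x Q)"
    unfolding eq using P Q m by (intro add scale; simp)+
qed

text \<open>The innermost bracket has r + 1 entries, so the first vector is taken once more:
  x_1^(r+1) x_2^r ... x_j^r.\<close>

definition prefix where
  "prefix xs = hd xs # concat (map (replicate r) xs)"

lemma length_prefix: "length (prefix xs) = Suc (length xs * r)"
  unfolding prefix_def by (induction xs) auto

lemma prefix_snoc: "xs \<noteq> [] \<Longrightarrow> prefix (xs @ [x]) = prefix xs @ replicate r x"
  by (simp add: prefix_def)

text \<open>For r \<ge> 2, take an entry v of V. With v in the first block and two x in the second,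
  symmetry of the whole first block makes v its isolated first letter; P is then a pure power of x
  and \<open>RR_power\<close> applies. \<open>RR_redistribute_eq_0\<close> moves v to the second
  block. For r = 1 there is no such v, and \<open>cube\<close> takes over.\<close>

lemma prefix_power_first:
  assumes w: "w \<in> lc.span {x}" and V: "Suc (length V) = r"
    and m: "length (prefix [x]) + r + length B = m"
  shows "\<Psi> (prefix [x] @ w # V @ B) = 0"
proof -
  have pre: "prefix [x] = replicate (Suc r) x" by (simp add: prefix_def)
  have len: "Suc r + r + length B = m" using m by (simp add: length_prefix)
  obtain c where c: "w = lc_scale c x" using w by (auto simp: lc.span_singleton)
  have "\<Psi> (prefix [x] @ x # V @ B) = 0"
  proof (cases V)
    case Nil
    with V have "r = 1" by simp
    with Nil show ?thesis unfolding pre using cube[of B x] len by simp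
  next
    case (Cons v V')
    have len1: "length [z] + r + r + length B = m" "length [z] = Suc (0 * r)" for z :: "'b \<Rightarrow>\<^sub>0 complex"
      using len by auto
    have r': "r = Suc (Suc (length V'))" using V Cons by simp
    have "blocks [x] B (mset (v # replicate (r - 1) x)) (mset (x # x # V'))
        = \<Psi> ((x # v # replicate (r - 1) x) @ (x # x # V' @ B))"
      by (subst blocks_mset[OF len1(2,1)]) (use r' in auto)
    also have "\<dots> = \<Psi> ((v # replicate r x) @ (x # x # V' @ B))"
      using len r' by (intro sym_first) auto
    also have "\<dots> = blocks [v] B (mset (replicate r x)) (mset (x # x # V'))"
      by (subst blocks_mset[OF len1(2,1)]) (use r' in auto)
    also have "\<dots> = 0"
      using RR_power[OF RR_blocks[OF len1(2,1)], of v r x "mset V'"] by simp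
    finally have "blocks [x] B (replicate_mset r x) (add_mset x ({#v#} + mset V')) = 0"
      using r' by (intro RR_redistribute_eq_0[OF RR_blocks[OF len1(2,1)]]) auto
    moreover have "blocks [x] B (mset (replicate r x)) (mset (x # V)) = \<Psi> (prefix [x] @ x # V @ B)"
      by (subst blocks_mset[OF len1(2,1)]) (use V in \<open>auto simp: pre\<close>)
    ultimately show ?thesis by (simp add: Cons)
  qed
  then show ?thesis
    using scale[of "prefix [x]" "V @ B" c x] len V by (simp add: c pre)
qed

text \<open>Write \<open>w = u + c y\<close> with \<open>u\<close> in the span of the previous vectors and expand \<open>w\<close>: the terms with no,
  one, and at least two factors \<open>y\<close> vanish by \<open>RR_few_moved\<close>, \<open>RR_redistribute_eq_0\<close> and \<open>RR_power\<close>, respectively.\<close>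

lemma prefix_power:
  assumes "xs \<noteq> []" and "w \<in> lc.span (set xs)" and "length xs + length V = r"
    and "length (prefix xs) + r + length B = m"
  shows "\<Psi> (prefix xs @ replicate (length xs) w @ V @ B) = 0"
  using assms
proof (induction xs arbitrary: w V B rule: rev_nonempty_induct)
  case (single x)
  then show ?case using prefix_power_first[of w x V B] by simp
next
  case (snoc y xs)
  define a where "a = length xs"
  define F where "F = blocks (prefix xs) B"
  have A: "length (prefix xs) = Suc (a * r)" by (simp add: length_prefix a_def)
  have m: "length (prefix xs) + r + r + length B = m"
    using snoc.prems by (simp add: length_prefix)
  have RR: "shiftR (shiftR F) = (\<lambda>P Q. 0)" unfolding F_def by (rule RR_blocks[OF A m])
  have r_eq: "r = Suc (a + length V)" using snoc.prems by (simp add: a_def)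
  obtain c where "w - lc_scale c y \<in> lc.span (set xs)"
    using snoc.prems(1) by (auto simp: lc.span_insert)
  then obtain u where u: "u \<in> lc.span (set xs)" "w = u + lc_scale c y"
    by (metis diff_add_cancel)
  \<comment> \<open>The induction hypothesis read as a statement on \<open>F\<close>: it vanishes as
    soon as P contains u^a.\<close>
  have few: "F (replicate_mset a u + T) Q = 0" for T Q
  proof (cases "size T + a = r \<and> size Q = r")
    case True
    have "F (mset (replicate a u @ list_of_mset T)) (mset (list_of_mset Q))
       = \<Psi> (prefix xs @ (replicate a u @ list_of_mset T) @ list_of_mset Q @ B)"
      unfolding F_def by (rule blocks_mset[OF A m]) (use True in auto)
    also have "\<dots> = 0"
      using snoc.IH[OF u(1), of "list_of_mset T" "list_of_mset Q @ B"] True m by (simp add: a_def)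
    finally show ?thesis by simp
  qed (auto simp: F_def blocks_def)
  \<comment> \<open>\<open>c1\<close> counts the factors \<open>w\<close> not yet expanded into u +
    c y, while \<open>a1\<close> and \<open>b1\<close> count the factors y and u produced so
    far.\<close>
  have "F (replicate_mset r y) (replicate_mset a1 y + replicate_mset b1 u + replicate_mset c1 w + mset V) = 0"
    if "a1 + b1 + c1 = Suc a" for a1 b1 c1
    using that
  proof (induction c1 arbitrary: a1 b1)
    case 0
    consider "a1 = 0" "b1 = Suc a" | "a1 = 1" "b1 = a" | d where "a1 = Suc (Suc d)"
      using 0 by (metis One_nat_def Suc_inject add.right_neutral add_0 add_Suc not0_implies_Suc)
    then show ?case
    proof cases
      case 1
      then show ?thesis
        using RR_few_moved[OF RR few, of "Suc a" 0 "replicate_mset r y" "mset V"] by simp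
    next
      case 2
      have "F (replicate_mset r y) (add_mset y (replicate_mset a u + mset V)) = 0"
      proof (rule RR_redistribute_eq_0[OF RR])
        show "size (replicate_mset a u) \<le> r" using r_eq by simp
        show "F (replicate_mset (r - size (replicate_mset a u)) y + replicate_mset a u)
          (replicate_mset (Suc (size (replicate_mset a u))) y + mset V) = 0"
          by (subst add.commute) (rule few)
      qed
      with 2 show ?thesis by simp
    next
      case 3
      then show ?thesis using RR_power[OF RR] by simp
    qed
  next
    case (Suc c1)
    let ?Q = "replicate_mset a1 y + replicate_mset b1 u + replicate_mset c1 w + mset V"
    have size: "size (replicate_mset r y) = r" "Suc (size ?Q) = r"
      using Suc.prems r_eq by auto
    have "F (replicate_mset r y) (add_mset (u + lc_scale c y) ?Q) =
      F (replicate_mset r y) (add_mset u ?Q) + c * F (replicate_mset r y) (add_mset y ?Q)"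
      unfolding F_def blocks_linear[OF A m size] ..
    then have "F (replicate_mset r y) (add_mset w ?Q) =
      F (replicate_mset r y) (add_mset u ?Q) + c * F (replicate_mset r y) (add_mset y ?Q)"
      by (simp only: u(2)[symmetric])
    moreover have "F (replicate_mset r y) (add_mset u ?Q) = 0"
      using Suc.IH[of a1 "Suc b1"] Suc.prems by simp
    moreover have "F (replicate_mset r y) (add_mset y ?Q) = 0"
      using Suc.IH[of "Suc a1" b1] Suc.prems by simp
    ultimately show ?case by simp
  qed
  from this[of 0 0 "Suc a"]
  have "F (mset (replicate r y)) (mset (replicate (Suc a) w @ V)) = 0" by simp
  also have "F (mset (replicate r y)) (mset (replicate (Suc a) w @ V))
     = \<Psi> (prefix xs @ replicate r y @ (replicate (Suc a) w @ V) @ B)"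
    unfolding F_def by (rule blocks_mset[OF A m]) (use r_eq in auto)
  finally show ?case
    using snoc.hyps by (simp add: prefix_snoc a_def)
qed

lemma block_eq_0:
  assumes W: "lc.subspace W" and H: "lc.subspace H" and h: "h \<in> W" "h \<notin> H"
    and sym: "\<And>P P'. length P = Suc s \<Longrightarrow> mset P = mset P' \<Longrightarrow> \<Psi> (A @ P @ B) = \<Psi> (A @ P' @ B)"
    and diag: "\<And>x. x \<in> W \<Longrightarrow> x \<notin> H \<Longrightarrow> \<Psi> (A @ replicate (Suc s) x @ B) = 0"
    and P: "set P \<subseteq> W" "length P = Suc s" and m: "length A + Suc s + length B = m"
  shows "\<Psi> (A @ P @ B) = 0"
proof -
  define f where "f M = \<Psi> (A @ list_of_mset M @ B)" for M
  have f: "f (mset P) = \<Psi> (A @ P @ B)" if "length P = Suc s" for P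
    unfolding f_def using that by (intro sym) auto
  have f_add: "f (add_mset z M) = \<Psi> (A @ z # (list_of_mset M @ B))" if "size M = s" for z M
    using f[of "z # list_of_mset M"] that by simp
  have "f (mset P) = 0"
  proof (rule polarization[OF W H h])
    show "f (replicate_mset (Suc s) x) = 0" if "x \<in> W" "x \<notin> H" for x
      using f[of "replicate (Suc s) x"] diag[OF that] by simp
    fix M :: "('b \<Rightarrow>\<^sub>0 complex) multiset" and x y c assume M: "size M = s"
    show "f (add_mset (x + y) M) = f (add_mset x M) + f (add_mset y M)"
      unfolding f_add[OF M] using m M by (intro add) simp
    show "f (add_mset (lc_scale c x) M) = c * f (add_mset x M)"
      unfolding f_add[OF M] using m M by (intro scale) simp
  qed (use P in auto)
  with f P show ?thesis by simp
qed

text \<open>Polarization in the block behind the prefix reduces that block to a power of one vector.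
  A vector in the span of the earlier ones may be excluded, so the longer prefix is independent
  again. Once there are r vectors nothing lies outside their span, and \<open>prefix_power\<close>
  kills the power in the next block.\<close>

theorem comb_form_eq_0:
  assumes E: "finite E" "lc.independent E" "card E = r"
    and m: "m = Suc (k * r)" "r < k"
    and L: "set L \<subseteq> lc.span E" "length L = m"
  shows "\<Psi> L = 0"
proof -
  define W where "W = lc.span E"
  have W: "lc.subspace W" unfolding W_def by (rule lc.subspace_span)
  have ext: "\<exists>h. h \<in> W \<and> h \<notin> lc.span (set xs)" if "length xs < r" for xs
  proof (rule ccontr)
    assume "\<not> ?thesis"
    then have "E \<subseteq> lc.span (set xs)" using lc.span_superset unfolding W_def by blast
    then have "card E \<le> card (set xs)" using lc.independent_span_bound E by blast
    with that E card_length[of xs] show False by simp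
  qed
  have *: "\<Psi> (prefix xs @ L) = 0"
    if "xs \<noteq> []" "distinct xs" "lc.independent (set xs)" "set xs \<subseteq> W" "length xs \<le> r"
      "set L \<subseteq> W" "length (prefix xs) + length L = m" for xs L
    using that
  proof (induction "r - length xs" arbitrary: xs L)
    case 0
    then have len: "length xs = r" by simp
    have "W \<subseteq> lc.span (set xs)"
    proof -
      have "E \<subseteq> lc.span (set xs)"
      proof
        fix e assume "e \<in> E"
        show "e \<in> lc.span (set xs)"
        proof (rule ccontr)
          assume e: "e \<notin> lc.span (set xs)"
          then have "lc.independent (insert e (set xs))" using 0 by (simp add: lc.independent_insert)
          moreover have "insert e (set xs) \<subseteq> lc.span E"
            using 0 \<open>e \<in> E\<close> lc.span_base by (auto simp: W_def)
          ultimately have "card (insert e (set xs)) \<le> card E"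
            using lc.independent_span_bound E by blast
          moreover have "e \<notin> set xs" using e lc.span_base by blast
          ultimately show False using E len distinct_card[OF \<open>distinct xs\<close>] by simp
        qed
      qed
      then show ?thesis unfolding W_def using lc.span_mono lc.span_span by metis
    qed
    \<comment> \<open>Here r < k enters: a full block must remain behind the r blocks of the
      prefix.\<close>
    have "r * r + r \<le> k * r" using m by (metis Suc_leI add.commute mult_Suc mult_le_mono1)
    then have lenL: "r \<le> length L" using 0 m len by (simp add: length_prefix)
    define P B where "P = take r L" and "B = drop r L"
    have PB: "L = P @ B" "length P = Suc (r - 1)" "set P \<subseteq> W"
      using lenL r set_take_subset[of r L] 0 by (auto simp: P_def B_def)
    obtain h where h: "h \<in> W" "h \<notin> lc.span {}"
      using ext[of "[]"] r by auto
    have "\<Psi> (prefix xs @ P @ B) = 0"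
    proof (rule block_eq_0[OF W lc.subspace_span h, of "r - 1"])
      show "\<Psi> (prefix xs @ P @ B) = \<Psi> (prefix xs @ P' @ B)" if "length P = Suc (r - 1)" "mset P = mset P'" for P P'
        by (rule sym[OF length_prefix]) (use that 0 PB r in auto)
      show "\<Psi> (prefix xs @ replicate (Suc (r - 1)) x @ B) = 0" if "x \<in> W" for x
        using prefix_power[of xs x "[]" B] that \<open>W \<subseteq> lc.span (set xs)\<close> 0 PB r len by auto
    qed (use PB 0 r in auto)
    then show ?case by (simp add: PB)
  next
    case (Suc d)
    then have less: "length xs < r" by simp
    have "length xs * r + r \<le> k * r" using m less
      by (metis Suc_leI add.commute less_trans mult_Suc mult_le_mono1)
    then have lenL: "r \<le> length L" using Suc.prems m by (simp add: length_prefix)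
    define P B where "P = take r L" and "B = drop r L"
    have PB: "L = P @ B" "length P = Suc (r - 1)" "set P \<subseteq> W" "set B \<subseteq> W"
      using lenL r set_take_subset[of r L] set_drop_subset[of r L] Suc.prems by (auto simp: P_def B_def)
    obtain h where h: "h \<in> W" "h \<notin> lc.span (set xs)"
      using ext[OF less] by auto
    have "\<Psi> (prefix xs @ P @ B) = 0"
    proof (rule block_eq_0[OF W lc.subspace_span h, of "r - 1"])
      show "\<Psi> (prefix xs @ P @ B) = \<Psi> (prefix xs @ P' @ B)" if "length P = Suc (r - 1)" "mset P = mset P'" for P P'
        by (rule sym[OF length_prefix]) (use that Suc.prems PB r in auto)
      show "\<Psi> (prefix xs @ replicate (Suc (r - 1)) x @ B) = 0" if x: "x \<in> W" "x \<notin> lc.span (set xs)" for x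
      proof -
        have "x \<notin> set xs" using x lc.span_base by blast
        then have "\<Psi> (prefix (xs @ [x]) @ B) = 0"
          using Suc.prems Suc.hyps(2) x PB r less
          by (intro Suc.hyps(1)) (auto simp: lc.independent_insert prefix_snoc)
        then show ?thesis using Suc.prems r by (simp add: prefix_snoc)
      qed
    qed (use PB Suc.prems r in auto)
    then show ?case by (simp add: PB)
  qed
  define P B where "P = take (Suc r) L" and "B = drop (Suc r) L"
  have "r \<le> k * r" using m by simp
  then have PB: "L = P @ B" "length P = Suc r" "set P \<subseteq> W" "set B \<subseteq> W" "length P + length B = m"
    using set_take_subset[of "Suc r" L] set_drop_subset[of "Suc r" L] L m
    by (auto simp: P_def B_def W_def)
  obtain h where h: "h \<in> W" "h \<notin> lc.span {}" using ext[of "[]"] r by auto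
  \<comment> \<open>The first block has length r + 1 and its own symmetry \<open>sym_first\<close>,
    so it is polarized separately.\<close>
  have "\<Psi> ([] @ P @ B) = 0"
  proof (rule block_eq_0[OF W lc.subspace_span h])
    show "\<Psi> ([] @ P @ B) = \<Psi> ([] @ P' @ B)" if "length P = Suc r" "mset P = mset P'" for P P'
      using sym_first[of P B P'] that PB by simp
    show "\<Psi> ([] @ replicate (Suc r) x @ B) = 0" if "x \<in> W" "x \<notin> lc.span {}" for x
    proof -
      have "\<Psi> (prefix [x] @ B) = 0"
        using that PB r by (intro *) (auto simp: length_prefix)
      then show ?thesis by (simp add: prefix_def)
    qed
  qed (use PB in auto)
  then show ?thesis by (simp add: PB)
qed

end

section \<open>Functionals vanishing on the ideal\<close>

abbreviation word :: "'a nword \<Rightarrow> ('a nword \<Rightarrow>\<^sub>0 complex)" where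
  "word w \<equiv> Poly_Mapping.single w 1"

text \<open>The linear functional with prescribed values on a basis. Functionals are kept as plain
  functions on words, so that bracketing and relabelling of letters act on them by
  composition.\<close>

definition ext :: "('b \<Rightarrow> complex) \<Rightarrow> ('b \<Rightarrow>\<^sub>0 complex) \<Rightarrow> complex" where
  "ext \<theta> p = (\<Sum>w\<in>Poly_Mapping.keys p. Poly_Mapping.lookup p w * \<theta> w)"

lemma ext_superset:
  "finite S \<Longrightarrow> Poly_Mapping.keys p \<subseteq> S \<Longrightarrow> ext \<theta> p = (\<Sum>w\<in>S. Poly_Mapping.lookup p w * \<theta> w)"
  unfolding ext_def by (rule sum.mono_neutral_left) (auto simp: in_keys_iff)

lemma ext_zero [simp]: "ext \<theta> 0 = 0"
  by (simp add: ext_def)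

lemma ext_add [simp]: "ext \<theta> (p + q) = ext \<theta> p + ext \<theta> q"
proof -
  let ?S = "Poly_Mapping.keys p \<union> Poly_Mapping.keys q"
  show ?thesis
    using ext_superset[of ?S p \<theta>] ext_superset[of ?S q \<theta>]
      ext_superset[of ?S "p + q" \<theta>] Poly_Mapping.keys_add[of p q]
    by (simp add: lookup_add algebra_simps sum.distrib)
qed

lemma ext_scale [simp]: "ext \<theta> (lc_scale c p) = c * ext \<theta> p"
  using ext_superset[of "Poly_Mapping.keys p" "lc_scale c p" \<theta>]
  by (force simp: ext_def sum_distrib_left in_keys_iff mult.assoc)

lemma ext_single [simp]: "ext \<theta> (Poly_Mapping.single w c) = c * \<theta> w"
  using ext_superset[of "{w}" "Poly_Mapping.single w c" \<theta>] by (simp split: if_splits)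

lemma ext_sum [simp]: "ext \<theta> (sum f A) = (\<Sum>x\<in>A. ext \<theta> (f x))"
  by (induction A rule: infinite_finite_induct) auto

lemma ext_diff [simp]: "ext \<theta> (p - q) = ext \<theta> p - ext \<theta> q"
  using ext_add[of \<theta> "p - q" q] by (simp add: algebra_simps)

lemma subspace_lc_over: "lc.subspace (lc_over B)"
proof (rule lc.subspaceI)
  fix p q :: "'a \<Rightarrow>\<^sub>0 complex" and c
  assume "p \<in> lc_over B"
  then show "lc_scale c p \<in> lc_over B" by (auto simp: lc_over_def in_keys_iff)
  assume "q \<in> lc_over B"
  with \<open>p \<in> lc_over B\<close> show "p + q \<in> lc_over B"
    using Poly_Mapping.keys_add[of p q] by (auto simp: lc_over_def)
qed (simp add: lc_over_def)

lemma single_in_lc_over: "w \<in> B \<Longrightarrow> Poly_Mapping.single w c \<in> lc_over B"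
  by (simp add: lc_over_def)

lemma Bracket_in_nwords_iff: "Bracket ws \<in> nwords n X \<longleftrightarrow> length ws = n \<and> set ws \<subseteq> nwords n X"
  by (auto elim: nwords.cases intro: nwords.intros)

lemma Letter_in_nwords_iff: "Letter x \<in> nwords n X \<longleftrightarrow> x \<in> X"
  by (auto elim: nwords.cases intro: nwords.intros)

text \<open>All other factors have a single key with coefficient 1, so only the key in the remaining
  slot varies.\<close>

lemma brk_slot:
  "brk (map word us @ p # map word vs) =
     (\<Sum>w\<in>Poly_Mapping.keys p. Poly_Mapping.single (Bracket (us @ w # vs)) (Poly_Mapping.lookup p w))"
proof -
  let ?ps = "map word us @ p # map word vs"
  have words: "list_all2 (\<lambda>w p. w \<in> Poly_Mapping.keys p) ws (map word us) \<longleftrightarrow> ws = us" for ws us :: "'a nword list"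
    by (simp add: list_all2_map2 list.rel_eq)
  have set: "{ws. list_all2 (\<lambda>w p. w \<in> Poly_Mapping.keys p) ws ?ps} = (\<lambda>w. us @ w # vs) ` Poly_Mapping.keys p"
    by (auto simp: list_all2_append2 list_all2_Cons2 words)
  have prod: "(\<Prod>i<length ?ps. Poly_Mapping.lookup (?ps ! i) ((us @ w # vs) ! i)) = Poly_Mapping.lookup p w" for w
  proof -
    have "Poly_Mapping.lookup (?ps ! i) ((us @ w # vs) ! i) = (if i = length us then Poly_Mapping.lookup p w else 1)"
      if "i < length ?ps" for i
      using that by (auto simp: nth_append nth_Cons split: nat.splits)
    then have "(\<Prod>i<length ?ps. Poly_Mapping.lookup (?ps ! i) ((us @ w # vs) ! i))
       = (\<Prod>i<length ?ps. if i = length us then Poly_Mapping.lookup p w else 1)"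
      by (intro prod.cong) auto
    then show ?thesis by simp
  qed
  show ?thesis
    unfolding brk_def set prod by (subst sum.reindex) (auto simp: inj_on_def prod simp del: length_append)
qed

lemma brk_words: "ws \<noteq> [] \<Longrightarrow> brk (map word ws) = word (Bracket ws)"
  using brk_slot[of "[]" "word (hd ws)" "tl ws"] by (cases ws) auto

lemma brk_in_lc_over:
  assumes "length ps = n" "set ps \<subseteq> lc_over (nwords n X)"
  shows "brk ps \<in> lc_over (nwords n X)"
  unfolding brk_def
proof (intro lc.subspace_sum[OF subspace_lc_over] single_in_lc_over)
  fix ws assume "ws \<in> {ws. list_all2 (\<lambda>w p. w \<in> Poly_Mapping.keys p) ws ps}"
  with assms show "Bracket ws \<in> nwords n X"
    unfolding Bracket_in_nwords_iff lc_over_def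
    by (auto simp: list_all2_conv_all_nth in_set_conv_nth) (metis nth_mem subsetD mem_Collect_eq)
qed

lemma ideal_in_lc_over:
  assumes "p \<in> filippov_ideal n X" "0 < n"
  shows "p \<in> lc_over (nwords n X)"
  using assms(1)
proof induction
  case zero
  show ?case using lc.subspace_0[OF subspace_lc_over] .
next
  case (antisymmetry ps \<sigma>)
  have "set (map (\<lambda>i. ps ! \<sigma> i) [0..<n]) \<subseteq> set ps"
    using antisymmetry permutes_in_image[OF antisymmetry(3)] by auto
  then show ?case
    using antisymmetry
    by (intro lc.subspace_diff[OF subspace_lc_over] lc.subspace_scale[OF subspace_lc_over] brk_in_lc_over) auto
next
  case (jacobi ps qs)
  have brk: "brk (ps ! i # qs) \<in> lc_over (nwords n X)" if "i < n" for i
    using jacobi assms(2) that by (intro brk_in_lc_over) auto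
  have "set (ps[i := brk (ps ! i # qs)]) \<subseteq> lc_over (nwords n X)" if "i < n" for i
    by (rule order.trans[OF set_update_subset_insert]) (use brk[OF that] jacobi(2) in simp)
  then show ?case
    using jacobi assms(2)
    by (intro lc.subspace_diff[OF subspace_lc_over] lc.subspace_sum[OF subspace_lc_over] brk_in_lc_over)
      (auto intro!: brk_in_lc_over)
qed (auto intro: lc.subspace_add[OF subspace_lc_over] lc.subspace_scale[OF subspace_lc_over] brk_in_lc_over)

section \<open>Identities of the free algebra in terms of functionals\<close>

definition annihilates :: "nat \<Rightarrow> 'a set \<Rightarrow> ('a nword \<Rightarrow> complex) \<Rightarrow> bool" where
  "annihilates n X \<theta> \<longleftrightarrow> (\<forall>p\<in>filippov_ideal n X. ext \<theta> p = 0)"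

text \<open>Closure of the ideal under bracketing, dualized. It makes every identity for the
  outermost bracket available at any depth of a word.\<close>

lemma annihilates_slot:
  assumes \<theta>: "annihilates n X \<theta>" and n: "Suc (length us + length vs) = n"
    and "set us \<subseteq> nwords n X" "set vs \<subseteq> nwords n X"
  shows "annihilates n X (\<lambda>w. \<theta> (Bracket (us @ w # vs)))"
  unfolding annihilates_def
proof
  fix p assume p: "p \<in> filippov_ideal n X"
  have "brk (map word us @ p # map word vs) \<in> filippov_ideal n X"
    using assms p ideal_in_lc_over[OF p]
    by (intro filippov_ideal.bracket[where i = "length us"]) (auto simp: nth_append intro!: single_in_lc_over)
  then have "ext \<theta> (brk (map word us @ p # map word vs)) = 0"
    using \<theta> by (simp add: annihilates_def)
  then show "ext (\<lambda>w. \<theta> (Bracket (us @ w # vs))) p = 0"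
    by (simp add: brk_slot) (simp add: ext_def)
qed

lemma annihilates_first:
  assumes "annihilates n X \<theta>" and "Suc (length vs) = n" and "set vs \<subseteq> nwords n X"
  shows "annihilates n X (\<lambda>w. \<theta> (Bracket (w # vs)))"
  using annihilates_slot[of n X \<theta> "[]" vs] assms by simp

lemma annihilates_jacobi:
  assumes \<theta>: "annihilates n X \<theta>" and n: "0 < n" "length ws = n" "Suc (length vs) = n"
    and ws: "set ws \<subseteq> nwords n X" and vs: "set vs \<subseteq> nwords n X"
  shows "\<theta> (Bracket (Bracket ws # vs)) = (\<Sum>i<n. \<theta> (Bracket (ws[i := Bracket (ws ! i # vs)])))"
proof -
  let ?ps = "map word ws" and ?qs = "map word vs"
  have "brk (brk ?ps # ?qs) - (\<Sum>i<n. brk (?ps[i := brk (?ps ! i # ?qs)])) \<in> filippov_ideal n X"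
    using n ws vs by (intro filippov_ideal.jacobi) (auto intro!: single_in_lc_over)
  moreover have "brk (brk ?ps # ?qs) = word (Bracket (Bracket ws # vs))"
  proof -
    have "ws \<noteq> []" using n by auto
    then show ?thesis using brk_words[of "Bracket ws # vs"] brk_words[of ws] by simp
  qed
  moreover have "brk (?ps[i := brk (?ps ! i # ?qs)]) = word (Bracket (ws[i := Bracket (ws ! i # vs)]))" if "i < n" for i
  proof -
    have "brk (?ps ! i # ?qs) = word (Bracket (ws ! i # vs))"
      using brk_words[of "ws ! i # vs"] that n by simp
    then have "?ps[i := brk (?ps ! i # ?qs)] = map word (ws[i := Bracket (ws ! i # vs)])"
      by (simp add: map_update)
    moreover have "ws \<noteq> []" using that n by auto
    ultimately show ?thesis using brk_words[of "ws[i := Bracket (ws ! i # vs)]"] by simp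
  qed
  ultimately have "word (Bracket (Bracket ws # vs)) - (\<Sum>i<n. word (Bracket (ws[i := Bracket (ws ! i # vs)]))) \<in> filippov_ideal n X"
    by simp
  then have "ext \<theta> (word (Bracket (Bracket ws # vs)) - (\<Sum>i<n. word (Bracket (ws[i := Bracket (ws ! i # vs)])))) = 0"
    using \<theta> unfolding annihilates_def by blast
  then show ?thesis by simp
qed

lemma annihilates_transpose:
  assumes \<theta>: "annihilates n X \<theta>" and n: "length ws = n" and ws: "set ws \<subseteq> nwords n X"
    and ij: "i < n" "j < n" "i \<noteq> j"
  shows "\<theta> (Bracket (ws[i := ws ! j, j := ws ! i])) = - \<theta> (Bracket ws)"
proof -
  let ?\<sigma> = "Transposition.transpose i j" and ?ps = "map word ws"
  have I: "brk ?ps - lc_scale (of_int (sign ?\<sigma>)) (brk (map (\<lambda>l. ?ps ! ?\<sigma> l) [0..<n])) \<in> filippov_ideal n X"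
    using n ws ij by (intro filippov_ideal.antisymmetry) (auto intro!: single_in_lc_over permutes_swap_id)
  have ne: "ws \<noteq> []" using n ij by auto
  have "map (\<lambda>l. ?ps ! ?\<sigma> l) [0..<n] = map word (ws[i := ws ! j, j := ws ! i])"
    using n ij by (intro nth_equalityI) (auto simp: nth_list_update Transposition.transpose_def)
  then have perm: "brk (map (\<lambda>l. ?ps ! ?\<sigma> l) [0..<n]) = word (Bracket (ws[i := ws ! j, j := ws ! i]))"
    using ne brk_words[of "ws[i := ws ! j, j := ws ! i]"] by simp
  have "sign ?\<sigma> = - 1" using ij by (simp add: sign_swap_id)
  then have "word (Bracket ws) - lc_scale (- 1) (word (Bracket (ws[i := ws ! j, j := ws ! i]))) \<in> filippov_ideal n X"
    using I unfolding perm brk_words[OF ne] by simp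
  then have "ext \<theta> (word (Bracket ws) - lc_scale (- 1) (word (Bracket (ws[i := ws ! j, j := ws ! i])))) = 0"
    using \<theta> unfolding annihilates_def by blast
  then show ?thesis by (simp add: eq_neg_iff_add_eq_0 add.commute)
qed

lemma annihilates_swap_first:
  assumes "annihilates n X \<theta>" and "Suc (length vs) = n" and "set vs \<subseteq> nwords n X"
    and "u \<in> nwords n X" "v \<in> nwords n X" and i: "i < length vs"
  shows "\<theta> (Bracket (u # vs[i := v])) = - \<theta> (Bracket (v # vs[i := u]))"
proof -
  have "set (v # vs[i := u]) \<subseteq> nwords n X"
    using assms set_update_subset_insert[of vs i u] by auto
  then show ?thesis
    using annihilates_transpose[of n X \<theta> "v # vs[i := u]" 0 "Suc i"] assms by simp
qed

lemma annihilates_adjacent: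
  assumes "annihilates n X \<theta>" and "length us + length vs + 2 = n" and "set us \<subseteq> nwords n X" "set vs \<subseteq> nwords n X"
    and "u \<in> nwords n X" "v \<in> nwords n X"
  shows "\<theta> (Bracket (us @ u # v # vs)) = - \<theta> (Bracket (us @ v # u # vs))"
  using annihilates_transpose[of n X \<theta> "us @ v # u # vs" "length us" "Suc (length us)"] assms
  by (auto simp: nth_append list_update_append)

text \<open>Jacobi on [[z, P], Q] gives [[z, Q], P] plus the words with P_i replaced by [P_i, Q].
  Each of these, with the inner bracket brought to the front and expanded again, gives [[z, P], Q]
  minus the exchanges of P_i with all Q_l. One of the r copies of [[z, P], Q] cancels against the
  left-hand side.\<close>

lemma annihilates_exchange:
  assumes \<theta>: "annihilates (Suc r) X \<theta>" and r: "1 \<le> r"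
    and len: "length P = r" "length Q = r"
    and z: "z \<in> nwords (Suc r) X" and P: "set P \<subseteq> nwords (Suc r) X" and Q: "set Q \<subseteq> nwords (Suc r) X"
  shows "(\<Sum>i<r. \<Sum>l<r. \<theta> (Bracket (Bracket (z # P[i := Q ! l]) # Q[l := P ! i])))
      = of_nat (r - 1) * \<theta> (Bracket (Bracket (z # P) # Q)) + \<theta> (Bracket (Bracket (z # Q) # P))"
proof -
  let ?N = "nwords (Suc r) X"
  define S where "S i = (\<Sum>l<r. \<theta> (Bracket (Bracket (z # P[i := Q ! l]) # Q[l := P ! i])))" for i
  let ?E = "\<theta> (Bracket (Bracket (z # P) # Q))"
  have br: "Bracket (w # vs) \<in> ?N" if "w \<in> ?N" "set vs \<subseteq> ?N" "length vs = r" for w vs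
    using that by (simp add: Bracket_in_nwords_iff)
  have upd: "set (vs[i := w]) \<subseteq> ?N" if "w \<in> ?N" "set vs \<subseteq> ?N" for w vs i
    using that set_update_subset_insert[of vs i w] by auto
  have mem: "P ! i \<in> ?N" "Q ! i \<in> ?N" if "i < r" for i
    using that P Q len by (auto simp: subset_iff)
  have step: "\<theta> (Bracket (z # P[i := Bracket (P ! i # Q)])) = ?E - S i" if i: "i < r" for i
  proof -
    have "\<theta> (Bracket (z # P[i := Bracket (P ! i # Q)])) = - \<theta> (Bracket (Bracket (P ! i # Q) # P[i := z]))"
      using \<theta> len P Q z mem[OF i] i by (intro annihilates_swap_first) (auto simp: Bracket_in_nwords_iff)
    also have "\<theta> (Bracket (Bracket (P ! i # Q) # P[i := z])) =
      (\<Sum>l<Suc r. \<theta> (Bracket ((P ! i # Q)[l := Bracket ((P ! i # Q) ! l # P[i := z])])))"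
      using \<theta> len P Q z mem[OF i] upd[OF z P, of i] by (intro annihilates_jacobi) (auto simp: subset_iff)
    also have "\<dots> = \<theta> (Bracket (Bracket (P ! i # P[i := z]) # Q))
       + (\<Sum>l<r. \<theta> (Bracket (P ! i # Q[l := Bracket (Q ! l # P[i := z])])))"
      by (subst sum.lessThan_Suc_shift) simp
    also have "\<theta> (Bracket (Bracket (P ! i # P[i := z]) # Q)) = - ?E"
      using annihilates_swap_first[OF annihilates_first[OF \<theta>], of Q P "P ! i" z i] len P Q z mem[OF i] i
      by simp
    also have "(\<Sum>l<r. \<theta> (Bracket (P ! i # Q[l := Bracket (Q ! l # P[i := z])]))) = S i"
      unfolding S_def
    proof (rule sum.cong[OF refl])
      fix l assume "l \<in> {..<r}"
      then have l: "l < r" by simp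
      have "\<theta> (Bracket (P ! i # Q[l := Bracket (Q ! l # P[i := z])])) = - \<theta> (Bracket (Bracket (Q ! l # P[i := z]) # Q[l := P ! i]))"
        using \<theta> len P Q z mem i l upd[OF z P, of i] by (intro annihilates_swap_first) (auto simp: Bracket_in_nwords_iff)
      also have "\<theta> (Bracket (Bracket (Q ! l # P[i := z]) # Q[l := P ! i])) = - \<theta> (Bracket (Bracket (z # P[i := Q ! l]) # Q[l := P ! i]))"
        by (rule annihilates_swap_first[OF annihilates_first[OF \<theta>]]) (use len P Q z mem i l upd[OF mem(1)[OF i] Q, of l] in \<open>auto simp: subset_iff\<close>)
      finally show "\<theta> (Bracket (P ! i # Q[l := Bracket (Q ! l # P[i := z])])) = \<theta> (Bracket (Bracket (z # P[i := Q ! l]) # Q[l := P ! i]))"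
        by simp
    qed
    finally show ?thesis by simp
  qed
  have "?E = (\<Sum>i<Suc r. \<theta> (Bracket ((z # P)[i := Bracket ((z # P) ! i # Q)])))"
    using \<theta> len P Q z by (intro annihilates_jacobi) auto
  also have "\<dots> = \<theta> (Bracket (Bracket (z # Q) # P)) + (\<Sum>i<r. \<theta> (Bracket (z # P[i := Bracket (P ! i # Q)])))"
    by (subst sum.lessThan_Suc_shift) simp
  also have "(\<Sum>i<r. \<theta> (Bracket (z # P[i := Bracket (P ! i # Q)]))) = of_nat r * ?E - (\<Sum>i<r. S i)"
    using step by (simp add: sum_subtractf)
  finally show ?thesis
    unfolding S_def[symmetric] using r by (simp add: of_nat_diff algebra_simps)
qed

section \<open>Left-normed words\<close>

primrec comb :: "nat \<Rightarrow> nat \<Rightarrow> 'a nword \<Rightarrow> 'a list \<Rightarrow> 'a nword" where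
  "comb r 0 z xs = z"
| "comb r (Suc k) z xs = comb r k (Bracket (z # map Letter (take r xs))) (drop r xs)"

lemma comb_append: "length xs = b * r \<Longrightarrow> comb r (b + k) z (xs @ ys) = comb r k (comb r b z xs) ys"
  by (induction b arbitrary: z xs) auto

lemma Letters_in_nwords: "set xs \<subseteq> X \<Longrightarrow> set (map Letter xs) \<subseteq> nwords n X"
  by (auto simp: Letter_in_nwords_iff)

lemma comb_in_nwords:
  "z \<in> nwords (Suc r) X \<Longrightarrow> set xs \<subseteq> X \<Longrightarrow> length xs = k * r \<Longrightarrow> comb r k z xs \<in> nwords (Suc r) X"
proof (induction k arbitrary: z xs)
  case (Suc k)
  have "set (take r xs) \<subseteq> X" "set (drop r xs) \<subseteq> X"
    using set_take_subset[of r xs] set_drop_subset[of r xs] Suc.prems by auto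
  then show ?case
    using Suc by (auto simp: Bracket_in_nwords_iff Letter_in_nwords_iff subset_iff intro!: Suc.IH)
qed simp

lemma annihilates_comb:
  "annihilates (Suc r) X \<theta> \<Longrightarrow> set xs \<subseteq> X \<Longrightarrow> length xs = k * r \<Longrightarrow> annihilates (Suc r) X (\<lambda>w. \<theta> (comb r k w xs))"
proof (induction k arbitrary: xs)
  case (Suc k)
  have sub: "set (take r xs) \<subseteq> X" "set (drop r xs) \<subseteq> X"
    using set_take_subset[of r xs] set_drop_subset[of r xs] Suc.prems by auto
  have "annihilates (Suc r) X (\<lambda>w. \<theta> (comb r k w (drop r xs)))"
    using Suc.prems sub by (intro Suc.IH) auto
  from annihilates_first[OF this, of "map Letter (take r xs)"] show ?case
    using Suc.prems Letters_in_nwords[OF sub(1)] by simp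
qed simp

fun brackets :: "'a nword \<Rightarrow> nat" where
  "brackets (Letter x) = 0"
| "brackets (Bracket ws) = Suc (sum_list (map brackets ws))"

lemma length_letters: "w \<in> nwords (Suc r) X \<Longrightarrow> length (letters w) = Suc (brackets w * r)"
proof (induction w rule: nwords.induct)
  case (Bracket ws)
  have "length (letters (Bracket ws)) = sum_list (map (\<lambda>w. Suc (brackets w * r)) ws)"
    using Bracket by (simp add: length_concat comp_def cong: map_cong)
  also have "\<dots> = length ws + sum_list (map brackets ws) * r"
    by (induction ws) (auto simp: algebra_simps)
  finally show ?case using Bracket by (simp add: algebra_simps)
qed simp

lemma brackets_eq_0: "brackets w = 0 \<longleftrightarrow> (\<exists>x. w = Letter x)"
  by (cases w) auto

lemma mset_letters_Bracket: "mset (letters (Bracket ws)) = (\<Sum>w\<in>#mset ws. mset (letters w))"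
  by (induction ws) auto

lemma brackets_Bracket: "brackets (Bracket ws) = Suc (\<Sum>w\<in>#mset ws. brackets w)"
  by (simp flip: sum_mset_sum_list)

lemma annihilates_to_front:
  assumes \<theta>: "annihilates n X \<theta>" and n: "length ws = n" and ws: "set ws \<subseteq> nwords n X" and i: "i < n"
  obtains us where "mset (ws ! i # us) = mset ws" and "\<theta> (Bracket ws) = 0 \<longleftrightarrow> \<theta> (Bracket (ws ! i # us)) = 0"
proof (cases i)
  case 0
  with i n that[of "tl ws"] show ?thesis by (cases ws) auto
next
  case (Suc l)
  obtain w vs where w: "ws = w # vs" using n i by (cases ws) auto
  have "l < length vs" using Suc i n w by simp
  then have "\<theta> (Bracket (w # vs[l := vs ! l])) = - \<theta> (Bracket (vs ! l # vs[l := w]))"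
    using ws w n by (intro annihilates_swap_first[OF \<theta>]) auto
  then have "\<theta> (Bracket ws) = 0 \<longleftrightarrow> \<theta> (Bracket (ws ! i # vs[l := w])) = 0"
    using w Suc by simp
  moreover have "mset (ws ! i # vs[l := w]) = mset ws"
    using w Suc \<open>l < length vs\<close> by (simp add: mset_update)
  ultimately show ?thesis by (rule that[rotated])
qed

text \<open>A bracket with two non-letter entries is expanded by the Jacobi identity along one of them; this
  enlarges the other one, so the process ends.\<close>

lemma annihilates_combs_imp_eq_0:
  assumes r: "1 \<le> r" and \<theta>: "annihilates (Suc r) X \<theta>" and w: "w \<in> nwords (Suc r) X"
    and combs: "\<And>xs. mset xs = mset (letters w) \<Longrightarrow> \<theta> (comb r (brackets w) (Letter (hd xs)) (tl xs)) = 0"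
  shows "\<theta> w = 0"
  using \<theta> w combs
proof (induction "brackets w" arbitrary: w \<theta> rule: less_induct)
  case less
  let ?N = "nwords (Suc r) X"
  show ?case
  proof (cases w)
    case (Letter x)
    then show ?thesis using less.prems(3)[of "[x]"] by simp
  next
    case (Bracket ws)
    \<comment> \<open>Jacobi changes the word, so the claim ranges over all words with the same
      letters and the same number of brackets; the inner measure drops when the first entry v
      grows.\<close>
    have front: "\<theta> (Bracket (v # us)) = 0"
      if "Suc (length us) = Suc r" "set (v # us) \<subseteq> ?N" "brackets (Bracket (v # us)) = brackets w"
        "mset (letters (Bracket (v # us))) = mset (letters w)" for v us
      using that
    proof (induction "brackets w - brackets v" arbitrary: v us rule: less_induct)
      case inner: less
      show ?case
      proof (cases "\<forall>u\<in>set us. \<exists>x. u = Letter x")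
        case True
        then obtain Q where Q: "us = map Letter Q" by (metis ex_map_conv)
        \<comment> \<open>The other entries are letters, so the outermost bracket is the last block
          of a left-normed word; v is left to the outer induction, with the functional that puts
          \<open>us\<close> behind its argument.\<close>
        have "set Q \<subseteq> X" using inner.prems(2) by (auto simp: Q Letter_in_nwords_iff)
        show ?thesis
        proof (rule less.hyps[of v "\<lambda>w. \<theta> (Bracket (w # us))"])
          have "sum_list (map brackets us) = 0" unfolding Q by (induction Q) auto
          moreover have "brackets w = Suc (brackets v + sum_list (map brackets us))" using inner.prems(3) by simp
          ultimately have bw: "brackets w = Suc (brackets v)" by presburger
          then show "brackets v < brackets w" by simp
          show "annihilates (Suc r) X (\<lambda>w. \<theta> (Bracket (w # us)))"
            using inner.prems by (intro annihilates_first[OF less.prems(1)]) auto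
          show "v \<in> ?N" using inner.prems by simp
          fix xs assume xs: "mset xs = mset (letters v)"
          then have len: "length xs = Suc (brackets v * r)"
            using length_letters[OF \<open>v \<in> ?N\<close>] by (metis size_mset)
          then obtain y ys where y: "xs = y # ys" "length ys = brackets v * r" by (cases xs) auto
          have "mset (xs @ Q) = mset (letters w)"
            using inner.prems(4) xs unfolding mset_letters_Bracket by (simp add: Q image_mset.compositionality comp_def)
          from less.prems(3)[OF this]
          show "\<theta> (Bracket (comb r (brackets v) (Letter (hd xs)) (tl xs) # us)) = 0"
            using comb_append[of ys "brackets v" r 1 "Letter y" Q] y inner.prems(1) by (simp add: bw Q)
        qed
      next
        case False
        then obtain l where l: "l < length us" "\<nexists>x. us ! l = Letter x" by (metis in_set_conv_nth)
        then obtain as where as: "us ! l = Bracket as" by (metis nword.exhaust)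
        \<comment> \<open>The bracket \<open>us ! l\<close> comes to the front and v takes its
          place. After the Jacobi identity v lies inside the new entry [as_i, vs], which therefore
          has more brackets than v.\<close>
        define vs where "vs = us[l := v]"
        have vs: "length vs = r" "set vs \<subseteq> ?N" "v \<in> set vs"
          using inner.prems l set_update_subset_insert[of us l v] set_update_memI[of l us v] by (auto simp: vs_def)
        have "us ! l \<in> ?N" using l inner.prems by auto
        then have as': "length as = Suc r" "set as \<subseteq> ?N" by (auto simp: as Bracket_in_nwords_iff)
        have mset_us: "add_mset v (mset us) = add_mset (Bracket as) (mset vs)"
          using nth_mem[OF l(1)] l(1) as by (simp add: vs_def mset_update)
        have "\<theta> (Bracket (v # us[l := us ! l])) = - \<theta> (Bracket (us ! l # us[l := v]))"
          using inner.prems l \<open>us ! l \<in> ?N\<close> by (intro annihilates_swap_first[OF less.prems(1)]) auto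
        then have "\<theta> (Bracket (v # us)) = - \<theta> (Bracket (Bracket as # vs))"
          unfolding list_update_id by (simp only: as vs_def)
        also have "\<theta> (Bracket (Bracket as # vs)) = (\<Sum>i<Suc r. \<theta> (Bracket (as[i := Bracket (as ! i # vs)])))"
          using vs as' by (intro annihilates_jacobi[OF less.prems(1)]) auto
        also have "\<dots> = 0"
        proof (rule sum.neutral, rule ballI)
          fix i assume "i \<in> {..<Suc r}"
          then have i: "i < length as" using as' by simp
          define b where "b = Bracket (as ! i # vs)"
          have b: "b \<in> ?N" using i as' vs by (auto simp: b_def Bracket_in_nwords_iff)
          have asN: "set (as[i := b]) \<subseteq> ?N"
            using set_update_subset_insert[of as i b] as' b by auto
          have m: "mset (as[i := b]) = add_mset b (mset as - {#as ! i#})" "as ! i \<in># mset as"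
            using i by (auto simp: mset_update)
          then obtain A where A: "mset as = add_mset (as ! i) A" by (metis mset_add)
          have mA: "mset (as[i := b]) = add_mset b A" using m A by simp
          obtain us' where us': "mset ((as[i := b]) ! i # us') = mset (as[i := b])"
            "\<theta> (Bracket (as[i := b])) = 0 \<longleftrightarrow> \<theta> (Bracket ((as[i := b]) ! i # us')) = 0"
            using annihilates_to_front[OF less.prems(1) _ asN, of i] as' i by auto
          then have us'': "mset us' = A" using i mA by simp
          have eq: "mset (b # us') = mset (as[i := b])" using us' i by simp
          have "brackets v \<le> sum_list (map brackets vs)"
            using vs(3) by (simp add: member_le_sum_list)
          then have bv: "brackets v < brackets b" by (simp add: b_def)
          have br: "brackets (Bracket (b # us')) = brackets w"
          proof -
            have "brackets w = brackets (Bracket (v # us))" using inner.prems by simp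
            also have "\<dots> = Suc (\<Sum>x\<in>#add_mset (Bracket as) (mset vs). brackets x)"
              unfolding brackets_Bracket mset.simps mset_us ..
            also have "\<dots> = brackets (Bracket (b # us'))"
              unfolding brackets_Bracket mset.simps us'' by (simp add: brackets_Bracket A b_def del: brackets.simps)
            finally show ?thesis ..
          qed
          have lt: "mset (letters (Bracket (b # us'))) = mset (letters w)"
          proof -
            have "mset (letters w) = mset (letters (Bracket (v # us)))" using inner.prems by simp
            also have "\<dots> = (\<Sum>x\<in>#add_mset (Bracket as) (mset vs). mset (letters x))"
              unfolding mset_letters_Bracket mset.simps mset_us ..
            also have "\<dots> = mset (letters (Bracket (b # us')))"
              unfolding mset_letters_Bracket mset.simps us'' by (simp add: mset_letters_Bracket A b_def ac_simps del: letters.simps)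
            finally show ?thesis ..
          qed
          have "brackets b \<le> brackets w" using br by simp
          have "\<theta> (Bracket (b # us')) = 0"
          proof (rule inner.hyps[OF _ _ _ br lt])
            show "brackets w - brackets b < brackets w - brackets v"
              using bv \<open>brackets b \<le> brackets w\<close> by simp
            show "Suc (length us') = Suc r" using arg_cong[OF eq, of size] as' by simp
            show "set (b # us') \<subseteq> ?N" using asN eq by (metis set_mset_mset)
          qed
          then show "\<theta> (Bracket (as[i := Bracket (as ! i # vs)])) = 0"
            using us'(2) i by (simp add: b_def)
        qed
        finally show ?thesis by simp
      qed
    qed
    from less.prems(2) obtain v us where v: "ws = v # us" unfolding Bracket Bracket_in_nwords_iff by (cases ws) auto
    show ?thesis
      using front[of us v] less.prems(2) unfolding Bracket v by (simp add: Bracket_in_nwords_iff)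
  qed
qed

section \<open>Alternation over classes of letters\<close>

text \<open>Permutations act on positions 1, ..., m, while list indices start at 0; hence the shift
  by one.\<close>

definition reorder :: "nat \<Rightarrow> (nat \<Rightarrow> nat) \<Rightarrow> 'x list \<Rightarrow> 'x list" where
  "reorder m \<pi> xs = map (\<lambda>i. xs ! (\<pi> i - 1)) [1..<Suc m]"

text \<open>\<open>c\<close> assigns to every letter its class. The sign makes antisymmetry of \<open>K\<close> in its positions into symmetry in \<open>xs\<close>.\<close>

definition alt_form ::
  "nat \<Rightarrow> (nat \<Rightarrow> 'c) \<Rightarrow> (nat list \<Rightarrow> complex) \<Rightarrow> ('c \<Rightarrow>\<^sub>0 complex) list \<Rightarrow> complex" where
  "alt_form m c K xs =
     (\<Sum>g | g permutes {1..m}. of_int (sign g) *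
        (\<Prod>i=1..m. Poly_Mapping.lookup (xs ! (i - 1)) (c (g i))) * K (map g [1..<Suc m]))"

lemma length_reorder [simp]: "length (reorder m \<pi> xs) = m"
  by (simp add: reorder_def)

lemma nth_reorder: "i < m \<Longrightarrow> reorder m \<pi> xs ! i = xs ! (\<pi> (Suc i) - 1)"
  by (simp add: reorder_def nth_append del: upt_Suc)

lemma reorder_map:
  "\<pi> permutes {1..m} \<Longrightarrow> reorder m \<pi> (map g [1..<Suc m]) = map (g \<circ> \<pi>) [1..<Suc m]"
proof (rule nth_equalityI)
  fix i assume \<pi>: "\<pi> permutes {1..m}" and "i < length (reorder m \<pi> (map g [1..<Suc m]))"
  then have i: "i < m" by simp
  then have "\<pi> (Suc i) \<in> {1..m}" using permutes_in_image[OF \<pi>] by simp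
  then show "reorder m \<pi> (map g [1..<Suc m]) ! i = map (g \<circ> \<pi>) [1..<Suc m] ! i"
    using i by (auto simp: nth_reorder simp del: upt_Suc)
qed simp

text \<open>Substituting g \<circ> \<pi> for g moves \<pi> from the vectors to the positions of K
  and leaves its sign behind.\<close>

lemma alt_form_reorder:
  assumes \<pi>: "\<pi> permutes {1..m}"
  shows "alt_form m c K (reorder m \<pi> xs) = of_int (sign \<pi>) * alt_form m c (\<lambda>ys. K (reorder m \<pi> ys)) xs"
proof -
  let ?X = "{1..m}"
  have "alt_form m c K (reorder m \<pi> xs) = (\<Sum>g | g permutes ?X. of_int (sign (g \<circ> \<pi>)) *
        (\<Prod>i\<in>?X. Poly_Mapping.lookup (reorder m \<pi> xs ! (i - 1)) (c ((g \<circ> \<pi>) i))) * K (map (g \<circ> \<pi>) [1..<Suc m]))"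
    unfolding alt_form_def by (rule sum_permutations_compose_right[OF \<pi>])
  also have "\<dots> = (\<Sum>g | g permutes ?X. of_int (sign \<pi>) * (of_int (sign g) *
        (\<Prod>i\<in>?X. Poly_Mapping.lookup (xs ! (i - 1)) (c (g i))) * K (reorder m \<pi> (map g [1..<Suc m]))))"
  proof (rule sum.cong[OF refl])
    fix g assume "g \<in> {g. g permutes ?X}"
    then have g: "g permutes ?X" by simp
    have "permutation g" "permutation \<pi>" using g \<pi> permutes_imp_permutation[of ?X] by auto
    then have sgn: "sign (g \<circ> \<pi>) = sign g * sign \<pi>" by (rule sign_compose)
    have "(\<Prod>i\<in>?X. Poly_Mapping.lookup (reorder m \<pi> xs ! (i - 1)) (c ((g \<circ> \<pi>) i)))
        = (\<Prod>i\<in>?X. (\<lambda>i. Poly_Mapping.lookup (xs ! (i - 1)) (c (g i))) (\<pi> i))"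
      by (intro prod.cong refl) (auto simp: nth_reorder)
    also have "\<dots> = (\<Prod>i\<in>?X. Poly_Mapping.lookup (xs ! (i - 1)) (c (g i)))"
      using prod.permute[OF \<pi>, of "\<lambda>i. Poly_Mapping.lookup (xs ! (i - 1)) (c (g i))"] by (simp add: comp_def)
    finally show "of_int (sign (g \<circ> \<pi>)) *
        (\<Prod>i\<in>?X. Poly_Mapping.lookup (reorder m \<pi> xs ! (i - 1)) (c ((g \<circ> \<pi>) i))) * K (map (g \<circ> \<pi>) [1..<Suc m])
      = of_int (sign \<pi>) * (of_int (sign g) *
        (\<Prod>i\<in>?X. Poly_Mapping.lookup (xs ! (i - 1)) (c (g i))) * K (reorder m \<pi> (map g [1..<Suc m])))"
      unfolding sgn reorder_map[OF \<pi>] by simp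
  qed
  finally show ?thesis by (simp add: alt_form_def sum_distrib_left)
qed

lemma alt_form_cong:
  assumes "\<And>ys. length ys = m \<Longrightarrow> set ys = {1..m} \<Longrightarrow> K ys = K' ys"
  shows "alt_form m c K xs = alt_form m c K' xs"
  unfolding alt_form_def
proof (intro sum.cong refl arg_cong2[where f = "(*)"] assms)
  fix g assume "g \<in> {g. g permutes {1..m}}"
  then show "set (map g [1..<Suc m]) = {1..m}"
    using permutes_image[of g "{1..m}"] by (simp add: atLeastLessThanSuc_atLeastAtMost del: upt_Suc)
qed simp

lemma alt_form_sum: "alt_form m c (\<lambda>ys. \<Sum>i\<in>I. K i ys) xs = (\<Sum>i\<in>I. alt_form m c (K i) xs)"
  unfolding alt_form_def sum_distrib_left by (rule sum.swap)

lemma alt_form_add: "alt_form m c (\<lambda>ys. K ys + K' ys) xs = alt_form m c K xs + alt_form m c K' xs"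
  by (simp add: alt_form_def sum.distrib algebra_simps)

lemma alt_form_scale: "alt_form m c (\<lambda>ys. a * K ys) xs = a * alt_form m c K xs"
  by (simp add: alt_form_def sum_distrib_left algebra_simps)

lemma reorder_transpose:
  assumes "length xs = m" "p < m" "q < m"
  shows "reorder m (Transposition.transpose (Suc p) (Suc q)) xs = xs[p := xs ! q, q := xs ! p]"
  using assms by (intro nth_equalityI) (auto simp: nth_reorder nth_list_update Transposition.transpose_def)

lemma alt_form_transpose:
  assumes "length xs = m" "p < m" "q < m" "p \<noteq> q"
  shows "alt_form m c K (xs[p := xs ! q, q := xs ! p]) =
    - alt_form m c (\<lambda>ys. K (ys[p := ys ! q, q := ys ! p])) xs"
proof -
  let ?\<pi> = "Transposition.transpose (Suc p) (Suc q)"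
  have \<pi>: "?\<pi> permutes {1..m}" using assms by (intro permutes_swap_id) auto
  have "sign ?\<pi> = - 1" using assms by (simp add: sign_swap_id)
  then have "alt_form m c K (reorder m ?\<pi> xs) = - alt_form m c (\<lambda>ys. K (reorder m ?\<pi> ys)) xs"
    by (simp add: alt_form_reorder[OF \<pi>])
  also have "alt_form m c (\<lambda>ys. K (reorder m ?\<pi> ys)) xs = alt_form m c (\<lambda>ys. K (ys[p := ys ! q, q := ys ! p])) xs"
    using assms by (intro alt_form_cong) (simp add: reorder_transpose)
  finally show ?thesis using assms by (simp add: reorder_transpose)
qed

lemma alt_form_slot:
  assumes "length A + length B + 1 = m"
  shows "alt_form m c K (A @ (x + y) # B) = alt_form m c K (A @ x # B) + alt_form m c K (A @ y # B)"
    and "alt_form m c K (A @ lc_scale a x # B) = a * alt_form m c K (A @ x # B)"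
proof -
  let ?i = "Suc (length A)"
  define R where "R g = (\<Prod>i\<in>{1..m} - {?i}. Poly_Mapping.lookup ((A @ x # B) ! (i - 1)) (c (g i)))" for g
  have "(\<Prod>i=1..m. Poly_Mapping.lookup ((A @ z # B) ! (i - 1)) (c (g i)))
     = Poly_Mapping.lookup z (c (g ?i)) * R g" for z g
  proof -
    have "(\<Prod>i=1..m. Poly_Mapping.lookup ((A @ z # B) ! (i - 1)) (c (g i)))
      = Poly_Mapping.lookup ((A @ z # B) ! (?i - 1)) (c (g ?i)) *
        (\<Prod>i\<in>{1..m} - {?i}. Poly_Mapping.lookup ((A @ z # B) ! (i - 1)) (c (g i)))"
      using assms by (intro prod.remove) auto
    also have "(\<Prod>i\<in>{1..m} - {?i}. Poly_Mapping.lookup ((A @ z # B) ! (i - 1)) (c (g i))) = R g"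
      unfolding R_def by (intro prod.cong refl) (auto simp: nth_append nth_Cons split: nat.splits)
    finally show ?thesis by simp
  qed
  then show "alt_form m c K (A @ (x + y) # B) = alt_form m c K (A @ x # B) + alt_form m c K (A @ y # B)"
    and "alt_form m c K (A @ lc_scale a x # B) = a * alt_form m c K (A @ x # B)"
    by (simp_all add: alt_form_def lookup_add algebra_simps sum.distrib sum_distrib_left)
qed

text \<open>Adjacent transpositions connect all orderings of a list.\<close>

lemma mset_invariant:
  fixes f :: "'a list \<Rightarrow> 'b"
  assumes "\<And>us x y vs. length us + length vs + 2 = s \<Longrightarrow> f (us @ x # y # vs) = f (us @ y # x # vs)"
    and "length P = s" and "mset P = mset P'"
  shows "f P = f P'"
  using assms
proof (induction P arbitrary: f s P')
  case (Cons p P)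
  have "p \<in> set P'" using Cons.prems(3) by (metis list.set_intros(1) set_mset_mset)
  then obtain us vs where P': "P' = us @ p # vs" by (auto simp: in_set_conv_decomp)
  have len: "length us + length vs + 1 = s" using Cons.prems(2,3) P' by (metis length_append length_Cons size_mset add_Suc_right Suc_eq_plus1)
  have "f (us @ p # vs) = f (p # us @ vs)"
    using len
  proof (induction us arbitrary: vs rule: rev_induct)
    case (snoc u us)
    then show ?case using Cons.prems(1)[of us vs u p] snoc.IH[of "u # vs"] by simp
  qed simp
  moreover have "f (p # P) = f (p # us @ vs)"
  proof (rule Cons.IH[of "s - 1" "\<lambda>P. f (p # P)"])
    fix us' vs' :: "'a list" and x y assume "length us' + length vs' + 2 = s - 1"
    then show "f (p # us' @ x # y # vs') = f (p # us' @ y # x # vs')"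
      using Cons.prems(1)[of "p # us'" vs' x y] by simp
  qed (use Cons.prems P' in auto)
  ultimately show ?case by (simp add: P')
qed simp

text \<open>The sign of the transposition cancels against the antisymmetry of K.\<close>

lemma alt_form_adjacent:
  assumes "length us + length vs + 2 = m"
    and "\<And>as a b bs. length as = length us \<Longrightarrow> length bs = length vs \<Longrightarrow> set (as @ a # b # bs) = {1..m} \<Longrightarrow>
      K (as @ b # a # bs) = - K (as @ a # b # bs)"
  shows "alt_form m c K (us @ x # y # vs) = alt_form m c K (us @ y # x # vs)"
proof -
  let ?p = "length us" and ?xs = "us @ y # x # vs"
  have swap: "(as @ a # b # bs)[?p := (as @ a # b # bs) ! Suc ?p, Suc ?p := (as @ a # b # bs) ! ?p] = as @ b # a # bs"
    if "length as = ?p" for as bs :: "'x list" and a b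
    using that by (auto simp: nth_append list_update_append)
  have "alt_form m c K (?xs[?p := ?xs ! Suc ?p, Suc ?p := ?xs ! ?p]) =
      - alt_form m c (\<lambda>ys. K (ys[?p := ys ! Suc ?p, Suc ?p := ys ! ?p])) ?xs"
    using assms(1) by (intro alt_form_transpose) auto
  also have "\<dots> = - alt_form m c (\<lambda>ys. - 1 * K ys) ?xs"
  proof (intro arg_cong[where f = uminus] alt_form_cong)
    fix ys :: "nat list" assume ys: "length ys = m" "set ys = {1..m}"
    obtain as a b bs where "ys = as @ a # b # bs" "length as = ?p" "length bs = length vs"
    proof -
      have "ys = take ?p ys @ ys ! ?p # ys ! Suc ?p # drop (Suc (Suc ?p)) ys"
        using ys assms(1) by (simp add: Cons_nth_drop_Suc)
      from that[OF this] ys assms(1) show ?thesis by simp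
    qed
    with swap[of as a b bs] assms(2)[of as bs a b] ys
    show "K (ys[?p := ys ! Suc ?p, Suc ?p := ys ! ?p]) = - 1 * K ys" by simp
  qed
  also have "\<dots> = alt_form m c K ?xs" unfolding alt_form_scale by simp
  finally show ?thesis using swap[of us y x vs] by simp
qed

section \<open>Left-normed words as alternated multilinear forms\<close>

definition leftcomb :: "nat \<Rightarrow> nat \<Rightarrow> 'a list \<Rightarrow> 'a nword" where
  "leftcomb r k xs = comb r k (Letter (hd xs)) (tl xs)"

lemma leftcomb_append:
  assumes "length xs = Suc (b * r)"
  shows "leftcomb r (b + k) (xs @ ys) = comb r k (leftcomb r b xs) ys"
  using assms comb_append[of "tl xs" b r k "Letter (hd xs)" ys] by (cases xs) (auto simp: leftcomb_def)

lemma leftcomb_block: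
  assumes "length xs = Suc (b * r)" "length P = r"
  shows "leftcomb r (b + Suc k) (xs @ P @ ys) = comb r k (Bracket (leftcomb r b xs # map Letter P)) ys"
  using leftcomb_append[OF assms(1), of "Suc k" "P @ ys"] assms(2) by simp

lemma leftcomb_one: "length xs = Suc r \<Longrightarrow> leftcomb r 1 xs = Bracket (map Letter xs)"
  by (cases xs) (auto simp: leftcomb_def)

lemma leftcomb_in_nwords:
  assumes "length xs = Suc (b * r)" "set xs \<subseteq> X"
  shows "leftcomb r b xs \<in> nwords (Suc r) X"
  using assms by (cases xs) (auto simp: leftcomb_def Letter_in_nwords_iff intro!: comb_in_nwords)

lemma annihilates_leftcomb_first:
  assumes r: "1 \<le> r" and \<theta>: "annihilates (Suc r) X \<theta>"
    and len: "length us + length vs + 2 = Suc r" "length ys = k * r"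
    and X: "set (us @ x # y # vs @ ys) \<subseteq> X"
  shows "\<theta> (leftcomb r (Suc k) (us @ y # x # vs @ ys)) = - \<theta> (leftcomb r (Suc k) (us @ x # y # vs @ ys))"
proof -
  have *: "leftcomb r (Suc k) (us @ a # b # vs @ ys) =
      comb r k (Bracket (map Letter us @ Letter a # Letter b # map Letter vs)) ys" for a b
    using leftcomb_append[of "us @ a # b # vs" 1 r k ys] leftcomb_one[of "us @ a # b # vs" r] len
    by simp
  show ?thesis unfolding *
    by (rule annihilates_adjacent[OF annihilates_comb[OF \<theta>]])
      (use len X in \<open>auto simp: Letter_in_nwords_iff\<close>)
qed

lemma annihilates_leftcomb_block:
  assumes r: "1 \<le> r" and \<theta>: "annihilates (Suc r) X \<theta>"
    and len: "length xs = Suc (b * r)" "length us + length vs + 2 = r" "length ys = k * r"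
    and X: "set (xs @ us @ x # y # vs @ ys) \<subseteq> X"
  shows "\<theta> (leftcomb r (b + Suc k) (xs @ us @ y # x # vs @ ys)) = - \<theta> (leftcomb r (b + Suc k) (xs @ us @ x # y # vs @ ys))"
proof -
  let ?z = "leftcomb r b xs"
  have *: "leftcomb r (b + Suc k) (xs @ us @ a # c # vs @ ys) =
      comb r k (Bracket ((?z # map Letter us) @ Letter a # Letter c # map Letter vs)) ys" for a c
    using leftcomb_block[OF len(1), of "us @ a # c # vs" k ys] len(2) by simp
  have z: "?z \<in> nwords (Suc r) X" using len X by (intro leftcomb_in_nwords) auto
  show ?thesis unfolding *
    by (rule annihilates_adjacent[OF annihilates_comb[OF \<theta>]])
      (use len X z in \<open>auto simp: Letter_in_nwords_iff\<close>)
qed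

lemma annihilates_leftcomb_exchange:
  assumes r: "1 \<le> r" and \<theta>: "annihilates (Suc r) X \<theta>"
    and len: "length xs = Suc (b * r)" "length P = r" "length Q = r" "length ys = k * r"
    and X: "set (xs @ P @ Q @ ys) \<subseteq> X"
  shows "(\<Sum>i<r. \<Sum>l<r. \<theta> (leftcomb r (b + 2 + k) (xs @ P[i := Q ! l] @ Q[l := P ! i] @ ys)))
      = of_nat (r - 1) * \<theta> (leftcomb r (b + 2 + k) (xs @ P @ Q @ ys)) + \<theta> (leftcomb r (b + 2 + k) (xs @ Q @ P @ ys))"
proof -
  let ?z = "leftcomb r b xs"
  have *: "leftcomb r (b + 2 + k) (xs @ P' @ Q' @ ys) = comb r k (Bracket (Bracket (?z # map Letter P') # map Letter Q')) ys"
    if "length P' = r" "length Q' = r" for P' Q'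
    using that leftcomb_append[OF len(1), of "Suc (Suc k)" "P' @ Q' @ ys"] by simp
  have z: "?z \<in> nwords (Suc r) X" using len X by (intro leftcomb_in_nwords) auto
  have "(\<Sum>i<r. \<Sum>l<r. \<theta> (leftcomb r (b + 2 + k) (xs @ P[i := Q ! l] @ Q[l := P ! i] @ ys)))
    = (\<Sum>i<r. \<Sum>l<r. \<theta> (comb r k (Bracket (Bracket (?z # (map Letter P)[i := map Letter Q ! l]) # (map Letter Q)[l := map Letter P ! i])) ys))"
    using len by (intro sum.cong refl, subst *) (simp_all add: map_update)
  also have "\<dots> = of_nat (r - 1) * \<theta> (comb r k (Bracket (Bracket (?z # map Letter P) # map Letter Q)) ys)
     + \<theta> (comb r k (Bracket (Bracket (?z # map Letter Q) # map Letter P)) ys)"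
    by (rule annihilates_exchange[OF annihilates_comb[OF \<theta>] r])
      (use len X z in \<open>auto simp: Letter_in_nwords_iff\<close>)
  finally show ?thesis unfolding *[OF len(2,3)] *[OF len(3,2)] .
qed

text \<open>The Jacobi identity of Lie algebras, arranged so that both words on the right arise from
  the left one by transposing two of the first three positions.\<close>

lemma annihilates_leftcomb_Lie:
  assumes \<theta>: "annihilates 2 X \<theta>" and len: "length ys = k" and X: "set (x # y # z # ys) \<subseteq> X"
  shows "\<theta> (leftcomb 1 (2 + k) (x # y # z # ys)) =
    \<theta> (leftcomb 1 (2 + k) (x # z # y # ys)) + \<theta> (leftcomb 1 (2 + k) (z # y # x # ys))"
proof -
  define \<theta>' where "\<theta>' = (\<lambda>w. \<theta> (comb 1 k w ys))"
  have \<theta>': "annihilates 2 X \<theta>'"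
    using annihilates_comb[of 1 X \<theta> ys k] \<theta> len X by (simp add: \<theta>'_def numeral_2_eq_2)
  have *: "\<theta> (leftcomb 1 (2 + k) (a # b # c # ys)) = \<theta>' (Bracket [Bracket [Letter a, Letter b], Letter c])" for a b c
    by (simp add: leftcomb_def \<theta>'_def numeral_2_eq_2)
  have mem: "Letter x \<in> nwords 2 X" "Letter y \<in> nwords 2 X" "Letter z \<in> nwords 2 X"
    using X by (auto simp: Letter_in_nwords_iff)
  have "\<theta>' (Bracket [Bracket [Letter x, Letter y], Letter z]) =
     \<theta>' (Bracket [Bracket [Letter x, Letter z], Letter y]) + \<theta>' (Bracket [Letter x, Bracket [Letter y, Letter z]])"
    using annihilates_jacobi[OF \<theta>', of "[Letter x, Letter y]" "[Letter z]"] mem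
    by (simp add: numeral_2_eq_2)
  also have "\<theta>' (Bracket [Letter x, Bracket [Letter y, Letter z]]) = - \<theta>' (Bracket [Bracket [Letter y, Letter z], Letter x])"
    using annihilates_swap_first[OF \<theta>', of "[Letter z]" "Letter x" "Bracket [Letter y, Letter z]" 0] mem
    by (simp add: Bracket_in_nwords_iff)
  also have "\<theta>' (Bracket [Bracket [Letter y, Letter z], Letter x]) = - \<theta>' (Bracket [Bracket [Letter z, Letter y], Letter x])"
    using annihilates_swap_first[OF annihilates_first[OF \<theta>', of "[Letter x]"], of "[Letter z]" "Letter y" "Letter z" 0] mem
    by simp
  finally show ?thesis unfolding * by simp
qed

lemma length_mult_cancel:
  assumes "1 \<le> (r::nat)" "b * r + d * r + l = k * r"
  obtains k' where "k = b + d + k'" "l = k' * r"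
proof -
  have "(b + d) * r \<le> k * r" using assms by (simp add: algebra_simps)
  then have "b + d \<le> k" using assms(1) by simp
  then obtain k' where k': "k = b + d + k'" using le_Suc_ex by blast
  with assms show ?thesis by (intro that[of k']) (auto simp: algebra_simps)
qed

text \<open>Interchanges two adjacent blocks of r positions, counted from 1; its sign supplies the
  \<open>\<epsilon>\<close> of the locale.\<close>

definition swap_blocks :: "nat \<Rightarrow> nat \<Rightarrow> nat \<Rightarrow> nat" where
  "swap_blocks a r i = (if a < i \<and> i \<le> a + r then i + r else if a + r < i \<and> i \<le> a + 2 * r then i - r else i)"

lemma swap_blocks_permutes: "a + 2 * r \<le> m \<Longrightarrow> swap_blocks a r permutes {1..m}"
proof (rule bij_imp_permutes)
  have inv: "swap_blocks a r (swap_blocks a r i) = i" for i by (auto simp: swap_blocks_def)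
  show "bij_betw (swap_blocks a r) {1..m} {1..m}" if "a + 2 * r \<le> m"
    by (rule bij_betw_byWitness[where f' = "swap_blocks a r"]) (use that inv in \<open>auto simp: swap_blocks_def\<close>)
qed (auto simp: swap_blocks_def)

lemma reorder_swap_blocks:
  assumes "length P = r" "length Q = r" "length xs + r + r + length ys = m"
  shows "reorder m (swap_blocks (length xs) r) (xs @ P @ Q @ ys) = xs @ Q @ P @ ys"
proof (rule nth_equalityI)
  fix i assume "i < length (reorder m (swap_blocks (length xs) r) (xs @ P @ Q @ ys))"
  then have i: "i < m" by simp
  consider "i < length xs" | j where "i = length xs + j" "j < r" | j where "i = length xs + r + j" "j < r"
    | j where "i = length xs + r + r + j"
    by (metis add.assoc le_Suc_ex nat_add_left_cancel_less not_less)
  then show "reorder m (swap_blocks (length xs) r) (xs @ P @ Q @ ys) ! i = (xs @ Q @ P @ ys) ! i"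
    by cases (use i assms in \<open>auto simp: nth_reorder swap_blocks_def nth_append\<close>)
qed (use assms in simp)

text \<open>Antisymmetry in the positions becomes symmetry in the vectors. In the exchange identity
  each transposition of positions contributes -1 and the interchange of two blocks contributes
  \<open>\<epsilon>\<close>, which accounts for the signs in the locale assumption.\<close>

lemma comb_form_alt_form:
  assumes r: "1 \<le> r" and m: "m = Suc (k * r)" and \<theta>: "annihilates (Suc r) {1..m} \<theta>"
  shows "comb_form r m (alt_form m c (\<lambda>xs. \<theta> (leftcomb r k xs)))" (is "comb_form r m ?\<Psi>")
proof
  show "1 \<le> r" by (rule r)
  show "?\<Psi> (A @ (x + y) # B) = ?\<Psi> (A @ x # B) + ?\<Psi> (A @ y # B)" if "length A + length B + 1 = m" for A B x y
    using that by (rule alt_form_slot)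
  show "?\<Psi> (A @ lc_scale a x # B) = a * ?\<Psi> (A @ x # B)" if "length A + length B + 1 = m" for A B a x
    using that by (rule alt_form_slot)
next
  fix P B P' :: "('a \<Rightarrow>\<^sub>0 complex) list"
  assume P: "length P = Suc r" "length P + length B = m" "mset P = mset P'"
  obtain k' where k': "k = Suc k'" "length B = k' * r"
    using length_mult_cancel[OF r, of 1 0 "length B" k] P m by auto
  show "?\<Psi> (P @ B) = ?\<Psi> (P' @ B)"
  proof (rule mset_invariant[OF _ P(1,3)])
    fix us vs :: "('a \<Rightarrow>\<^sub>0 complex) list" and x y assume len: "length us + length vs + 2 = Suc r"
    have "?\<Psi> (us @ x # y # (vs @ B)) = ?\<Psi> (us @ y # x # (vs @ B))"
    proof (rule alt_form_adjacent)
      show "length us + length (vs @ B) + 2 = m" using len P by simp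
      fix as a b bs assume as: "length as = length us" "length bs = length (vs @ B)" "set (as @ a # b # bs) = {1..m}"
      define bs1 bs2 where "bs1 = take (length vs) bs" and "bs2 = drop (length vs) bs"
      have bs: "bs = bs1 @ bs2" "length bs1 = length vs" "length bs2 = k' * r"
        using as k' by (auto simp: bs1_def bs2_def)
      show "\<theta> (leftcomb r k (as @ b # a # bs)) = - \<theta> (leftcomb r k (as @ a # b # bs))"
        unfolding bs(1) k'(1) by (rule annihilates_leftcomb_first[OF r \<theta>]) (use len as bs in auto)
    qed
    then show "?\<Psi> ((us @ x # y # vs) @ B) = ?\<Psi> ((us @ y # x # vs) @ B)" by simp
  qed
next
  fix A P B P' :: "('a \<Rightarrow>\<^sub>0 complex) list" and b
  assume A: "length A = Suc (b * r)" and P: "length P = r" "mset P = mset P'" and B: "length A + r + length B = m"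
  obtain k' where k': "k = b + 1 + k'" "length B = k' * r"
    using length_mult_cancel[OF r, of b 1 "length B" k] A P B m by auto
  show "?\<Psi> (A @ P @ B) = ?\<Psi> (A @ P' @ B)"
  proof (rule mset_invariant[OF _ P])
    fix us vs :: "('a \<Rightarrow>\<^sub>0 complex) list" and x y assume len: "length us + length vs + 2 = r"
    have "?\<Psi> ((A @ us) @ x # y # (vs @ B)) = ?\<Psi> ((A @ us) @ y # x # (vs @ B))"
    proof (rule alt_form_adjacent)
      show "length (A @ us) + length (vs @ B) + 2 = m" using len B by simp
      fix as a a' bs assume as: "length as = length (A @ us)" "length bs = length (vs @ B)" "set (as @ a # a' # bs) = {1..m}"
      define as1 as2 where "as1 = take (length A) as" and "as2 = drop (length A) as"
      define bs1 bs2 where "bs1 = take (length vs) bs" and "bs2 = drop (length vs) bs"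
      have bs: "bs = bs1 @ bs2" "length bs1 = length vs" "length bs2 = k' * r"
        and as': "as = as1 @ as2" "length as1 = Suc (b * r)" "length as2 = length us"
        using as k' A by (auto simp: as1_def as2_def bs1_def bs2_def)
      show "\<theta> (leftcomb r k (as @ a' # a # bs)) = - \<theta> (leftcomb r k (as @ a # a' # bs))"
      proof -
        have k: "k = b + Suc k'" using k' by simp
        have "length as2 + length bs1 + 2 = r" using len as' bs by simp
        moreover have "set (as1 @ as2 @ a # a' # bs1 @ bs2) \<subseteq> {1..m}"
          using as(3) as'(1) bs(1) by auto
        ultimately show ?thesis
          unfolding as'(1) bs(1) k append_assoc
          by (rule annihilates_leftcomb_block[OF r \<theta> as'(2) _ bs(3)])
      qed
    qed
    then show "?\<Psi> (A @ (us @ x # y # vs) @ B) = ?\<Psi> (A @ (us @ y # x # vs) @ B)" by simp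
  qed
next
  fix A B :: "('a \<Rightarrow>\<^sub>0 complex) list" and b
  assume A: "length A = Suc (b * r)" and B: "length A + r + r + length B = m"
  obtain k' where k': "k = b + 2 + k'" "length B = k' * r"
    using length_mult_cancel[OF r, of b 2 "length B" k] A B m by auto
  let ?a = "length A" and ?\<tau> = "swap_blocks (length A) r"
  define \<epsilon> :: complex where "\<epsilon> = of_int (sign ?\<tau>)"
  have \<epsilon>: "\<epsilon> * \<epsilon> = 1" by (simp add: \<epsilon>_def flip: of_int_mult)
  have \<tau>: "?\<tau> permutes {1..m}" using B by (intro swap_blocks_permutes) simp
  let ?K = "\<lambda>xs. \<theta> (leftcomb r k xs)"
  have "(\<Sum>i<r. \<Sum>l<r. ?\<Psi> (A @ P[i := Q ! l] @ Q[l := P ! i] @ B))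
           + of_nat (r - 1) * ?\<Psi> (A @ P @ Q @ B) + \<epsilon> * ?\<Psi> (A @ Q @ P @ B) = 0"
    if PQ: "length P = r" "length Q = r" for P Q
  proof -
    let ?xs = "A @ P @ Q @ B"
    define sw :: "nat \<Rightarrow> nat \<Rightarrow> nat list \<Rightarrow> nat list"
      where "sw i l ys = ys[?a + i := ys ! (?a + r + l), ?a + r + l := ys ! (?a + i)]" for i l ys
    have upd: "(xs @ P @ Q @ ys)[?a + i := (xs @ P @ Q @ ys) ! (?a + r + l), ?a + r + l := (xs @ P @ Q @ ys) ! (?a + i)]
        = xs @ P[i := Q ! l] @ Q[l := P ! i] @ ys"
      if "length xs = ?a" "length P = r" "length Q = r" "i < r" "l < r" for xs P Q ys :: "'x list" and i l
      using that by (simp add: nth_append list_update_append)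
    have one: "?\<Psi> (A @ P[i := Q ! l] @ Q[l := P ! i] @ B) = - alt_form m c (\<lambda>ys. ?K (sw i l ys)) ?xs"
      if "i < r" "l < r" for i l
      using alt_form_transpose[of ?xs m "?a + i" "?a + r + l" c ?K] upd[OF refl PQ that, of B] that B PQ
      by (simp add: sw_def)
    have two: "\<epsilon> * ?\<Psi> (A @ Q @ P @ B) = alt_form m c (\<lambda>ys. ?K (reorder m ?\<tau> ys)) ?xs"
      using alt_form_reorder[OF \<tau>, of c ?K ?xs] reorder_swap_blocks[OF PQ B] \<epsilon>
      by (simp add: \<epsilon>_def flip: mult.assoc)
    have "(\<Sum>i<r. \<Sum>l<r. alt_form m c (\<lambda>ys. ?K (sw i l ys)) ?xs) = alt_form m c (\<lambda>ys. \<Sum>i<r. \<Sum>l<r. ?K (sw i l ys)) ?xs"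
      by (simp add: alt_form_sum)
    also have "\<dots> = alt_form m c (\<lambda>ys. of_nat (r - 1) * ?K ys + ?K (reorder m ?\<tau> ys)) ?xs"
    proof (rule alt_form_cong)
      fix ys :: "nat list" assume ys: "length ys = m" "set ys = {1..m}"
      define y1 y2 y3 y4 where "y1 = take ?a ys" and "y2 = take r (drop ?a ys)"
        and "y3 = take r (drop (?a + r) ys)" and "y4 = drop (?a + r + r) ys"
      have y: "ys = y1 @ y2 @ y3 @ y4"
        unfolding y1_def y2_def y3_def y4_def
        by (metis add.commute append_take_drop_id drop_drop)
      have len: "length y1 = ?a" "length y2 = r" "length y3 = r" "length y4 = k' * r"
        using ys B k' by (auto simp: y1_def y2_def y3_def y4_def)
      have sub: "set (y1 @ y2 @ y3 @ y4) \<subseteq> {1..m}" using ys(2) y by simp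
      have "sw i l ys = y1 @ y2[i := y3 ! l] @ y3[l := y2 ! i] @ y4" if "i < r" "l < r" for i l
        unfolding sw_def y using that len by (intro upd)
      moreover have "reorder m ?\<tau> ys = y1 @ y3 @ y2 @ y4"
        using reorder_swap_blocks[of y2 r y3 y1 y4 m] len B k' unfolding y by simp
      ultimately show "(\<Sum>i<r. \<Sum>l<r. ?K (sw i l ys)) = of_nat (r - 1) * ?K ys + ?K (reorder m ?\<tau> ys)"
        using annihilates_leftcomb_exchange[OF r \<theta> len(1)[unfolded A] len(2,3,4) sub] k'(1) unfolding y by simp
    qed
    finally show ?thesis
      using one by (simp add: sum_negf alt_form_add alt_form_scale two)
  qed
  with \<epsilon> show "\<exists>\<epsilon>. \<epsilon> * \<epsilon> = 1 \<and> (\<forall>P Q. length P = r \<longrightarrow> length Q = r \<longrightarrow>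
     (\<Sum>i<r. \<Sum>l<r. ?\<Psi> (A @ P[i := Q ! l] @ Q[l := P ! i] @ B))
           + of_nat (r - 1) * ?\<Psi> (A @ P @ Q @ B) + \<epsilon> * ?\<Psi> (A @ Q @ P @ B) = 0)"
    by blast
next
  fix B :: "('a \<Rightarrow>\<^sub>0 complex) list" and x
  assume r1: "r = 1" and B: "length B + 3 = m"
  let ?K = "\<lambda>xs. \<theta> (leftcomb r k xs)" and ?xs = "x # x # x # B"
  \<comment> \<open>Both transpositions fix the vectors x, x, x but carry the sign -1, so the
    identity becomes \<open>\<Psi> = - \<Psi> - \<Psi>\<close>.\<close>
  have "?\<Psi> ?xs = alt_form m c (\<lambda>ys. ?K (ys[1 := ys ! 2, 2 := ys ! 1]) + ?K (ys[0 := ys ! 2, 2 := ys ! 0])) ?xs"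
  proof (rule alt_form_cong)
    fix ys :: "nat list" assume ys: "length ys = m" "set ys = {1..m}"
    obtain k' where k': "k = 2 + k'" using B m r1 by (intro that[of "k - 2"]) auto
    obtain y1 y2 y3 y4 where y: "ys = y1 # y2 # y3 # y4" "length y4 = k'"
    proof -
      from ys B obtain y1 y2 y3 y4 where "ys = y1 # y2 # y3 # y4"
        by (cases ys; cases "tl ys"; cases "tl (tl ys)") auto
      with that ys m r1 k' show ?thesis by auto
    qed
    show "?K ys = ?K (ys[1 := ys ! 2, 2 := ys ! 1]) + ?K (ys[0 := ys ! 2, 2 := ys ! 0])"
    proof -
      have "annihilates 2 {1..m} \<theta>" using \<theta> r1 by (simp add: numeral_2_eq_2)
      moreover have "set (y1 # y2 # y3 # y4) \<subseteq> {1..m}" using ys(2) y(1) by simp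
      ultimately show ?thesis
        using annihilates_leftcomb_Lie[OF _ y(2)] unfolding y(1) k' r1 by (simp add: numeral_2_eq_2)
    qed
  qed
  also have "\<dots> = - ?\<Psi> (?xs[1 := ?xs ! 2, 2 := ?xs ! 1]) - ?\<Psi> (?xs[0 := ?xs ! 2, 2 := ?xs ! 0])"
    using alt_form_transpose[of ?xs m 1 2 c ?K] alt_form_transpose[of ?xs m 0 2 c ?K] B
    by (simp add: alt_form_add)
  also have "?xs[1 := ?xs ! 2, 2 := ?xs ! 1] = ?xs" by (simp add: numeral_2_eq_2)
  also have "?xs[0 := ?xs ! 2, 2 := ?xs ! 0] = ?xs" by (simp add: numeral_2_eq_2)
  finally show "?\<Psi> ?xs = 0" by (simp add: eq_neg_iff_add_eq_0)
qed

lemma map_nword_comb: "map_nword f (comb r k z xs) = comb r k (map_nword f z) (map f xs)"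
  by (induction k arbitrary: z xs) (auto simp: take_map drop_map comp_def)

lemma map_nword_leftcomb: "xs \<noteq> [] \<Longrightarrow> map_nword f (leftcomb r k xs) = leftcomb r k (map f xs)"
  by (simp add: leftcomb_def map_nword_comb hd_map map_tl)

lemma inj_on_single: "inj_on (\<lambda>i. Poly_Mapping.single i (1::complex)) S"
  by (rule inj_onI) (metis lookup_single_eq lookup_single_not_eq one_neq_zero)

lemma independent_singles:
  fixes S :: "'c set"
  assumes "finite S"
  shows "lc.independent ((\<lambda>i. Poly_Mapping.single i (1::complex)) ` S)"
proof (rule lc.independent_if_scalars_zero)
  let ?e = "\<lambda>i. Poly_Mapping.single i (1::complex)"
  show "finite (?e ` S)" using assms by simp
  have inj: "inj_on ?e S" by (rule inj_on_single)
  fix f :: "('c \<Rightarrow>\<^sub>0 complex) \<Rightarrow> complex" and x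
  assume "(\<Sum>x\<in>?e ` S. lc_scale (f x) x) = 0" "x \<in> ?e ` S"
  then obtain i where i: "i \<in> S" "x = ?e i" and sum: "(\<Sum>j\<in>S. lc_scale (f (?e j)) (?e j)) = 0"
    by (auto simp: sum.reindex[OF inj])
  have "0 = Poly_Mapping.lookup (\<Sum>j\<in>S. lc_scale (f (?e j)) (?e j)) i" by (simp add: sum)
  also have "\<dots> = (\<Sum>j\<in>S. f (?e j) * (if j = i then 1 else 0))"
    by (simp add: lookup_sum lookup_single when_def)
  also have "\<dots> = (\<Sum>j\<in>S. if j = i then f (?e i) else 0)" by (intro sum.cong) auto
  also have "\<dots> = f (?e i)" using assms i by simp
  finally show "f x = 0" using i by simp
qed

text \<open>The form is evaluated at basis vectors, in each position the one of the class of its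
  letter. The product of coordinates is then 1 for permutations preserving the classes and 0
  otherwise, and r classes give vectors in a space of dimension r.\<close>

lemma alt_leftcomb_eq_0:
  assumes r: "1 \<le> r" "r < k" and m: "m = Suc (k * r)" and \<theta>: "annihilates (Suc r) {1..m} \<theta>"
    and c: "\<And>x. x \<in> {1..m} \<Longrightarrow> c x < r" and xs: "mset xs = mset_set {1..m}"
  shows "(\<Sum>\<sigma> | \<sigma> permutes {1..m} \<and> (\<forall>x\<in>{1..m}. c (\<sigma> x) = c x).
      of_int (sign \<sigma>) * \<theta> (leftcomb r k (map \<sigma> xs))) = 0"
proof -
  let ?X = "{1..m}" and ?K = "\<lambda>xs. \<theta> (leftcomb r k xs)"
  have len: "length xs = m" by (metis xs card_atLeastAtMost diff_Suc_1 size_mset size_mset_set)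
  have set: "set xs = ?X" by (metis xs finite_atLeastAtMost finite_set_mset_mset_set set_mset_mset)
  have dist: "distinct xs" using len set by (simp add: card_distinct)
  \<comment> \<open>\<open>xs\<close> lists every letter once and so is a permutation g of the
    positions; summing over \<sigma> \<circ> g turns rearrangements of positions into relabellings
    \<sigma> of letters.\<close>
  define g where "g i = (if i \<in> ?X then xs ! (i - 1) else i)" for i
  have g: "g permutes ?X"
  proof (rule bij_imp_permutes)
    have "inj_on g ?X"
      using dist len by (auto simp: inj_on_def g_def nth_eq_iff_index_eq)
    moreover have "g ` ?X \<subseteq> ?X"
      using set len nth_mem by (force simp: g_def)
    ultimately show "bij_betw g ?X ?X"
      by (simp add: bij_betw_def endo_inj_surj)
  qed (auto simp: g_def)
  have xs_g: "xs = map g [1..<Suc m]"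
    using len by (intro nth_equalityI) (auto simp: g_def simp del: upt_Suc)
  define E where "E = (\<lambda>i. Poly_Mapping.single i (1::complex)) ` {..<r}"
  define L where "L = map (\<lambda>i. Poly_Mapping.single (c (g i)) (1::complex)) [1..<Suc m]"
  note rk = \<open>r < k\<close>
  interpret comb_form r m "alt_form m c ?K"
    by (rule comb_form_alt_form[OF r(1) m \<theta>])
  have "alt_form m c ?K L = 0"
  proof (rule comb_form_eq_0[OF _ _ _ m rk])
    show "finite E" "lc.independent E" by (simp_all add: E_def independent_singles)
    show "card E = r" by (simp add: E_def card_image inj_on_single)
    have "c (g i) < r" if "i \<in> ?X" for i
      using c permutes_in_image[OF g] that by blast
    then have "set L \<subseteq> E" by (auto simp: L_def E_def)
    then show "set L \<subseteq> lc.span E" using lc.span_superset by blast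
  qed (simp add: L_def del: upt_Suc)
  also have "alt_form m c ?K L = (\<Sum>\<sigma> | \<sigma> permutes ?X. of_int (sign (\<sigma> \<circ> g)) *
        (\<Prod>i\<in>?X. Poly_Mapping.lookup (L ! (i - 1)) (c ((\<sigma> \<circ> g) i))) * ?K (map (\<sigma> \<circ> g) [1..<Suc m]))"
    unfolding alt_form_def by (rule sum_permutations_compose_right[OF g])
  also have "\<dots> = (\<Sum>\<sigma> | \<sigma> permutes ?X. of_int (sign g) *
      (if \<forall>x\<in>?X. c (\<sigma> x) = c x then of_int (sign \<sigma>) * ?K (map \<sigma> xs) else 0))"
  proof (rule sum.cong[OF refl])
    fix \<sigma> assume "\<sigma> \<in> {\<sigma>. \<sigma> permutes ?X}"
    then have "permutation \<sigma>" "permutation g" using g permutes_imp_permutation[of ?X] by auto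
    then have sgn: "sign (\<sigma> \<circ> g) = sign \<sigma> * sign g" by (rule sign_compose)
    have "(\<Prod>i\<in>?X. Poly_Mapping.lookup (L ! (i - 1)) (c ((\<sigma> \<circ> g) i)))
      = (\<Prod>i\<in>?X. (\<lambda>x. if c (\<sigma> x) = c x then 1 else 0) (g i))"
      by (intro prod.cong refl) (auto simp: L_def lookup_single when_def simp del: upt_Suc)
    also have "\<dots> = (\<Prod>x\<in>?X. if c (\<sigma> x) = c x then 1 else 0)"
      using prod.permute[OF g, of "\<lambda>x. if c (\<sigma> x) = c x then 1 else (0::complex)"] by (simp add: comp_def)
    also have "\<dots> = (if \<forall>x\<in>?X. c (\<sigma> x) = c x then 1 else 0)"
      by (auto intro!: prod.neutral prod_zero)
    finally have prod: "(\<Prod>i\<in>?X. Poly_Mapping.lookup (L ! (i - 1)) (c ((\<sigma> \<circ> g) i)))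
      = (if \<forall>x\<in>?X. c (\<sigma> x) = c x then 1 else 0)" .
    have "map (\<sigma> \<circ> g) [1..<Suc m] = map \<sigma> xs" by (simp add: xs_g del: upt_Suc)
    then show "of_int (sign (\<sigma> \<circ> g)) * (\<Prod>i\<in>?X. Poly_Mapping.lookup (L ! (i - 1)) (c ((\<sigma> \<circ> g) i))) *
        ?K (map (\<sigma> \<circ> g) [1..<Suc m])
      = of_int (sign g) * (if \<forall>x\<in>?X. c (\<sigma> x) = c x then of_int (sign \<sigma>) * ?K (map \<sigma> xs) else 0)"
      unfolding prod sgn by simp
  qed
  also have "\<dots> = of_int (sign g) * (\<Sum>\<sigma> | \<sigma> permutes ?X.
      if \<forall>x\<in>?X. c (\<sigma> x) = c x then of_int (sign \<sigma>) * ?K (map \<sigma> xs) else 0)"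
    by (rule sum_distrib_left[symmetric])
  also have "(\<Sum>\<sigma> | \<sigma> permutes ?X.
      if \<forall>x\<in>?X. c (\<sigma> x) = c x then of_int (sign \<sigma>) * ?K (map \<sigma> xs) else 0)
     = (\<Sum>\<sigma>\<in>{\<sigma> \<in> {\<sigma>. \<sigma> permutes ?X}. \<forall>x\<in>?X. c (\<sigma> x) = c x}. of_int (sign \<sigma>) * ?K (map \<sigma> xs))"
    by (rule sum.inter_filter[symmetric]) (simp add: finite_permutations)
  finally show ?thesis by (simp add: sign_nz)
qed

lemma annihilates_lincomb:
  assumes "\<And>i. i \<in> I \<Longrightarrow> annihilates n X (\<theta> i)"
  shows "annihilates n X (\<lambda>w. \<Sum>i\<in>I. a i * \<theta> i w)"
  unfolding annihilates_def
proof
  fix p assume p: "p \<in> filippov_ideal n X"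
  have "ext (\<lambda>w. \<Sum>i\<in>I. a i * \<theta> i w) p = (\<Sum>i\<in>I. a i * ext (\<theta> i) p)"
    unfolding ext_def sum_distrib_left by (subst sum.swap) (simp add: mult_ac)
  also have "\<dots> = 0" using assms p by (simp add: annihilates_def)
  finally show "ext (\<lambda>w. \<Sum>i\<in>I. a i * \<theta> i w) p = 0" .
qed

lemma mset_set_letters:
  assumes "mset (letters w) = mset_set X" "finite X"
  shows "set (letters w) = X" "distinct (letters w)"
  using assms by (metis finite_set_mset_mset_set set_mset_mset)
    (metis assms distinct_count_atmost_1 count_mset_set(1) count_mset_set(3) finite_set_mset_mset_set set_mset_mset)

lemma brackets_multilinear:
  assumes "1 \<le> r" "w \<in> multilinear_words (Suc r) {1..Suc (k * r)}"
  shows "brackets w = k"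
proof -
  have "length (letters w) = Suc (k * r)"
    using assms(2) by (metis (mono_tags, lifting) card_atLeastAtMost diff_Suc_1 mem_Collect_eq multilinear_words_def size_mset size_mset_set)
  then show ?thesis
    using length_letters[of w r] assms by (auto simp: multilinear_words_def)
qed

text \<open>The alternating sum is itself a functional annihilating the ideal, so checking it on
  left-normed words suffices.\<close>

lemma alternating_sum_eq_0:
  assumes r: "1 \<le> r" "r < k" and m: "m = Suc (k * r)"
    and \<theta>: "\<And>\<sigma>. \<sigma> permutes {1..m} \<Longrightarrow> annihilates (Suc r) {1..m} (\<lambda>w. \<theta> (map_nword \<sigma> w))"
    and c: "\<And>x. x \<in> {1..m} \<Longrightarrow> c x < r" and w: "w \<in> multilinear_words (Suc r) {1..m}"
  shows "(\<Sum>\<sigma> | \<sigma> permutes {1..m} \<and> (\<forall>x\<in>{1..m}. c (\<sigma> x) = c x).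
      of_int (sign \<sigma>) * \<theta> (map_nword \<sigma> w)) = 0"
proof (rule annihilates_combs_imp_eq_0[OF r(1)])
  show "annihilates (Suc r) {1..m} (\<lambda>w. \<Sum>\<sigma> | \<sigma> permutes {1..m} \<and> (\<forall>x\<in>{1..m}. c (\<sigma> x) = c x).
      of_int (sign \<sigma>) * \<theta> (map_nword \<sigma> w))"
    using \<theta> by (intro annihilates_lincomb) auto
  show "w \<in> nwords (Suc r) {1..m}" using w by (simp add: multilinear_words_def)
  fix xs assume "mset xs = mset (letters w)"
  then have xs: "mset xs = mset_set {1..m}" using w by (simp add: multilinear_words_def)
  then have "xs \<noteq> []" using m by (auto simp: mset_set_empty_iff)
  have k: "brackets w = k" using brackets_multilinear[OF r(1)] w m by simp
  have "annihilates (Suc r) {1..m} \<theta>"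
    using \<theta>[OF permutes_id] by (simp add: nword.map_id0 id_def[symmetric])
  from alt_leftcomb_eq_0[OF r m this c xs]
  show "(\<Sum>\<sigma> | \<sigma> permutes {1..m} \<and> (\<forall>x\<in>{1..m}. c (\<sigma> x) = c x).
      of_int (sign \<sigma>) * \<theta> (map_nword \<sigma> (comb r (brackets w) (Letter (hd xs)) (tl xs)))) = 0"
    by (simp add: k map_nword_leftcomb[OF \<open>xs \<noteq> []\<close>] flip: leftcomb_def)
qed

lemma map_nword_fixed: "(\<And>a. a \<in> set (letters w) \<Longrightarrow> f a = a) \<Longrightarrow> map_nword f w = w"
  by (induction w) (auto intro!: map_idI)

lemma distinct_concat_disjoint:
  "distinct (concat xss) \<Longrightarrow> i < length xss \<Longrightarrow> j < length xss \<Longrightarrow> i \<noteq> j \<Longrightarrow> set (xss ! i) \<inter> set (xss ! j) = {}"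
proof (induction xss arbitrary: i j)
  case (Cons xs xss)
  have "set xs \<inter> set (xss ! l) = {}" if "l < length xss" for l
    using Cons.prems(1) nth_mem[OF that] by fastforce
  with Cons show ?case by (cases i; cases j) (simp_all add: Int_commute)
qed simp

section \<open>Words with many letters from a set\<close>

text \<open>Pigeonhole: each letter sits directly inside exactly one bracket, so two letters of A
  share one, and transposing them costs a sign. The pair is chosen before \<open>\<theta>\<close>,
  because the induction passes from \<open>\<theta>\<close> to a functional on a subword.\<close>

lemma annihilates_two_letters:
  assumes "w \<in> nwords n X" "distinct (letters w)" "brackets w < card (A \<inter> set (letters w))" "0 < brackets w"
  shows "\<exists>x y. x \<in> A \<inter> set (letters w) \<and> y \<in> A \<inter> set (letters w) \<and> x \<noteq> y \<and>
    (\<forall>\<theta>. annihilates n X \<theta> \<longrightarrow> \<theta> (map_nword (Transposition.transpose x y) w) = - \<theta> w)"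
  using assms
proof (induction w rule: nwords.induct)
  case (Bracket ws)
  have ws: "set ws \<subseteq> nwords n X" using Bracket.hyps by blast
  have disj: "set (letters (ws ! i)) \<inter> set (letters (ws ! l)) = {}" if "i < n" "l < n" "i \<noteq> l" for i l
    using distinct_concat_disjoint[of "map letters ws" i l] Bracket.prems(1) Bracket.hyps(1) that by simp
  have sub: "set (letters (ws ! i)) \<subseteq> set (letters (Bracket ws))" if "i < n" for i
  proof -
    have "ws ! i \<in> set ws" using that Bracket.hyps(1) by simp
    then show ?thesis by auto
  qed
  define D where "D = {i. i < n \<and> (\<exists>x\<in>A. ws ! i = Letter x)}"
  show ?case
  proof (cases "card D \<le> 1")
    case False
    then obtain i l where il: "i \<in> D" "l \<in> D" "i \<noteq> l"
      by (metis One_nat_def card.infinite card_le_Suc0_iff_eq nat_le_linear zero_le)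
    then obtain x y where xy: "x \<in> A" "y \<in> A" "ws ! i = Letter x" "ws ! l = Letter y" "i < n" "l < n"
      by (auto simp: D_def)
    let ?t = "Transposition.transpose x y"
    have "x \<noteq> y" using disj[of i l] xy il by auto
    have "map_nword ?t (Bracket ws) = Bracket (ws[i := ws ! l, l := ws ! i])"
    proof -
      have "map_nword ?t (ws ! h) = ws[i := ws ! l, l := ws ! i] ! h" if "h < n" for h
      proof -
        consider "h = i" | "h = l" | "h \<noteq> i" "h \<noteq> l" by blast
        then show ?thesis
        proof cases
          case 3
          then have "x \<notin> set (letters (ws ! h))" "y \<notin> set (letters (ws ! h))"
            using disj[of h i] disj[of h l] xy that by auto
          then have "map_nword ?t (ws ! h) = ws ! h"
            by (intro map_nword_fixed) (auto simp: Transposition.transpose_def)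
          then show ?thesis using 3 by simp
        qed (use xy il Bracket.hyps(1) in \<open>auto simp: nth_list_update\<close>)
      qed
      then have "map (map_nword ?t) ws = ws[i := ws ! l, l := ws ! i]"
        using Bracket.hyps(1) by (intro nth_equalityI) auto
      then show ?thesis by simp
    qed
    moreover have "x \<in> set (letters (Bracket ws))" "y \<in> set (letters (Bracket ws))"
      using sub[of i] sub[of l] xy by auto
    ultimately show ?thesis
      using annihilates_transpose[OF _ Bracket.hyps(1) ws xy(5,6) il(3)] xy \<open>x \<noteq> y\<close> by (metis IntI)
  next
    case True
    have "\<exists>i<n. brackets (ws ! i) < card (A \<inter> set (letters (ws ! i))) \<and> 0 < brackets (ws ! i)"
    proof (rule ccontr)
      assume no: "\<not> ?thesis"
      \<comment> \<open>Without a subword having too many letters of A, the entries contribute at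
        most their own brackets plus \<open>card D\<close>; the outermost bracket pays for
        \<open>card D \<le> 1\<close>.\<close>
      have le: "card (A \<inter> set (letters (ws ! i))) \<le> brackets (ws ! i) + (if i \<in> D then 1 else 0)" if "i < n" for i
      proof (cases "brackets (ws ! i) = 0")
        case True
        then obtain x where "ws ! i = Letter x" by (auto simp: brackets_eq_0)
        then show ?thesis using that by (auto simp: D_def Int_insert_right)
      next
        case False
        with no that have "card (A \<inter> set (letters (ws ! i))) \<le> brackets (ws ! i)"
          by (metis not_less neq0_conv)
        then show ?thesis by simp
      qed
      have "set (letters (Bracket ws)) = (\<Union>i<n. set (letters (ws ! i)))"
      proof -
        have "set ws = (!) ws ` {..<n}" using Bracket.hyps(1) by (auto simp: set_conv_nth)
        then show ?thesis by simp
      qed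
      then have "A \<inter> set (letters (Bracket ws)) = (\<Union>i<n. A \<inter> set (letters (ws ! i)))" by blast
      then have "card (A \<inter> set (letters (Bracket ws))) \<le> (\<Sum>i<n. card (A \<inter> set (letters (ws ! i))))"
        using card_UN_le[of "{..<n}" "\<lambda>i. A \<inter> set (letters (ws ! i))"] by (simp only: finite_lessThan)
      also have "\<dots> \<le> (\<Sum>i<n. brackets (ws ! i) + (if i \<in> D then 1 else 0))"
        using le by (intro sum_mono) auto
      also have "\<dots> = (\<Sum>i<n. brackets (ws ! i)) + card D"
      proof -
        have "D \<subseteq> {..<n}" by (auto simp: D_def)
        then have "(\<Sum>i<n. if i \<in> D then 1 else 0) = card D"
          by (simp add: sum.If_cases Int_absorb1)
        then show ?thesis by (simp add: sum.distrib)
      qed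
      also have "(\<Sum>i<n. brackets (ws ! i)) = sum_list (map brackets ws)"
        using Bracket.hyps(1) by (simp add: sum_list_sum_nth atLeast0LessThan)
      finally show False using True Bracket.prems(2) by simp
    qed
    then obtain i where i: "i < n" "brackets (ws ! i) < card (A \<inter> set (letters (ws ! i)))" "0 < brackets (ws ! i)"
      by blast
    let ?v = "ws ! i"
    have v: "?v \<in> set ws" using i Bracket.hyps(1) by simp
    then have "distinct (letters ?v)" using Bracket.prems(1) by (auto simp: distinct_concat_iff)
    with Bracket.IH[OF v] i obtain x y where xy: "x \<in> A \<inter> set (letters ?v)" "y \<in> A \<inter> set (letters ?v)" "x \<noteq> y"
      and IH: "\<And>\<theta>. annihilates n X \<theta> \<Longrightarrow> \<theta> (map_nword (Transposition.transpose x y) ?v) = - \<theta> ?v"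
      by blast
    let ?t = "Transposition.transpose x y"
    have "map_nword ?t (ws ! h) = ws ! h" if "h < n" "h \<noteq> i" for h
      using disj[of h i] that xy i by (intro map_nword_fixed) (auto simp: Transposition.transpose_def)
    then have "map (map_nword ?t) ws = ws[i := map_nword ?t ?v]"
      using Bracket.hyps(1) i by (intro nth_equalityI) (auto simp: nth_list_update)
    then have map: "map_nword ?t (Bracket ws) = Bracket (take i ws @ map_nword ?t ?v # drop (Suc i) ws)"
      using i Bracket.hyps(1) by (simp add: upd_conv_take_nth_drop)
    have eq: "ws = take i ws @ ?v # drop (Suc i) ws"
      using i Bracket.hyps(1) by (intro id_take_nth_drop) simp
    have "\<theta> (map_nword ?t (Bracket ws)) = - \<theta> (Bracket ws)" if \<theta>: "annihilates n X \<theta>" for \<theta>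
    proof -
      have "annihilates n X (\<lambda>u. \<theta> (Bracket (take i ws @ u # drop (Suc i) ws)))"
        using i Bracket.hyps(1) ws set_take_subset[of i ws] set_drop_subset[of "Suc i" ws]
        by (intro annihilates_slot[OF \<theta>]) auto
      from IH[OF this] show ?thesis unfolding map using eq by simp
    qed
    then show ?thesis using xy sub[OF i(1)] by blast
  qed
qed simp

text \<open>Replacing \<pi> by \<pi> composed with the transposition of the two letters shows that
  the sum equals its own negative.\<close>

lemma symmetric_sum_eq_0:
  assumes w: "w \<in> nwords n X" "distinct (letters w)" "brackets w < card (A \<inter> set (letters w))" "0 < brackets w"
    and \<theta>: "\<And>\<pi>. \<pi> permutes A \<Longrightarrow> annihilates n X (\<lambda>w. \<theta> (map_nword \<pi> w))"
  shows "(\<Sum>\<pi> | \<pi> permutes A. \<theta> (map_nword \<pi> w)) = 0"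
proof -
  obtain x y where xy: "x \<in> A" "y \<in> A"
    and sgn: "\<And>\<theta>. annihilates n X \<theta> \<Longrightarrow> \<theta> (map_nword (Transposition.transpose x y) w) = - \<theta> w"
    using annihilates_two_letters[OF w] by blast
  have "(\<Sum>\<pi> | \<pi> permutes A. \<theta> (map_nword \<pi> w)) =
     (\<Sum>\<pi> | \<pi> permutes A. \<theta> (map_nword (\<pi> \<circ> Transposition.transpose x y) w))"
    by (rule sum_permutations_compose_right) (rule permutes_swap_id[OF xy])
  also have "\<dots> = (\<Sum>\<pi> | \<pi> permutes A. - \<theta> (map_nword \<pi> w))"
    using sgn[OF \<theta>] by (intro sum.cong) (auto simp: nword.map_comp[symmetric])
  finally show ?thesis by (simp add: sum_negf)
qed

text \<open>A basis of the ideal stays independent when p is added, so some linear functional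
  vanishes on the basis and is 1 at p.\<close>

lemma separating_functional:
  assumes "p \<notin> filippov_ideal n X"
  obtains \<theta> where "annihilates n X \<theta>" "ext \<theta> p \<noteq> 0"
proof -
  interpret vp: vector_space_pair lc_scale "(*) :: complex \<Rightarrow> complex \<Rightarrow> complex"
    by unfold_locales (auto simp: algebra_simps)
  let ?I = "filippov_ideal n X"
  have I: "lc.subspace ?I"
    by (rule lc.subspaceI) (auto intro: filippov_ideal.intros)
  obtain B where B: "B \<subseteq> ?I" "lc.independent B" "?I \<subseteq> lc.span B"
    using lc.maximal_independent_subset by blast
  have "lc.span B \<subseteq> ?I" using B(1) I by (rule lc.span_minimal)
  then have "p \<notin> lc.span B" using assms by blast
  then have "lc.independent (insert p B)" using B(2) by (simp add: lc.independent_insert)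
  then obtain g where g: "Vector_Spaces.linear lc_scale (*) g" "\<forall>x\<in>insert p B. g x = (if x = p then 1 else 0)"
    using vp.linear_independent_extend[of "insert p B" "\<lambda>x. if x = p then 1 else 0"] by blast
  interpret g: Vector_Spaces.linear lc_scale "(*)" g by (rule g(1))
  have ext: "ext (\<lambda>w. g (word w)) q = g q" for q
  proof -
    have "q = (\<Sum>w\<in>Poly_Mapping.keys q. lc_scale (Poly_Mapping.lookup q w) (word w))"
    proof (rule poly_mapping_eqI)
      fix v
      have "Poly_Mapping.lookup (\<Sum>w\<in>Poly_Mapping.keys q. lc_scale (Poly_Mapping.lookup q w) (word w)) v
        = (\<Sum>w\<in>Poly_Mapping.keys q. if w = v then Poly_Mapping.lookup q v else 0)"
        unfolding lookup_sum by (intro sum.cong) (auto simp: lookup_single when_def)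
      then show "Poly_Mapping.lookup q v = Poly_Mapping.lookup (\<Sum>w\<in>Poly_Mapping.keys q. lc_scale (Poly_Mapping.lookup q w) (word w)) v"
        by (simp add: in_keys_iff)
    qed
    then have "g q = g (\<Sum>w\<in>Poly_Mapping.keys q. lc_scale (Poly_Mapping.lookup q w) (word w))" by simp
    then show ?thesis by (simp add: g.sum g.scale ext_def)
  qed
  have "g q = 0" if "q \<in> ?I" for q
  proof (rule vp.linear_eq_0_on_span[OF g(1), of B])
    show "q \<in> lc.span B" using that B by blast
    show "g x = 0" if "x \<in> B" for x
      using g(2) that \<open>p \<notin> lc.span B\<close> lc.span_base by auto
  qed
  then show ?thesis
    using that[of "\<lambda>w. g (word w)"] g(2) by (simp add: ext annihilates_def)
qed

section \<open>Polytabloids and the theorem\<close>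

lemma ext_eqI: "(\<And>\<theta>. ext \<theta> p = ext \<theta> q) \<Longrightarrow> p = q"
proof (rule poly_mapping_eqI)
  fix k assume eq: "\<And>\<theta>. ext \<theta> p = ext \<theta> q"
  have "ext (\<lambda>b. if b = k then 1 else 0) p = Poly_Mapping.lookup p k" for p :: "'a \<Rightarrow>\<^sub>0 complex"
  proof -
    have "ext (\<lambda>b. if b = k then 1 else 0) p = (\<Sum>b\<in>Poly_Mapping.keys p. if b = k then Poly_Mapping.lookup p k else 0)"
      unfolding ext_def by (intro sum.cong) auto
    then show ?thesis by (simp add: in_keys_iff)
  qed
  then show "Poly_Mapping.lookup p k = Poly_Mapping.lookup q k" using eq by metis
qed

definition push :: "('a \<Rightarrow> 'b) \<Rightarrow> ('a \<Rightarrow>\<^sub>0 complex) \<Rightarrow> ('b \<Rightarrow>\<^sub>0 complex)" where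
  "push a p = (\<Sum>b\<in>Poly_Mapping.keys p. Poly_Mapping.single (a b) (Poly_Mapping.lookup p b))"

lemma ext_push [simp]: "ext \<theta> (push a p) = ext (\<lambda>b. \<theta> (a b)) p"
  by (simp add: push_def) (simp add: ext_def)

lemma specht_simps:
  "carrier (specht la) = lc.span (polytabloid la ` tableaux la)"
  "ring.add (specht la) = (+)" "Module.smult (specht la) = lc_scale"
  "act (specht la) = (\<lambda>\<sigma>. push (map ((`) \<sigma>)))"
  by (simp_all add: specht_def lc_module_def push_def fun_eq_iff)

lemma rho_simps:
  assumes "I = filippov_ideal n {1..k * (n - 1) + 1}"
  shows "carrier (rho n k) = {(\<lambda>i. i + p) ` I | p. p \<in> lc_over (multilinear_words n {1..k * (n - 1) + 1})}"
    and "Module.smult (rho n k) c A = {i + lc_scale c a | i a. i \<in> I \<and> a \<in> A}"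
    and "act (rho n k) \<sigma> A = push (map_nword \<sigma>) ` A"
  unfolding assms
  by (auto simp: rho_def multilinear_component_def free_filippov_def quotient_perm_module_def lc_module_def
     a_r_coset_def r_coset_def set_add_def set_mult_def push_def image_def)

text \<open>Equivariance at \<open>0\<close> shows that the ideal, being the image of \<open>0\<close>, is stable under permutations of the letters.\<close>

lemma embedding_functional:
  assumes f: "perm_module_embedding m (specht la) (rho n k) f"
    and n: "2 \<le> n" and m: "m = k * (n - 1) + 1"
    and e: "e \<in> carrier (specht la)" "e \<noteq> 0"
  obtains p \<theta> where "p \<in> lc_over (multilinear_words n {1..m})" "ext \<theta> p \<noteq> 0"
    and "\<And>\<sigma>. \<sigma> permutes {1..m} \<Longrightarrow> annihilates n {1..m} (\<lambda>w. \<theta> (map_nword \<sigma> w))"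
    and "\<And>\<sigma> s. \<sigma> permutes {1..m} \<Longrightarrow> act (specht la) \<sigma> e = lc_scale s e \<Longrightarrow>
      ext (\<lambda>w. \<theta> (map_nword \<sigma> w)) p = s * ext \<theta> p"
proof -
  define I where "I = filippov_ideal n {1..m}"
  have I: "lc.subspace I"
    unfolding I_def by (rule lc.subspaceI) (auto intro: filippov_ideal.intros)
  note rho = rho_simps[of I n k, folded m, OF I_def]
  have f_carrier: "f x \<in> carrier (rho n k)" if "x \<in> carrier (specht la)" for x
    using f that by (auto simp: perm_module_embedding_def)
  have f_scale: "f (lc_scale c x) = {i + lc_scale c a | i a. i \<in> I \<and> a \<in> f x}" if "x \<in> carrier (specht la)" for c x
    using f that unfolding perm_module_embedding_def specht_simps rho(2) by blast
  have f_act: "f (act (specht la) \<sigma> x) = push (map_nword \<sigma>) ` f x"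
    if "\<sigma> permutes {1..m}" "x \<in> carrier (specht la)" for \<sigma> x
    using f that unfolding perm_module_embedding_def rho(3) by blast
  have zero: "0 \<in> carrier (specht la)" by (simp add: specht_simps lc.span_zero)
  \<comment> \<open>Obtained by scaling 0 by 0: the summand \<open>U\<close> in the quotient makes 0
    times a coset the ideal itself.\<close>
  have f0: "f 0 = I"
  proof -
    obtain p where p: "f 0 = (\<lambda>i. i + p) ` I" using f_carrier[OF zero] rho(1) by auto
    have "f 0 = {i + lc_scale 0 a | i a. i \<in> I \<and> a \<in> f 0}"
      using f_scale[OF zero, of 0] by (simp add: lc.scale_zero_right)
    also have "\<dots> = I" using lc.subspace_0[OF I] unfolding p by auto
    finally show ?thesis .
  qed
  have closed: "push (map_nword \<sigma>) q \<in> I" if "\<sigma> permutes {1..m}" "q \<in> I" for \<sigma> q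
  proof -
    have "act (specht la) \<sigma> 0 = 0" by (simp add: specht_simps push_def)
    with f_act[OF that(1) zero] have "push (map_nword \<sigma>) ` I = I" by (simp add: f0)
    with that(2) show ?thesis by blast
  qed
  obtain p where p: "f e = (\<lambda>i. i + p) ` I" "p \<in> lc_over (multilinear_words n {1..m})"
    using f_carrier[OF e(1)] rho(1) by auto
  have "p \<notin> I"
  proof
    assume "p \<in> I"
    have "f e = I"
    proof
      show "f e \<subseteq> I" unfolding p(1) using lc.subspace_add[OF I] \<open>p \<in> I\<close> by auto
      have "q = (q - p) + p" "q - p \<in> I" if "q \<in> I" for q
        using that lc.subspace_diff[OF I] \<open>p \<in> I\<close> by auto
      then show "I \<subseteq> f e" unfolding p(1) by blast
    qed
    then have "e = 0"
      using f e(1) zero f0 unfolding perm_module_embedding_def by (metis inj_onD)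
    with e(2) show False by simp
  qed
  then obtain \<theta> where \<theta>: "annihilates n {1..m} \<theta>" "ext \<theta> p \<noteq> 0"
    unfolding I_def by (rule separating_functional)
  have ann: "ext \<theta> q = 0" if "q \<in> I" for q using \<theta>(1) that by (simp add: annihilates_def I_def)
  show ?thesis
  proof (rule that[OF p(2) \<theta>(2)])
    show "annihilates n {1..m} (\<lambda>w. \<theta> (map_nword \<sigma> w))" if "\<sigma> permutes {1..m}" for \<sigma>
      unfolding annihilates_def I_def[symmetric] using ann closed[OF that] by (metis ext_push)
    show "ext (\<lambda>w. \<theta> (map_nword \<sigma> w)) p = s * ext \<theta> p"
      if \<sigma>: "\<sigma> permutes {1..m}" and s: "act (specht la) \<sigma> e = lc_scale s e" for \<sigma> s
    proof -
      \<comment> \<open>Equality of cosets gives a congruence modulo the ideal, and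
        \<open>\<theta>\<close> does not see the difference.\<close>
      have "p \<in> f e" unfolding p(1) using lc.subspace_0[OF I] by force
      then have "push (map_nword \<sigma>) p \<in> f (lc_scale s e)"
        using f_act[OF \<sigma> e(1)] s by auto
      then obtain i a where i: "push (map_nword \<sigma>) p = i + lc_scale s a" "i \<in> I" "a \<in> f e"
        unfolding f_scale[OF e(1)] by auto
      then obtain i' where "a = i' + p" "i' \<in> I" unfolding p(1) by auto
      then have "ext \<theta> (push (map_nword \<sigma>) p) = s * ext \<theta> p"
        using i ann by simp
      then show ?thesis by simp
    qed
  qed
qed

lemma map_image_tabloid: "map ((`) \<sigma>) (tabloid la t) = tabloid la (\<sigma> \<circ> t)"
  by (auto simp: tabloid_def)

lemma ext_polytabloid:
  "ext \<theta> (polytabloid la t) = (\<Sum>\<sigma>\<in>column_stabilizer la t. of_int (sign \<sigma>) * \<theta> (tabloid la (\<sigma> \<circ> t)))"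
  by (simp add: polytabloid_def)

section \<open>Polytabloids of a fixed tableau\<close>

context
  fixes la :: "nat list" and t :: "nat \<times> nat \<Rightarrow> nat" and m :: nat
  assumes t: "t \<in> tableaux la" and m: "m = sum_list la"
begin

text \<open>These are the classes of letters for the alternation in the lower bound.\<close>

definition column_of :: "nat \<Rightarrow> nat" where
  "column_of x = snd (inv_into (cells la) t x)"

lemma bij_t: "bij_betw t (cells la) {1..m}"
  using t m by (simp add: tableaux_def)

lemma column_of_t: "(i, j) \<in> cells la \<Longrightarrow> column_of (t (i, j)) = j"
  using bij_t by (simp add: column_of_def bij_betw_inv_into_left)

lemma t_in: "(i, j) \<in> cells la \<Longrightarrow> t (i, j) \<in> {1..m}"
  using bij_t by (auto simp: bij_betw_def)

lemma t_cases: assumes "x \<in> {1..m}" obtains i j where "(i, j) \<in> cells la" "x = t (i, j)"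
  using assms bij_t unfolding bij_betw_def by (metis imageE surj_pair)

lemma column_of_less: "x \<in> {1..m} \<Longrightarrow> column_of x \<in> snd ` cells la"
  by (erule t_cases) (force simp: column_of_t)

text \<open>Columns are finite, so a permutation mapping each of them into itself maps it onto
  itself. This form matches the summation range of \<open>alternating_sum_eq_0\<close>.\<close>

lemma column_stabilizer_eq:
  "column_stabilizer la t = {\<sigma>. \<sigma> permutes {1..m} \<and> (\<forall>x\<in>{1..m}. column_of (\<sigma> x) = column_of x)}"
proof -
  have col: "{t (i, j) | i. (i, j) \<in> cells la} = {x \<in> {1..m}. column_of x = j}" for j
  proof (intro equalityI subsetI)
    fix x assume "x \<in> {t (i, j) | i. (i, j) \<in> cells la}"
    then show "x \<in> {x \<in> {1..m}. column_of x = j}" using column_of_t t_in by auto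
  next
    fix x assume x: "x \<in> {x \<in> {1..m}. column_of x = j}"
    then have "x \<in> {1..m}" by simp
    then obtain i j' where "(i, j') \<in> cells la" "x = t (i, j')" by (rule t_cases)
    with x show "x \<in> {t (i, j) | i. (i, j) \<in> cells la}" using column_of_t by auto
  qed
  have "(\<forall>j. \<sigma> ` {x \<in> {1..m}. column_of x = j} = {x \<in> {1..m}. column_of x = j}) \<longleftrightarrow>
      (\<forall>x\<in>{1..m}. column_of (\<sigma> x) = column_of x)" if \<sigma>: "\<sigma> permutes {1..m}" for \<sigma>
  proof
    assume stab: "\<forall>j. \<sigma> ` {x \<in> {1..m}. column_of x = j} = {x \<in> {1..m}. column_of x = j}"
    show "\<forall>x\<in>{1..m}. column_of (\<sigma> x) = column_of x"
    proof
      fix x assume "x \<in> {1..m}"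
      then have "\<sigma> x \<in> \<sigma> ` {y \<in> {1..m}. column_of y = column_of x}" by blast
      then show "column_of (\<sigma> x) = column_of x" unfolding stab[rule_format] by simp
    qed
  next
    assume stab: "\<forall>x\<in>{1..m}. column_of (\<sigma> x) = column_of x"
    have "\<sigma> ` {x \<in> {1..m}. column_of x = j} \<subseteq> {x \<in> {1..m}. column_of x = j}" for j
      using stab permutes_in_image[OF \<sigma>] by auto
    then show "\<forall>j. \<sigma> ` {x \<in> {1..m}. column_of x = j} = {x \<in> {1..m}. column_of x = j}"
      using endo_inj_surj[of "{x \<in> {1..m}. column_of x = _}" \<sigma>] permutes_inj_on[OF \<sigma>] by auto
  qed
  then show ?thesis unfolding column_stabilizer_def col m[symmetric] by blast
qed

lemma column_stabilizer_permutes: "\<sigma> \<in> column_stabilizer la t \<Longrightarrow> \<sigma> permutes {1..m}"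
  by (simp add: column_stabilizer_eq)

lemma column_stabilizer_compose:
  assumes "\<sigma> \<in> column_stabilizer la t" "\<tau> \<in> column_stabilizer la t"
  shows "\<sigma> \<circ> \<tau> \<in> column_stabilizer la t"
  using assms permutes_in_image[of \<tau> "{1..m}"]
  by (auto simp: column_stabilizer_eq intro: permutes_compose)

lemma column_stabilizer_inv:
  assumes "\<sigma> \<in> column_stabilizer la t"
  shows "inv_into UNIV \<sigma> \<in> column_stabilizer la t"
proof -
  have \<sigma>: "\<sigma> permutes {1..m}" and c: "\<And>x. x \<in> {1..m} \<Longrightarrow> column_of (\<sigma> x) = column_of x"
    using assms by (auto simp: column_stabilizer_eq)
  have "column_of (inv_into UNIV \<sigma> x) = column_of x" if "x \<in> {1..m}" for x
  proof -
    have "inv_into UNIV \<sigma> x \<in> {1..m}" using that permutes_in_image[OF permutes_inv[OF \<sigma>]] by blast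
    from c[OF this] show ?thesis using permutes_inverses(1)[OF \<sigma>] by simp
  qed
  then show ?thesis using permutes_inv[OF \<sigma>] by (simp add: column_stabilizer_eq)
qed

lemma sign_compose_permutes:
  "\<sigma> permutes {1..m} \<Longrightarrow> \<tau> permutes {1..m} \<Longrightarrow> sign (\<sigma> \<circ> \<tau>) = sign \<sigma> * sign \<tau>"
  using permutes_imp_permutation[of "{1..m}"] by (simp add: sign_compose)

text \<open>Left multiplication by \<tau> permutes the column group and multiplies every sign by
  that of \<tau>.\<close>

lemma act_column_stabilizer:
  assumes \<tau>: "\<tau> \<in> column_stabilizer la t"
  shows "act (specht la) \<tau> (polytabloid la t) = lc_scale (of_int (sign \<tau>)) (polytabloid la t)"
proof (rule ext_eqI)
  fix \<theta> :: "nat set list \<Rightarrow> complex"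
  let ?C = "column_stabilizer la t"
  note perm = column_stabilizer_permutes
  have inv: "inv_into UNIV \<tau> \<circ> (\<tau> \<circ> \<sigma>) = \<sigma>" "\<tau> \<circ> (inv_into UNIV \<tau> \<circ> \<sigma>) = \<sigma>" for \<sigma>
    using permutes_inv_o[OF perm[OF \<tau>]] by (simp_all flip: comp_assoc)
  have "ext \<theta> (act (specht la) \<tau> (polytabloid la t)) = (\<Sum>\<sigma>\<in>?C. of_int (sign \<sigma>) * \<theta> (tabloid la (\<tau> \<circ> \<sigma> \<circ> t)))"
    by (simp add: specht_simps ext_polytabloid map_image_tabloid comp_assoc)
  also have "\<dots> = (\<Sum>\<sigma>\<in>?C. of_int (sign \<tau>) * (of_int (sign \<sigma>) * \<theta> (tabloid la (\<sigma> \<circ> t))))"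
  proof (rule sum.reindex_bij_witness[where i = "\<lambda>\<sigma>. inv_into UNIV \<tau> \<circ> \<sigma>" and j = "\<lambda>\<sigma>. \<tau> \<circ> \<sigma>"])
    fix \<sigma> assume \<sigma>: "\<sigma> \<in> ?C"
    show "inv_into UNIV \<tau> \<circ> (\<tau> \<circ> \<sigma>) = \<sigma>" "\<tau> \<circ> (inv_into UNIV \<tau> \<circ> \<sigma>) = \<sigma>" by (rule inv)+
    show "\<tau> \<circ> \<sigma> \<in> ?C" "inv_into UNIV \<tau> \<circ> \<sigma> \<in> ?C"
      using \<sigma> \<tau> by (simp_all add: column_stabilizer_compose column_stabilizer_inv)
    have "complex_of_int (sign \<tau>) * of_int (sign \<tau>) = 1" by (simp flip: of_int_mult)
    then show "of_int (sign \<tau>) * (of_int (sign (\<tau> \<circ> \<sigma>)) * \<theta> (tabloid la (\<tau> \<circ> \<sigma> \<circ> t)))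
        = of_int (sign \<sigma>) * \<theta> (tabloid la (\<tau> \<circ> \<sigma> \<circ> t))"
      using sign_compose_permutes[OF perm[OF \<tau>] perm[OF \<sigma>]] by (simp flip: mult.assoc)
  qed
  also have "\<dots> = ext \<theta> (lc_scale (of_int (sign \<tau>)) (polytabloid la t))"
    by (simp add: ext_polytabloid sum_distrib_left)
  finally show "ext \<theta> (act (specht la) \<tau> (polytabloid la t)) = ext \<theta> (lc_scale (of_int (sign \<tau>)) (polytabloid la t))" .
qed

text \<open>Conjugation by \<pi> carries the column group of t to that of \<pi> \<circ> t and
  preserves signs.\<close>

lemma act_polytabloid:
  assumes \<pi>: "\<pi> permutes {1..m}"
  shows "act (specht la) \<pi> (polytabloid la t) = polytabloid la (\<pi> \<circ> t)" and "\<pi> \<circ> t \<in> tableaux la"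
proof -
  show "\<pi> \<circ> t \<in> tableaux la"
    using bij_betw_trans[OF bij_t permutes_imp_bij[OF \<pi>]] by (simp add: tableaux_def m)
  note inv = permutes_inv_o[OF \<pi>]
  note i = permutes_inv[OF \<pi>]
  have col: "{(\<pi> \<circ> t) (i, j) | i. (i, j) \<in> cells la} = \<pi> ` {t (i, j) | i. (i, j) \<in> cells la}" for j
    by auto
  show "act (specht la) \<pi> (polytabloid la t) = polytabloid la (\<pi> \<circ> t)"
  proof (rule ext_eqI)
    fix \<theta> :: "nat set list \<Rightarrow> complex"
    let ?conj = "\<lambda>\<sigma>. \<pi> \<circ> \<sigma> \<circ> inv_into UNIV \<pi>" and ?unconj = "\<lambda>\<sigma>. inv_into UNIV \<pi> \<circ> \<sigma> \<circ> \<pi>"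
    have "ext \<theta> (act (specht la) \<pi> (polytabloid la t)) =
        (\<Sum>\<sigma>\<in>column_stabilizer la t. of_int (sign \<sigma>) * \<theta> (tabloid la (\<pi> \<circ> \<sigma> \<circ> t)))"
      by (simp add: specht_simps ext_polytabloid map_image_tabloid comp_assoc)
    also have "\<dots> = (\<Sum>\<sigma>\<in>column_stabilizer la (\<pi> \<circ> t). of_int (sign \<sigma>) * \<theta> (tabloid la (\<sigma> \<circ> (\<pi> \<circ> t))))"
    proof (rule sum.reindex_bij_witness[where i = ?unconj and j = ?conj])
      fix \<sigma> assume \<sigma>: "\<sigma> \<in> column_stabilizer la t"
      then have p: "\<sigma> permutes {1..m}" by (rule column_stabilizer_permutes)
      show "?unconj (?conj \<sigma>) = \<sigma>" using inv by (simp add: comp_assoc) (simp flip: comp_assoc)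
      show "?conj \<sigma> \<in> column_stabilizer la (\<pi> \<circ> t)"
      proof -
        have "?conj \<sigma> permutes {1..m}" by (intro permutes_compose i p \<pi>)
        moreover have "?conj \<sigma> ` (\<pi> ` S) = \<pi> ` (\<sigma> ` S)" for S
          by (simp add: image_comp comp_def permutes_inverses[OF \<pi>])
        ultimately show ?thesis
          using \<sigma> unfolding column_stabilizer_def col m[symmetric] by (simp only: mem_Collect_eq simp_thms)
      qed
      have "sign (?conj \<sigma>) = sign \<pi> * sign \<sigma> * sign (inv_into UNIV \<pi>)"
        using p i \<pi> by (simp add: sign_compose_permutes permutes_compose)
      then have "sign (?conj \<sigma>) = sign \<sigma>"
        using sign_inverse[OF permutes_imp_permutation[OF _ \<pi>]] by (simp add: mult.commute)
      moreover have "?conj \<sigma> \<circ> (\<pi> \<circ> t) = \<pi> \<circ> \<sigma> \<circ> t"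
        using inv by (simp add: comp_assoc) (simp flip: comp_assoc)
      ultimately show "of_int (sign (?conj \<sigma>)) * \<theta> (tabloid la (?conj \<sigma> \<circ> (\<pi> \<circ> t)))
          = of_int (sign \<sigma>) * \<theta> (tabloid la (\<pi> \<circ> \<sigma> \<circ> t))"
        by (simp only:)
    next
      fix \<sigma> assume \<sigma>: "\<sigma> \<in> column_stabilizer la (\<pi> \<circ> t)"
      then have p: "\<sigma> permutes {1..m}" by (simp add: column_stabilizer_def m)
      show "?conj (?unconj \<sigma>) = \<sigma>" using inv by (simp add: comp_assoc) (simp flip: comp_assoc)
      have "?unconj \<sigma> permutes {1..m}" by (intro permutes_compose i p \<pi>)
      moreover have "?unconj \<sigma> ` S = S" if "\<sigma> ` (\<pi> ` S) = \<pi> ` S" for S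
      proof -
        have "?unconj \<sigma> ` S = inv_into UNIV \<pi> ` (\<sigma> ` (\<pi> ` S))" by (simp add: image_comp comp_assoc)
        also have "\<dots> = S" unfolding that using inv by (simp add: image_comp)
        finally show ?thesis .
      qed
      ultimately show "?unconj \<sigma> \<in> column_stabilizer la t"
        using \<sigma> unfolding column_stabilizer_def col m[symmetric] by (simp only: mem_Collect_eq simp_thms)
    qed
    finally show "ext \<theta> (act (specht la) \<pi> (polytabloid la t)) = ext \<theta> (polytabloid la (\<pi> \<circ> t))"
      by (simp add: ext_polytabloid)
  qed
qed

text \<open>\<pi> moves letters only within the first row and so preserves every row. Hence \<sigma>
  keeps each letter in its row as well as in its column, that is, in its cell.\<close>

lemma row_column_trivial:
  assumes \<pi>: "\<pi> permutes {t (0, j) | j. (0, j) \<in> cells la}" and \<sigma>: "\<sigma> \<in> column_stabilizer la t"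
    and eq: "tabloid la (\<pi> \<circ> \<sigma> \<circ> t) = tabloid la t"
  shows "\<sigma> = id"
proof
  fix x
  have p: "\<sigma> permutes {1..m}" by (rule column_stabilizer_permutes[OF \<sigma>])
  show "\<sigma> x = id x"
  proof (cases "x \<in> {1..m}")
    case True
    then obtain i j where x: "(i, j) \<in> cells la" "x = t (i, j)" by (rule t_cases)
    have "\<sigma> x \<in> {1..m}" using True permutes_in_image[OF p] by blast
    then obtain i' j' where y: "(i', j') \<in> cells la" "\<sigma> x = t (i', j')" by (rule t_cases)
    have "column_of (\<sigma> x) = column_of x" using \<sigma> True by (simp add: column_stabilizer_eq)
    then have [simp]: "j' = j" using x y column_of_t by metis
    have i: "i < length la" using x by (simp add: cells_def)
    have "{(\<pi> \<circ> \<sigma> \<circ> t) (i, j) | j. (i, j) \<in> cells la} = {t (i, j) | j. (i, j) \<in> cells la}"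
      using arg_cong[OF eq, of "\<lambda>l. l ! i"] i by (simp add: tabloid_def)
    then have "\<pi> (\<sigma> x) \<in> {t (i, j) | j. (i, j) \<in> cells la}" using x by auto
    then obtain l where l: "(i, l) \<in> cells la" "\<pi> (\<sigma> x) = t (i, l)" by auto
    have inj: "inj_on t (cells la)" using bij_t by (simp add: bij_betw_def)
    have "i' = i"
    proof (cases "\<sigma> x \<in> {t (0, j) | j. (0, j) \<in> cells la}")
      case True
      then have "\<pi> (\<sigma> x) \<in> {t (0, j) | j. (0, j) \<in> cells la}" using permutes_in_image[OF \<pi>] by blast
      with True show ?thesis using l y inj by (auto dest!: inj_onD[OF inj])
    next
      case False
      then have "\<pi> (\<sigma> x) = \<sigma> x" using \<pi> by (simp add: permutes_def)
      then show ?thesis using l y inj by (auto dest!: inj_onD[OF inj])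
    qed
    then show ?thesis using x y by simp
  next
    case False
    then show ?thesis using permutes_not_in[OF p] by simp
  qed
qed

text \<open>By \<open>row_column_trivial\<close> each \<pi> contributes to the coefficient of the
  tabloid of t through \<sigma> = id alone, so this coefficient is \<open>card G\<close> and nothing
  cancels.\<close>

lemma symmetrized_polytabloid_nonzero:
  assumes G: "G \<noteq> {}" "finite G" "\<And>\<pi>. \<pi> \<in> G \<Longrightarrow> \<pi> permutes {t (0, j) | j. (0, j) \<in> cells la}"
  shows "(\<Sum>\<pi>\<in>G. act (specht la) \<pi> (polytabloid la t)) \<noteq> 0"
proof -
  let ?C = "column_stabilizer la t"
  define \<theta> :: "nat set list \<Rightarrow> complex" where "\<theta> b = (if b = tabloid la t then 1 else 0)" for b
  have id: "id \<in> ?C" by (simp add: column_stabilizer_eq permutes_id)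
  have fin: "finite ?C"
    by (rule finite_subset[of _ "{\<sigma>. \<sigma> permutes {1..m}}"]) (auto simp: column_stabilizer_eq finite_permutations)
  have "ext \<theta> (act (specht la) \<pi> (polytabloid la t)) = 1" if "\<pi> \<in> G" for \<pi>
  proof -
    have \<pi>: "\<pi> permutes {t (0, j) | j. (0, j) \<in> cells la}" using G(3) that .
    have fix_tabloid: "tabloid la (\<pi> \<circ> t) = tabloid la t"
    proof -
      have "\<pi> ` {t (i, j) | j. (i, j) \<in> cells la} = {t (i, j) | j. (i, j) \<in> cells la}" for i
      proof (cases "i = 0")
        case True
        then show ?thesis using permutes_image[OF \<pi>] by simp
      next
        case False
        have "\<pi> (t (i, j)) = t (i, j)" if "(i, j) \<in> cells la" for j
        proof -
          have "t (i, j) \<notin> {t (0, j) | j. (0, j) \<in> cells la}"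
            using False that bij_t by (auto simp: bij_betw_def dest: inj_onD)
          then show ?thesis by (rule permutes_not_in[OF \<pi>])
        qed
        then show ?thesis by force
      qed
      then show ?thesis
        unfolding map_image_tabloid[symmetric] by (simp only: tabloid_def map_map comp_def)
    qed
    have "ext \<theta> (act (specht la) \<pi> (polytabloid la t)) = (\<Sum>\<sigma>\<in>?C. of_int (sign \<sigma>) * \<theta> (tabloid la (\<pi> \<circ> \<sigma> \<circ> t)))"
      by (simp add: specht_simps ext_polytabloid map_image_tabloid comp_assoc)
    also have "\<dots> = (\<Sum>\<sigma>\<in>?C. if \<sigma> = id then 1 else 0)"
      using row_column_trivial[OF \<pi>] fix_tabloid by (intro sum.cong refl) (auto simp: \<theta>_def)
    finally show ?thesis using id fin by simp
  qed
  then have "ext \<theta> (\<Sum>\<pi>\<in>G. act (specht la) \<pi> (polytabloid la t)) = of_nat (card G)" by simp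
  moreover have "card G \<noteq> 0" using G by simp
  ultimately show ?thesis by (metis ext_zero of_nat_eq_0_iff)
qed

end

section \<open>The two bounds on the number of columns\<close>

lemma exists_tableau: "\<exists>t. t \<in> tableaux la"
proof -
  have "cells la = (SIGMA i:{..<length la}. {..<la ! i})" by (auto simp: cells_def)
  then have "finite (cells la)" "card (cells la) = sum_list la"
    by (simp_all add: sum_list_sum_nth atLeast0LessThan)
  then have "\<exists>t. bij_betw t (cells la) {1..sum_list la}" by (intro finite_same_card_bij) auto
  then show ?thesis by (auto simp: tableaux_def)
qed

lemma snd_cells_subset:
  assumes "is_partition m la" "la \<noteq> []"
  shows "snd ` cells la \<subseteq> {..<num_columns la}"
proof -
  have "la ! i \<le> la ! 0" if "i < length la" for i
    using assms(1) that by (cases "i = 0") (auto simp: is_partition_def sorted_wrt_iff_nth_less)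
  then show ?thesis
    unfolding num_columns_eq[OF assms] by (force simp: cells_def)
qed

text \<open>The symmetrized polytabloid is invariant under the group of the first row. Summed over
  this group, the functional takes the group order times its nonzero value on p; yet it vanishes on
  every word, because a first row longer than k exceeds the number of brackets.\<close>

lemma columns_le:
  assumes n: "2 \<le> n" "n \<le> k" and la: "is_partition (k * (n - 1) + 1) la"
    and f: "perm_module_embedding (k * (n - 1) + 1) (specht la) (rho n k) f"
  shows "num_columns la \<le> k"
proof (rule ccontr)
  assume neg: "\<not> ?thesis"
  define m where "m = k * (n - 1) + 1"
  have m: "m = sum_list la" using la by (simp add: m_def is_partition_def)
  then have "la \<noteq> []" by (auto simp: m_def)
  then have j: "k < la ! 0" using neg num_columns_eq[OF la] by simp
  obtain t where t: "t \<in> tableaux la" using exists_tableau by blast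
  define A where "A = {t (0, j) | j. (0, j) \<in> cells la}"
  define e where "e = polytabloid la t"
  have A: "A \<subseteq> {1..m}" using t_in[OF t m] by (auto simp: A_def)
  then have "finite A" by (rule finite_subset) simp
  then have fin: "finite {\<pi>. \<pi> permutes A}" by (rule finite_permutations)
  have "A = t ` (Pair 0 ` {..<la ! 0})" using \<open>la \<noteq> []\<close> by (auto simp: A_def cells_def)
  moreover have "inj_on t (Pair 0 ` {..<la ! 0})"
    using bij_t[OF t m] \<open>la \<noteq> []\<close> by (auto simp: bij_betw_def cells_def intro: inj_on_subset)
  ultimately have "card A = la ! 0" by (simp add: card_image inj_on_def)
  define v where "v = (\<Sum>\<pi> | \<pi> permutes A. act (specht la) \<pi> e)"
  have perm: "\<pi> permutes {1..m}" if "\<pi> permutes A" for \<pi>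
    using that A by (rule permutes_subset)
  have "v \<noteq> 0"
    unfolding v_def e_def using permutes_id[of A] fin
    by (intro symmetrized_polytabloid_nonzero[OF t m]) (auto simp: A_def intro: permutes_id)
  have "v \<in> carrier (specht la)"
    unfolding v_def specht_simps(1)
  proof (rule lc.span_sum)
    fix \<pi> assume "\<pi> \<in> {\<pi>. \<pi> permutes A}"
    then have "\<pi> permutes {1..m}" using perm by simp
    then show "act (specht la) \<pi> e \<in> lc.span (polytabloid la ` tableaux la)"
      unfolding e_def act_polytabloid(1)[OF t m \<open>\<pi> permutes {1..m}\<close>]
      using act_polytabloid(2)[OF t m] by (intro lc.span_base) blast
  qed
  have inv: "act (specht la) \<tau> v = lc_scale 1 v" if \<tau>: "\<tau> permutes A" for \<tau>
  proof (rule ext_eqI)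
    fix \<theta> :: "nat set list \<Rightarrow> complex"
    have "ext \<theta> (act (specht la) \<tau> v) = (\<Sum>\<pi> | \<pi> permutes A. ext \<theta> (act (specht la) (\<tau> \<circ> \<pi>) e))"
      by (simp add: v_def specht_simps image_comp comp_def)
    also have "\<dots> = (\<Sum>\<pi> | \<pi> permutes A. ext \<theta> (act (specht la) \<pi> e))"
      by (rule setum_permutations_compose_left[OF \<tau>, symmetric])
    finally show "ext \<theta> (act (specht la) \<tau> v) = ext \<theta> (lc_scale 1 v)" by (simp add: v_def)
  qed
  obtain p \<theta> where p: "p \<in> lc_over (multilinear_words n {1..m})" "ext \<theta> p \<noteq> 0"
    and ann: "\<And>\<sigma>. \<sigma> permutes {1..m} \<Longrightarrow> annihilates n {1..m} (\<lambda>w. \<theta> (map_nword \<sigma> w))"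
    and eig: "\<And>\<sigma> s. \<sigma> permutes {1..m} \<Longrightarrow> act (specht la) \<sigma> v = lc_scale s v \<Longrightarrow>
      ext (\<lambda>w. \<theta> (map_nword \<sigma> w)) p = s * ext \<theta> p"
    using embedding_functional[OF f n(1) refl \<open>v \<in> carrier (specht la)\<close> \<open>v \<noteq> 0\<close>] unfolding m_def by blast
  have "(\<Sum>\<pi> | \<pi> permutes A. \<theta> (map_nword \<pi> w)) = 0" if "w \<in> multilinear_words n {1..m}" for w
  proof (rule symmetric_sum_eq_0)
    show "w \<in> nwords n {1..m}" using that by (simp add: multilinear_words_def)
    have "mset (letters w) = mset_set {1..m}" using that by (simp add: multilinear_words_def)
    note w = mset_set_letters[OF this finite_atLeastAtMost]
    show "distinct (letters w)" by (rule w)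
    have "brackets w = k"
      using brackets_multilinear[of "n - 1" w k] that n by (simp add: m_def)
    then show "brackets w < card (A \<inter> set (letters w))" "0 < brackets w"
      using w(1) A \<open>card A = la ! 0\<close> j n by (simp_all add: Int_absorb2)
  qed (use ann perm in blast)
  then have "(\<Sum>w\<in>Poly_Mapping.keys p. Poly_Mapping.lookup p w * (\<Sum>\<pi> | \<pi> permutes A. \<theta> (map_nword \<pi> w))) = 0"
    using p(1) by (intro sum.neutral) (auto simp: lc_over_def)
  also have "(\<Sum>w\<in>Poly_Mapping.keys p. Poly_Mapping.lookup p w * (\<Sum>\<pi> | \<pi> permutes A. \<theta> (map_nword \<pi> w)))
      = (\<Sum>\<pi> | \<pi> permutes A. ext (\<lambda>w. \<theta> (map_nword \<pi> w)) p)"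
    unfolding ext_def sum_distrib_left by (rule sum.swap)
  also have "\<dots> = (\<Sum>\<pi> | \<pi> permutes A. ext \<theta> p)"
    using eig[OF perm inv] by (intro sum.cong) auto
  finally show False
    using p(2) fin permutes_id[of A] by auto
qed

text \<open>The same comparison with the polytabloid itself and its signed column group: fewer than
  n columns mean at most r = n - 1 classes of letters, and n \<le> k gives r < k.\<close>

lemma columns_ge:
  assumes n: "2 \<le> n" "n \<le> k" and la: "is_partition (k * (n - 1) + 1) la"
    and f: "perm_module_embedding (k * (n - 1) + 1) (specht la) (rho n k) f"
  shows "n \<le> num_columns la"
proof (rule ccontr)
  assume neg: "\<not> ?thesis"
  define m r where "m = k * (n - 1) + 1" and "r = n - 1"
  have nr: "n = Suc r" "1 \<le> r" "r < k" "m = Suc (k * r)" using n by (auto simp: r_def m_def)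
  have m: "m = sum_list la" using la by (simp add: m_def is_partition_def)
  then have "la \<noteq> []" by (auto simp: m_def)
  obtain t where t: "t \<in> tableaux la" using exists_tableau by blast
  define c where "c = column_of la t"
  define e where "e = polytabloid la t"
  have c: "c x < r" if "x \<in> {1..m}" for x
  proof -
    have "c x < num_columns la"
      using column_of_less[OF t m that] snd_cells_subset[OF la \<open>la \<noteq> []\<close>] unfolding c_def by blast
    with neg show ?thesis by (simp add: r_def)
  qed
  define C where "C = {\<sigma>. \<sigma> permutes {1..m} \<and> (\<forall>x\<in>{1..m}. c (\<sigma> x) = c x)}"
  have C: "C = column_stabilizer la t" unfolding C_def c_def by (rule column_stabilizer_eq[OF t m, symmetric])
  have e: "e \<in> carrier (specht la)"
    unfolding e_def specht_simps(1) using t by (intro lc.span_base) blast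
  have "act (specht la) id e = e"
    by (rule ext_eqI) (simp add: specht_simps image_id id_def[symmetric] list.map_id0[unfolded id_def] list.map_ident)
  then have "e \<noteq> 0"
    using symmetrized_polytabloid_nonzero[OF t m, of "{id}"] permutes_id by (simp add: e_def)
  obtain p \<theta> where p: "p \<in> lc_over (multilinear_words n {1..m})" "ext \<theta> p \<noteq> 0"
    and ann: "\<And>\<sigma>. \<sigma> permutes {1..m} \<Longrightarrow> annihilates n {1..m} (\<lambda>w. \<theta> (map_nword \<sigma> w))"
    and eig: "\<And>\<sigma> s. \<sigma> permutes {1..m} \<Longrightarrow> act (specht la) \<sigma> e = lc_scale s e \<Longrightarrow>
      ext (\<lambda>w. \<theta> (map_nword \<sigma> w)) p = s * ext \<theta> p"
    using embedding_functional[OF f n(1) refl e \<open>e \<noteq> 0\<close>] unfolding m_def by blast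
  have "(\<Sum>\<sigma>\<in>C. of_int (sign \<sigma>) * \<theta> (map_nword \<sigma> w)) = 0" if "w \<in> multilinear_words n {1..m}" for w
    unfolding C_def using alternating_sum_eq_0[OF nr(2,3,4)] ann c that unfolding nr(1) by blast
  then have "(\<Sum>w\<in>Poly_Mapping.keys p. Poly_Mapping.lookup p w * (\<Sum>\<sigma>\<in>C. of_int (sign \<sigma>) * \<theta> (map_nword \<sigma> w))) = 0"
    using p(1) by (intro sum.neutral) (auto simp: lc_over_def)
  also have "(\<Sum>w\<in>Poly_Mapping.keys p. Poly_Mapping.lookup p w * (\<Sum>\<sigma>\<in>C. of_int (sign \<sigma>) * \<theta> (map_nword \<sigma> w)))
      = (\<Sum>\<sigma>\<in>C. of_int (sign \<sigma>) * ext (\<lambda>w. \<theta> (map_nword \<sigma> w)) p)"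
    unfolding ext_def sum_distrib_left by (subst sum.swap) (simp add: mult_ac)
  also have "\<dots> = (\<Sum>\<sigma>\<in>C. ext \<theta> p)"
  proof (rule sum.cong[OF refl])
    fix \<sigma> assume \<sigma>: "\<sigma> \<in> C"
    have "ext (\<lambda>w. \<theta> (map_nword \<sigma> w)) p = of_int (sign \<sigma>) * ext \<theta> p"
    proof (rule eig)
      show "\<sigma> permutes {1..m}" using \<sigma> by (simp add: C_def)
      show "act (specht la) \<sigma> e = lc_scale (of_int (sign \<sigma>)) e"
        unfolding e_def by (rule act_column_stabilizer[OF t m \<sigma>[unfolded C]])
    qed
    moreover have "complex_of_int (sign \<sigma>) * of_int (sign \<sigma>) = 1" by (simp flip: of_int_mult)
    ultimately show "of_int (sign \<sigma>) * ext (\<lambda>w. \<theta> (map_nword \<sigma> w)) p = ext \<theta> p"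
      by (simp flip: mult.assoc)
  qed
  finally have "card C = 0" using p(2) by simp
  moreover have "finite C" "id \<in> C"
    by (auto simp: C_def permutes_id finite_permutations)
  ultimately show False by auto
qed

theorem theorem7p2:
  fixes n k j :: nat and la :: "nat list"
  assumes "1 \<le> n" and "n \<le> k"
    and "is_partition (k * (n - 1) + 1) la"
    and "rho_contains_specht n k la"
    and "num_columns la = j"
  shows "n \<le> j \<and> j \<le> k"
proof (cases "n = 1")
  case True
  \<comment> \<open>For n = 1 the group acts on one letter, and the one-cell diagram is the only
    one.\<close>
  then have la: "is_partition 1 la" using assms(3) by simp
  then have "la \<noteq> []" by (auto simp: is_partition_def)
  then have "la ! 0 \<in> set la" by simp
  moreover from this have "la ! 0 \<le> 1"
    using la member_le_sum_list[of "la ! 0" la] by (simp add: is_partition_def)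
  moreover have "0 \<notin> set la" using la by (simp add: is_partition_def)
  ultimately have "la ! 0 = 1" by (metis One_nat_def le_0_eq le_SucE)
  then show ?thesis
    using num_columns_eq[OF la \<open>la \<noteq> []\<close>] True assms by simp
next
  case False
  with assms obtain f where f: "perm_module_embedding (k * (n - 1) + 1) (specht la) (rho n k) f"
    by (auto simp: rho_contains_specht_def has_submodule_iso_def)
  have "2 \<le> n" using False assms(1) by simp
  from columns_le[OF this assms(2,3) f] columns_ge[OF this assms(2,3) f] show ?thesis
    using assms(5) by simp
qed

end
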